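(* Let $R$ be the coefficient defined in the context. Then $R$ has symmetries under the action of the group $\tilde G$ (which has $96$ elements): for every $\tilde\sigma\in\tilde G$ and every $(k,l,m)\in\mathbb{Z}^3$ there exist $\alpha_1,\dots,\alpha_s\in S_{abc}$ and $n_1,\dots,n_{s+3}\in\mathbb{Z}$ such that $$R(k,l,m;a,b,c;x)=(\alpha_1)_{n_1}\cdots(\alpha_s)_{n_s}(-1)^{n_{s+1}}x^{n_{s+2}}(1-x)^{n_{s+3}}\,(\tilde\sigma R)(k,l,m;a,b,c;x).$$ In fact, for all $(k,l,m)\in\mathbb{Z}^3$: $$R(k,l,m;a,b,c;x)=\frac{(c+1)_{m-1}(c)_{m-1}(-1)^{m-k-l}x^{1-m}(1-x)^{m+1-k-l}}{(a+1)_{k-1}(b+1)_{l-1}(c-a)_{m-k}(c-b)_{m-l}}\,(\tilde\sigma_0R)(k,l,m;a,b,c;x),$$ $$R(k,l,m;a,b,c;x)=(1-x)^{-l}(\tilde\sigma_1R)(k,l,m;a,b,c;x),$$ $$R(k,l,m;a,b,c;x)=\frac{(c)_m(c-a-b)_{m-k-l}}{(c-a)_{m-k}(c-b)_{m-l}}(\tilde\sigma_2R)(k,l,m;a,b,c;x),$$ $$R(k,l,m;a,b,c;x)=(\tilde\sigma_3R)(k,l,m;a,b,c;x).$$ (Each $\tilde\sigma_i$ is an involution, so $(\tilde\sigma_iR)(\vec z)=R(\tilde\sigma_i\vec z)$; e.g. $(\tilde\sigma_0R)(k,l,m;a,b,c;x)=R(2-k,2-l,2-m;a+k-1,b+l-1,c+m-1;x)$,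 $(\tilde\sigma_1R)(k,l,m;a,b,c;x)=R(m+1-k,l,m;c-a-1,b,c;\tfrac{x}{x-1})$, $(\tilde\sigma_2R)(k,l,m;a,b,c;x)=R(k,l,k+l-m;a,b,a+b+1-c;1-x)$, $(\tilde\sigma_3R)(k,l,m;a,b,c;x)=R(l,k,m;b,a,c;x)$.)
   Context: $F(a,b,c;x)=\sum_{n\ge0}\frac{(a)_n(b)_n}{(c)_n n!}x^n$, $(\alpha)_n=\Gamma(\alpha+n)/\Gamma(\alpha)$ for $n\in\mathbb{Z}$. Standing assumption: $a,b,c-a,c-b,c,c-a-b,a-b\notin\mathbb{Z}$. For each $(k,l,m)\in\mathbb{Z}^3$ there is a unique pair $(Q,R)$ of rational functions of $a,b,c,x$ with $F(a+k,b+l,c+m;x)=Q\,F(a+1,b+1,c+1;x)+R\,F(a,b,c;x)$; write $R=R(k,l,m;a,b,c;x)$, and $R(k,l,m;\alpha_1,\alpha_2,\alpha_3;\beta)$ for the substitution $a,b,c,x\mapsto\alpha_1,\alpha_2,\alpha_3,\beta$. Let $S_{abc}=\{n_0+n_1a+n_2b+n_3c:n_i\in\mathbb{Z}\}$, $S_x=\{x,\frac{x}{x-1},1-x,\frac{x-1}{x},\frac1x,\frac1{1-x}\}$, $S=\{(k,l,m;\alpha_1,\alpha_2,\alpha_3;\beta):(k,l,m)\in\mathbb{Z}^3,\alpha_i\in S_{abc},\beta\in S_x\}$, $T$ the rational functions of $a,b,c,x$, $\mathrm{Map}(S,T)$ the functions $S\to T$. Let $\tilde G$ be the group (under composition) of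 maps $S\to S$ generated by $\tilde\sigma_0:(k,l,m;a,b,c;x)\mapsto(2-k,2-l,2-m;a+k-1,b+l-1,c+m-1;x)$, $\tilde\sigma_1:(k,l,m;a,b,c;x)\mapsto(m+1-k,l,m;c-a-1,b,c;\frac{x}{x-1})$, $\tilde\sigma_2:(k,l,m;a,b,c;x)\mapsto(k,l,k+l-m;a,b,a+b+1-c;1-x)$, $\tilde\sigma_3:(k,l,m;a,b,c;x)\mapsto(l,k,m;b,a,c;x)$, acting on $\mathrm{Map}(S,T)$ by $(\tilde\sigma P)(\vec z)=P(\tilde\sigma^{-1}\vec z)$. *)

theory Defs
  imports Complex_Main
begin

definition hypF :: "complex \<Rightarrow> complex \<Rightarrow> complex \<Rightarrow> complex \<Rightarrow> complex" where
  "hypF a b c x = (\<Sum>n. pochhammer a n * pochhammer b n / (pochhammer c n * fact n) * x ^ n)"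

text \<open>Pochhammer symbol with integer index: (alpha)_n = Gamma(alpha+n)/Gamma(alpha),
  written out as the rational function of alpha it equals.\<close>
definition poch :: "complex \<Rightarrow> int \<Rightarrow> complex" where
  "poch \<alpha> n = (if n \<ge> 0 then pochhammer \<alpha> (nat n)
                 else inverse (pochhammer (\<alpha> + of_int n) (nat (- n))))"

definition standing :: "complex \<Rightarrow> complex \<Rightarrow> complex \<Rightarrow> bool" where
  "standing a b c \<longleftrightarrow> a \<notin> \<int> \<and> b \<notin> \<int> \<and> c - a \<notin> \<int> \<and> c - b \<notin> \<int> \<and> c \<notin> \<int>
      \<and> c - a - b \<notin> \<int> \<and> a - b \<notin> \<int>"

type_synonym fun4 = "complex \<Rightarrow> complex \<Rightarrow> complex \<Rightarrow> complex \<Rightarrow> complex"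

inductive polyfun4 :: "fun4 \<Rightarrow> bool" where
  pconst: "polyfun4 (\<lambda>a b c x. k)"
| pvar_a: "polyfun4 (\<lambda>a b c x. a)"
| pvar_b: "polyfun4 (\<lambda>a b c x. b)"
| pvar_c: "polyfun4 (\<lambda>a b c x. c)"
| pvar_x: "polyfun4 (\<lambda>a b c x. x)"
| padd: "polyfun4 p \<Longrightarrow> polyfun4 q \<Longrightarrow> polyfun4 (\<lambda>a b c x. p a b c x + q a b c x)"
| pmult: "polyfun4 p \<Longrightarrow> polyfun4 q \<Longrightarrow> polyfun4 (\<lambda>a b c x. p a b c x * q a b c x)"

text \<open>Equality of rational functions: the identity holds off the zero set of a
  nonzero polynomial (i.e. on a Zariski-dense open set).\<close>
definition generically :: "(complex \<Rightarrow> complex \<Rightarrow> complex \<Rightarrow> complex \<Rightarrow> bool) \<Rightarrow> bool" where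
  "generically P \<longleftrightarrow> (\<exists>g. polyfun4 g \<and> g \<noteq> (\<lambda>a b c x. 0) \<and>
      (\<forall>a b c x. g a b c x \<noteq> 0 \<longrightarrow> P a b c x))"

definition contig_pair :: "int \<Rightarrow> int \<Rightarrow> int \<Rightarrow> fun4 \<Rightarrow> fun4 \<Rightarrow> bool" where
  "contig_pair k l m Q R \<longleftrightarrow>
     (\<exists>pQ qQ pR qR. polyfun4 pQ \<and> polyfun4 qQ \<and> polyfun4 pR \<and> polyfun4 qR \<and>
        qQ \<noteq> (\<lambda>a b c x. 0) \<and> qR \<noteq> (\<lambda>a b c x. 0) \<and>
        Q = (\<lambda>a b c x. pQ a b c x / qQ a b c x) \<and> R = (\<lambda>a b c x. pR a b c x / qR a b c x) \<and>
        (\<forall>a b c x. standing a b c \<and> norm x < 1 \<and> qQ a b c x \<noteq> 0 \<and> qR a b c x \<noteq> 0 \<longrightarrow>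
           hypF (a + of_int k) (b + of_int l) (c + of_int m) x
             = Q a b c x * hypF (a + 1) (b + 1) (c + 1) x + R a b c x * hypF a b c x))"

text \<open>The coefficient R(k,l,m;a,b,c;x) (unique as a rational function).\<close>
definition Rcoef :: "int \<Rightarrow> int \<Rightarrow> int \<Rightarrow> fun4" where
  "Rcoef k l m = (SOME R. \<exists>Q. contig_pair k l m Q R)"

type_synonym aff = "int \<times> int \<times> int \<times> int"

fun eval_aff :: "aff \<Rightarrow> complex \<Rightarrow> complex \<Rightarrow> complex \<Rightarrow> complex" where
  "eval_aff (n0, n1, n2, n3) a b c = of_int n0 + of_int n1 * a + of_int n2 * b + of_int n3 * c"

fun aff_add :: "aff \<Rightarrow> aff \<Rightarrow> aff" where
  "aff_add (n0, n1, n2, n3) (m0, m1, m2, m3) = (n0 + m0, n1 + m1, n2 + m2, n3 + m3)"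

fun aff_sub :: "aff \<Rightarrow> aff \<Rightarrow> aff" where
  "aff_sub (n0, n1, n2, n3) (m0, m1, m2, m3) = (n0 - m0, n1 - m1, n2 - m2, n3 - m3)"

fun aff_shift :: "int \<Rightarrow> aff \<Rightarrow> aff" where
  "aff_shift j (n0, n1, n2, n3) = (n0 + j, n1, n2, n3)"

datatype xform = XId | XDivXm1 | OneMinusX | Xm1DivX | InvX | InvOneMinusX

fun eval_x :: "xform \<Rightarrow> complex \<Rightarrow> complex" where
  "eval_x XId x = x"
| "eval_x XDivXm1 x = x / (x - 1)"
| "eval_x OneMinusX x = 1 - x"
| "eval_x Xm1DivX x = (x - 1) / x"
| "eval_x InvX x = 1 / x"
| "eval_x InvOneMinusX x = 1 / (1 - x)"

fun x_div_xm1 :: "xform \<Rightarrow> xform" where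
  "x_div_xm1 XId = XDivXm1"
| "x_div_xm1 XDivXm1 = XId"
| "x_div_xm1 OneMinusX = Xm1DivX"
| "x_div_xm1 Xm1DivX = OneMinusX"
| "x_div_xm1 InvX = InvOneMinusX"
| "x_div_xm1 InvOneMinusX = InvX"

fun one_minus :: "xform \<Rightarrow> xform" where
  "one_minus XId = OneMinusX"
| "one_minus XDivXm1 = InvOneMinusX"
| "one_minus OneMinusX = XId"
| "one_minus Xm1DivX = InvX"
| "one_minus InvX = Xm1DivX"
| "one_minus InvOneMinusX = XDivXm1"

datatype spt = Spt int int int aff aff aff xform

fun sig0 :: "spt \<Rightarrow> spt" where
  "sig0 (Spt k l m a b c x) =
     Spt (2 - k) (2 - l) (2 - m) (aff_shift (k - 1) a) (aff_shift (l - 1) b) (aff_shift (m - 1) c) x"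

fun sig1 :: "spt \<Rightarrow> spt" where
  "sig1 (Spt k l m a b c x) = Spt (m + 1 - k) l m (aff_shift (-1) (aff_sub c a)) b c (x_div_xm1 x)"

fun sig2 :: "spt \<Rightarrow> spt" where
  "sig2 (Spt k l m a b c x) = Spt k l (k + l - m) a b (aff_shift 1 (aff_sub (aff_add a b) c)) (one_minus x)"

fun sig3 :: "spt \<Rightarrow> spt" where
  "sig3 (Spt k l m a b c x) = Spt l k m b a c x"

definition gens :: "(spt \<Rightarrow> spt) set" where
  "gens = {sig0, sig1, sig2, sig3}"

inductive_set Gt :: "(spt \<Rightarrow> spt) set" where
  Gt_id: "id \<in> Gt"
| Gt_gen: "\<sigma> \<in> Gt \<Longrightarrow> g \<in> gens \<Longrightarrow> g \<circ> \<sigma> \<in> Gt"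
| Gt_inv: "\<sigma> \<in> Gt \<Longrightarrow> g \<in> gens \<Longrightarrow> inv g \<circ> \<sigma> \<in> Gt"

fun Rmap :: "spt \<Rightarrow> fun4" where
  "Rmap (Spt k l m \<alpha>1 \<alpha>2 \<alpha>3 \<beta>) =
     (\<lambda>a b c x. Rcoef k l m (eval_aff \<alpha>1 a b c) (eval_aff \<alpha>2 a b c) (eval_aff \<alpha>3 a b c) (eval_x \<beta> x))"

definition act :: "(spt \<Rightarrow> spt) \<Rightarrow> (spt \<Rightarrow> fun4) \<Rightarrow> (spt \<Rightarrow> fun4)" where
  "act \<sigma> P = (\<lambda>z. P (inv \<sigma> z))"

definition base :: "int \<Rightarrow> int \<Rightarrow> int \<Rightarrow> spt" where
  "base k l m = Spt k l m (0, 1, 0, 0) (0, 0, 1, 0) (0, 0, 0, 1) XId"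

end

theory Submission
  imports Defs "HOL-Analysis.FPS_Convergence"
begin

text \<open>For fixed parameters, \<open>\<Phi>(k, l, m) = F(a+k, b+l, c+m; x)\<close> satisfies three contiguous relations, and
  these alone determine a family \<open>\<Phi>\<close> on the lattice from \<open>\<Phi>(0, 0, 0)\<close> and \<open>\<Phi>(1, 1, 1)\<close>. Since the two basis
  series are linearly independent over \<open>\<complex>(x)\<close>, the coefficients \<open>Q\<close> and \<open>R\<close> are themselves contiguous
  families, \<open>R\<close> being the one with initial values \<open>1\<close> and \<open>0\<close>. The symmetries \<open>\<sigma>\<^sub>1, \<sigma>\<^sub>2, \<sigma>\<^sub>3\<close> (Pfaff's
  transformation, \<open>x \<mapsto> 1 - x\<close>, and the exchange of \<open>a\<close> and \<open>b\<close>) carry contiguous families to contiguous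
  families with the same initial values, so no analytic transformation formula is needed. The symmetry
  \<open>\<sigma>\<^sub>0\<close> inverts the two-by-two transition matrix, and its factor is the determinant of that matrix. All
  identities hold at every point satisfying the standing assumption with \<open>x \<noteq> 0, 1\<close>, and spread from
  there to generic points because they are identities between rational functions.\<close>

subsection \<open>Contiguous families\<close>

text \<open>Three obstacles shape the argument. So the symmetries are proved for rational families
  that satisfy the contiguous relations at every x other than 0 and 1, and the series itself is used
  only inside the disc, to separate the coefficients of the two basis functions.
  \<open>Rcoef\<close> is picked among fractions whose denominators are uncontrolled. A second
  choice, \<open>Rcan\<close>, has denominators that vanish at no point satisfying the standing
  assumption with x other than 0 and 1; this is what makes pointwise arguments possible, and
  \<open>Rcoef\<close> is compared with it only at the end. The standing assumption removes
  infinitely many hyperplanes and is therefore not a Zariski open condition. Polynomial identities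
  pass to the whole space by restriction to a complex line through one fixed good point.\<close>

text \<open>Here \<open>\<Phi> k l m\<close> stands for \<open>F(a+k, b+l, c+m; x)\<close>, and denominators are cleared.\<close>

definition contig :: "complex \<Rightarrow> complex \<Rightarrow> complex \<Rightarrow> complex \<Rightarrow> (int \<Rightarrow> int \<Rightarrow> int \<Rightarrow> complex) \<Rightarrow> bool"
  where "contig a b c x \<Phi> \<longleftrightarrow> (\<forall>k l m.
      (c + of_int m) * \<Phi> (k + 1) l m
        = (c + of_int m) * \<Phi> k l m + (b + of_int l) * x * \<Phi> (k + 1) (l + 1) (m + 1)
    \<and> (c + of_int m) * \<Phi> k (l + 1) m
        = (c + of_int m) * \<Phi> k l m + (a + of_int k) * x * \<Phi> (k + 1) (l + 1) (m + 1)
    \<and> x * (1 - x) * (a + of_int k + 1) * (b + of_int l + 1) * \<Phi> (k + 2) (l + 2) (m + 2)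
        = (c + of_int m + 1) * ((c + of_int m) * \<Phi> k l m
            - (c + of_int m - (a + of_int k + b + of_int l + 1) * x) * \<Phi> (k + 1) (l + 1) (m + 1)))"

lemma contigD:
  assumes "contig a b c x \<Phi>"
  shows contig_raise_a: "(c + of_int m) * \<Phi> (k + 1) l m
        = (c + of_int m) * \<Phi> k l m + (b + of_int l) * x * \<Phi> (k + 1) (l + 1) (m + 1)"
    and contig_raise_b: "(c + of_int m) * \<Phi> k (l + 1) m
        = (c + of_int m) * \<Phi> k l m + (a + of_int k) * x * \<Phi> (k + 1) (l + 1) (m + 1)"
    and contig_diagonal: "x * (1 - x) * (a + of_int k + 1) * (b + of_int l + 1) * \<Phi> (k + 2) (l + 2) (m + 2)
        = (c + of_int m + 1) * ((c + of_int m) * \<Phi> k l m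
            - (c + of_int m - (a + of_int k + b + of_int l + 1) * x) * \<Phi> (k + 1) (l + 1) (m + 1))"
  using assms unfolding contig_def by blast+

lemma contig_swap:
  assumes "contig a b c x \<Phi>"
  shows "contig b a c x (\<lambda>k l m. \<Phi> l k m)"
  unfolding contig_def
proof (intro allI, goal_cases)
  case (1 k l m)
  show ?case
    using contigD[OF assms, where k = l and l = k and m = m] by (simp add: ac_simps)
qed

lemma contig_shift:
  assumes "contig a b c x \<Phi>"
  shows "contig (a + of_int i) (b + of_int j) (c + of_int n) x (\<lambda>k l m. \<Phi> (k + i) (l + j) (m + n))"
  unfolding contig_def
proof (intro allI, goal_cases)
  case (1 k l m)
  show ?case
    using contigD[OF assms, where k = "k + i" and l = "l + j" and m = "m + n"] by (simp add: ac_simps)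
qed

lemma not_Ints_add_of_int: "z \<notin> \<int> \<Longrightarrow> z + of_int n \<noteq> 0" for z :: complex
  by (metis Ints_minus Ints_of_int eq_neg_iff_add_eq_0)

lemma standing_nonzero:
  assumes "standing a b c"
  shows "a + of_int k \<noteq> 0" "b + of_int l \<noteq> 0" "c + of_int m \<noteq> 0"
    "a + of_int k + 1 \<noteq> 0" "b + of_int l + 1 \<noteq> 0" "c + of_int m + 1 \<noteq> 0"
    "c + of_int m - a - of_int k \<noteq> 0" "c + of_int m - b - of_int l \<noteq> 0"
    "c + of_int m - a - of_int k - b - of_int l \<noteq> 0"
    "c + of_int m - a - of_int k - 1 \<noteq> 0" "c + of_int m - b - of_int l - 1 \<noteq> 0"
    "c + of_int m - a - of_int k - b - of_int l - 1 \<noteq> 0"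
  using not_Ints_add_of_int[of a k] not_Ints_add_of_int[of a "k+1"]
    not_Ints_add_of_int[of b l] not_Ints_add_of_int[of b "l+1"]
    not_Ints_add_of_int[of c m] not_Ints_add_of_int[of c "m+1"]
    not_Ints_add_of_int[of "c-a" "m-k"] not_Ints_add_of_int[of "c-b" "m-l"]
    not_Ints_add_of_int[of "c-a-b" "m-k-l"]
    not_Ints_add_of_int[of "c-a" "m-k-1"] not_Ints_add_of_int[of "c-b" "m-l-1"]
    not_Ints_add_of_int[of "c-a-b" "m-k-l-1"] assms
  unfolding standing_def by (auto simp: algebra_simps)

text \<open>The relation for lowering the first parameter, given those for raising it, is equivalent to the
  three-term relation along the diagonal (the hypergeometric equation).\<close>

lemma lower_identity:
  fixes A B C x f f1 f2 g g1 :: complex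
  assumes g: "C * g = C * f + B * x * f1" and g1: "(C + 1) * g1 = (C + 1) * f1 + (B + 1) * x * f2"
  shows "(C + 1) * (C * (C - A - 1 - B * x) * g + x * (1 - x) * (A + 1) * B * g1 - C * (C - A - 1) * f)
     = B * x * (x * (1 - x) * (A + 1) * (B + 1) * f2 - (C + 1) * (C * f - (C - (A + B + 1) * x) * f1))"
proof -
  have "(C + 1) * (C * (C - A - 1 - B * x) * g + x * (1 - x) * (A + 1) * B * g1 - C * (C - A - 1) * f)
     = (C + 1) * (C - A - 1 - B * x) * (C * g) + x * (1 - x) * (A + 1) * B * ((C + 1) * g1)
        - (C + 1) * C * (C - A - 1) * f"
    by (simp add: algebra_simps)
  then show ?thesis
    unfolding g g1 by (simp add: algebra_simps)
qed

lemma contig_lower_a: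
  assumes "contig a b c x \<Phi>" "standing a b c"
  shows "(c + of_int m) * (c + of_int m - a - of_int k) * \<Phi> (k - 1) l m
    = (c + of_int m) * (c + of_int m - a - of_int k - (b + of_int l) * x) * \<Phi> k l m
      + x * (1 - x) * (a + of_int k) * (b + of_int l) * \<Phi> (k + 1) (l + 1) (m + 1)"
proof -
  \<comment> \<open>The base point of \<open>lower_identity\<close> is (k - 1, l, m), so A becomes a
    + k - 1. Its right-hand bracket vanishes by the diagonal relation, and the factor C + 1
    cancels.\<close>
  have "(c + of_int m) * (c + of_int m - (a + of_int k - 1) - 1 - (b + of_int l) * x) * \<Phi> k l m
      + x * (1 - x) * (a + of_int k - 1 + 1) * (b + of_int l) * \<Phi> (k + 1) (l + 1) (m + 1)
      - (c + of_int m) * (c + of_int m - (a + of_int k - 1) - 1) * \<Phi> (k - 1) l m = 0"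
  using lower_identity[of "c + of_int m" "\<Phi> k l m" "\<Phi> (k - 1) l m" "b + of_int l" x
      "\<Phi> k (l + 1) (m + 1)" "\<Phi> (k + 1) (l + 1) (m + 1)" "\<Phi> (k + 1) (l + 2) (m + 2)" "a + of_int k - 1"]
    contigD(1)[OF assms(1), of m "k - 1" l] contigD(1)[OF assms(1), of "m + 1" k "l + 1"]
    contigD(3)[OF assms(1), of "k - 1" l m] standing_nonzero(6)[OF assms(2), of m]
  by (simp add: add.commute add.left_commute)
  moreover have "c + of_int m - (a + of_int k - 1) - 1 = c + of_int m - a - of_int k" by simp
  ultimately show ?thesis by simp
qed

text \<open>Trades the diagonal relation for the lowering one, which is easier to check when a
  substitution reverses the first index, as in \<open>contig_pfaff\<close>. The way back divides by
  (b + l) * x, whence the condition on x.\<close>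

lemma contigI:
  assumes st: "standing a b c" and x: "x \<noteq> 0"
    and a: "\<And>k l m. (c + of_int m) * \<Phi> (k + 1) l m
        = (c + of_int m) * \<Phi> k l m + (b + of_int l) * x * \<Phi> (k + 1) (l + 1) (m + 1)"
    and b: "\<And>k l m. (c + of_int m) * \<Phi> k (l + 1) m
        = (c + of_int m) * \<Phi> k l m + (a + of_int k) * x * \<Phi> (k + 1) (l + 1) (m + 1)"
    and lower: "\<And>k l m. (c + of_int m) * (c + of_int m - a - of_int k) * \<Phi> (k - 1) l m
    = (c + of_int m) * (c + of_int m - a - of_int k - (b + of_int l) * x) * \<Phi> k l m
      + x * (1 - x) * (a + of_int k) * (b + of_int l) * \<Phi> (k + 1) (l + 1) (m + 1)"
  shows "contig a b c x \<Phi>"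
  unfolding contig_def
proof (intro allI conjI, goal_cases)
  case (3 k l m)
  have "(b + of_int l) * x * (x * (1 - x) * (a + of_int k + 1) * (b + of_int l + 1) * \<Phi> (k + 2) (l + 2) (m + 2)
      - (c + of_int m + 1) * ((c + of_int m) * \<Phi> k l m
            - (c + of_int m - (a + of_int k + b + of_int l + 1) * x) * \<Phi> (k + 1) (l + 1) (m + 1))) = 0"
    using lower_identity[of "c + of_int m" "\<Phi> (k + 1) l m" "\<Phi> k l m" "b + of_int l" x
      "\<Phi> (k + 1) (l + 1) (m + 1)" "\<Phi> (k + 2) (l + 1) (m + 1)" "\<Phi> (k + 2) (l + 2) (m + 2)" "a + of_int k"]
     a[of m k l] a[of "m + 1" "k + 1" "l + 1"] lower[of m "k + 1" l]
    by (simp add: add.commute add.left_commute diff_diff_eq)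
  then show ?case
    using standing_nonzero(2)[OF st] x by simp
qed (rule a b)+

lemma standing_swap: "standing a b c \<Longrightarrow> standing b a c"
  using minus_in_Ints_iff[of "a - b"] unfolding standing_def by (auto simp: algebra_simps)

lemma contig_lower_b:
  assumes "contig a b c x \<Phi>" "standing a b c"
  shows "(c + of_int m) * (c + of_int m - b - of_int l) * \<Phi> k (l - 1) m
    = (c + of_int m) * (c + of_int m - b - of_int l - (a + of_int k) * x) * \<Phi> k l m
      + x * (1 - x) * (a + of_int k) * (b + of_int l) * \<Phi> (k + 1) (l + 1) (m + 1)"
  using contig_lower_a[OF contig_swap[OF assms(1)] standing_swap[OF assms(2)], of m l k]
  by (simp add: mult.commute mult.left_commute)

text \<open>The step (1, 0, 1) is what raising k becomes under (k, l, m) to (k, l, k + l - m). It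
  results from eliminating the value at (k + 2, l + 2, m + 2) between the diagonal relation and the
  lowering of b at (k + 1, l + 1, m + 1).\<close>

lemma contig_raise_ac:
  assumes "contig a b c x \<Phi>" "standing a b c"
  shows "(c + of_int m - b - of_int l) * \<Phi> (k + 1) l (m + 1)
    = (c + of_int m) * \<Phi> k l m - (b + of_int l) * (1 - x) * \<Phi> (k + 1) (l + 1) (m + 1)"
proof -
  define A B C where "A = a + of_int k" and "B = b + of_int l" and "C = c + of_int m"
  have "(C + 1) * (C - B) * \<Phi> (k + 1) l (m + 1)
    = (C + 1) * (C - B - (A + 1) * x) * \<Phi> (k + 1) (l + 1) (m + 1)
      + x * (1 - x) * (A + 1) * (B + 1) * \<Phi> (k + 2) (l + 2) (m + 2)"
    using contig_lower_b[OF assms, of "m + 1" "l + 1" "k + 1"]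
    unfolding A_def B_def C_def by (simp add: algebra_simps)
  moreover have "x * (1 - x) * (A + 1) * (B + 1) * \<Phi> (k + 2) (l + 2) (m + 2)
        = (C + 1) * (C * \<Phi> k l m - (C - (A + B + 1) * x) * \<Phi> (k + 1) (l + 1) (m + 1))"
    using contig_diagonal[OF assms(1), of k l m] unfolding A_def B_def C_def by (simp add: add.assoc)
  ultimately have "(C + 1) * ((C - B) * \<Phi> (k + 1) l (m + 1)
     - (C * \<Phi> k l m - B * (1 - x) * \<Phi> (k + 1) (l + 1) (m + 1))) = 0"
    by (simp add: algebra_simps)
  then show ?thesis
    using standing_nonzero(6)[OF assms(2), of m] unfolding B_def C_def by (simp add: diff_diff_eq)
qed

text \<open>Elimination step for \<open>contig_pfaff\<close>: \<alpha> is the first parameter of the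
  source family, and f, f1, f2 are its values along one diagonal. The factor C + 1 clears the
  denominator that comes with \<open>h1\<close> and f2.\<close>

lemma pfaff_raise_b_identity:
  fixes A B C y :: complex
  assumes "C * g = C * f + B * y * f1" "C * h = C * f + \<alpha> * y * f1"
    "(C + 1) * h1 = (C + 1) * f1 + (\<alpha> + 1) * y * f2" "C * g' = C * h + (B + 1) * y * h1"
    "y * (1 - y) * (\<alpha> + 1) * (B + 1) * f2 = (C + 1) * (C * f - (C - (\<alpha> + B + 1) * y) * f1)"
    "A = C - 1 - \<alpha>"
  shows "(C + 1) * (C * (1 - y) * g') = (C + 1) * (C * g - A * y * f1)"
  using assms by algebra

lemma pfaff_lower_a_identity:
  fixes A B C y :: complex
  assumes "C * g = C * f + B * y * f1" "C * p = C * g + B * y * q"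
    "(C + 1) * q = (C + 1) * f1 + (B + 1) * y * f2"
    "y * (1 - y) * (\<alpha> + 1) * (B + 1) * f2 = (C + 1) * (C * f - (C - (\<alpha> + B + 1) * y) * f1)"
    "A = C - 1 - \<alpha>"
  shows "(C + 1) * (C * (C - A) * (1 - y) * p) = (C + 1) * (C * ((C - A) * (1 - y) + B * y) * g - A * B * y * f1)"
  using assms by algebra

subsection \<open>Transformations of contiguous families\<close>

text \<open>Pfaff's formula carries the power -(b + l) of 1 - x; the part with exponent -b is
  constant on the lattice and is dropped. The source parameter c - a - 1 at index m + 1 - k equals
  (c + m) - (a + k), and the offset by one is chosen so that (1, 1, 1) is fixed.\<close>

lemma contig_pfaff:
  assumes st: "standing a b c" and x: "x \<noteq> 0" "x \<noteq> 1" and \<Phi>: "contig (c - a - 1) b c (x / (x - 1)) \<Phi>"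
  shows "contig a b c x (\<lambda>k l m. (1 - x) powi (- l) * \<Phi> (m + 1 - k) l m)"
proof -
  define y where "y = x / (x - 1)"
  have y: "(1 - y) * (1 - x) = 1" "x * (1 - y) = - y" "x = - y * (1 - x)"
    using x by (auto simp: y_def field_simps)
  then have "1 - y \<noteq> 0" by auto
  note \<Phi> = contigD[OF \<Phi>[folded y_def]]
  have w: "(1 - x) powi (- (l + 1)) = (1 - x) powi (- l) * (1 - y)" for l
  proof -
    have "(1 - x) powi (- l) = (1 - x) powi (- (l + 1)) * (1 - x)"
      using power_int_add_1[of "1 - x" "- (l + 1)"] x by simp
    then show ?thesis using y by (simp add: mult.assoc) (simp add: mult.commute)
  qed
  show ?thesis
  proof (rule contigI[OF st x(1)], goal_cases)
    case (1 k l m)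
    define C B f1 w where "C = c + of_int m" and "B = b + of_int l" and "f1 = \<Phi> (m - k + 1) (l + 1) (m + 1)"
      and "w = (1 - x) powi (- l)"
    have "C * \<Phi> (m - k + 1) l m = C * \<Phi> (m - k) l m + B * y * f1"
      using \<Phi>(1)[of m "m - k" l] by (simp add: C_def B_def f1_def)
    moreover have "B * x * (w * (1 - y) * f1) = - (B * w * y * f1)"
      using y(2) by algebra
    ultimately have "C * (w * \<Phi> (m - k) l m) = C * (w * \<Phi> (m - k + 1) l m) + B * x * (w * (1 - y) * f1)"
      by algebra
    then show ?case
      unfolding w C_def B_def f1_def w_def by (simp add: algebra_simps)
  next
    case (2 k l m)
    define C B A w where "C = c + of_int m" and "B = b + of_int l" and "A = a + of_int k"
      and "w = (1 - x) powi (- l)"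
    define f f1 f2 where "f = \<Phi> (m - k) l m" and "f1 = \<Phi> (m - k + 1) (l + 1) (m + 1)"
      and "f2 = \<Phi> (m - k + 2) (l + 2) (m + 2)"
    define g g' where "g = \<Phi> (m - k + 1) l m" and "g' = \<Phi> (m - k + 1) (l + 1) m"
    have "(C + 1) * (C * (1 - y) * g') = (C + 1) * (C * g - A * y * f1)"
    proof (rule pfaff_raise_b_identity)
      show "C * g = C * f + B * y * f1"
        using \<Phi>(1)[of m "m - k" l] by (simp add: C_def B_def g_def f_def f1_def)
      show "C * \<Phi> (m - k) (l + 1) m = C * f + (C - A - 1) * y * f1"
        using \<Phi>(2)[of m "m - k" l] by (simp add: C_def A_def f_def f1_def algebra_simps)
      show "(C + 1) * \<Phi> (m - k + 1) (l + 2) (m + 1) = (C + 1) * f1 + ((C - A - 1) + 1) * y * f2"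
        using \<Phi>(2)[of "m + 1" "m - k + 1" "l + 1"] by (simp add: C_def A_def f2_def f1_def algebra_simps)
      show "C * g' = C * \<Phi> (m - k) (l + 1) m + (B + 1) * y * \<Phi> (m - k + 1) (l + 2) (m + 1)"
        using \<Phi>(1)[of m "m - k" "l + 1"] by (simp add: C_def B_def g'_def algebra_simps)
      show "y * (1 - y) * ((C - A - 1) + 1) * (B + 1) * f2 = (C + 1) * (C * f - (C - ((C - A - 1) + B + 1) * y) * f1)"
        using \<Phi>(3)[of "m - k" l m] by (simp add: C_def B_def A_def f_def f1_def f2_def algebra_simps)
    qed simp
    then have "C * (1 - y) * g' = C * g - A * y * f1"
      using standing_nonzero(6)[OF st, of m] by (simp add: C_def)
    moreover have "A * x * (w * (1 - y) * f1) = - (A * w * y * f1)"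
      using y(2) by algebra
    ultimately have "C * (w * (1 - y) * g') = C * (w * g) + A * x * (w * (1 - y) * f1)"
      by algebra
    then show ?case
      unfolding w C_def A_def f1_def w_def g_def g'_def by (simp add: algebra_simps)
  next
    case (3 k l m)
    define C B A w where "C = c + of_int m" and "B = b + of_int l" and "A = a + of_int k"
      and "w = (1 - x) powi (- l)"
    define f f1 f2 where "f = \<Phi> (m - k) l m" and "f1 = \<Phi> (m - k + 1) (l + 1) (m + 1)"
      and "f2 = \<Phi> (m - k + 2) (l + 2) (m + 2)"
    define g p where "g = \<Phi> (m - k + 1) l m" and "p = \<Phi> (m - k + 2) l m"
    have "(C + 1) * (C * (C - A) * (1 - y) * p) = (C + 1) * (C * ((C - A) * (1 - y) + B * y) * g - A * B * y * f1)"
    proof (rule pfaff_lower_a_identity)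
      show "C * g = C * f + B * y * f1"
        using \<Phi>(1)[of m "m - k" l] by (simp add: C_def B_def g_def f_def f1_def)
      show "C * p = C * g + B * y * \<Phi> (m - k + 2) (l + 1) (m + 1)"
        using \<Phi>(1)[of m "m - k + 1" l] by (simp add: C_def B_def g_def p_def algebra_simps)
      show "(C + 1) * \<Phi> (m - k + 2) (l + 1) (m + 1) = (C + 1) * f1 + (B + 1) * y * f2"
        using \<Phi>(1)[of "m + 1" "m - k + 1" "l + 1"] by (simp add: C_def B_def f2_def f1_def algebra_simps)
      show "y * (1 - y) * ((C - A - 1) + 1) * (B + 1) * f2 = (C + 1) * (C * f - (C - ((C - A - 1) + B + 1) * y) * f1)"
        using \<Phi>(3)[of "m - k" l m] by (simp add: C_def B_def A_def f_def f1_def f2_def algebra_simps)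
    qed simp
    then have "C * (C - A) * (1 - y) * p = C * ((C - A) * (1 - y) + B * y) * g - A * B * y * f1"
      using standing_nonzero(6)[OF st, of m] by (simp add: C_def)
    moreover have "A * x * (w * (1 - y) * f1) = - (A * w * y * f1)"
      using y(2) by algebra
    ultimately have "(1 - y) * (C * (C - A) * (w * p)) = (1 - y) * (C * (C - A - B * x) * (w * g) + x * (1 - x) * A * B * (w * (1 - y) * f1))"
      using y(1,2) by algebra
    then have "C * (C - A) * (w * p) = C * (C - A - B * x) * (w * g) + x * (1 - x) * A * B * (w * (1 - y) * f1)"
      using \<open>1 - y \<noteq> 0\<close> by simp
    then show ?case
      unfolding w C_def A_def B_def f1_def w_def g_def p_def by (simp add: algebra_simps)
  qed
qed

subsection \<open>The Casoratian of two families\<close>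

definition casoratian :: "(int \<Rightarrow> int \<Rightarrow> int \<Rightarrow> complex) \<Rightarrow> (int \<Rightarrow> int \<Rightarrow> int \<Rightarrow> complex) \<Rightarrow> int \<Rightarrow> int \<Rightarrow> int \<Rightarrow> complex"
  where "casoratian \<Phi> \<Psi> k l m = \<Phi> k l m * \<Psi> (k + 1) (l + 1) (m + 1) - \<Phi> (k + 1) (l + 1) (m + 1) * \<Psi> k l m"

text \<open>Raising k acts on the pair of values at (k, l, m) and (k + 1, l + 1, m + 1) by a
  two-by-two matrix that is the same for all contiguous families; the Casoratian is multiplied by
  its determinant.\<close>

lemma casoratian_raise_a:
  assumes \<Phi>: "contig a b c x \<Phi>" and \<Psi>: "contig a b c x \<Psi>" and st: "standing a b c"
  shows "(1 - x) * (a + of_int k + 1) * casoratian \<Phi> \<Psi> (k + 1) l m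
    = (a + of_int k + 1 - c - of_int m) * casoratian \<Phi> \<Psi> k l m"
proof -
  define A B C where "A = a + of_int k" and "B = b + of_int l" and "C = c + of_int m"
  define f f1 f2 g g1 where "f = \<Phi> k l m" and "f1 = \<Phi> (k + 1) (l + 1) (m + 1)"
    and "f2 = \<Phi> (k + 2) (l + 2) (m + 2)" and "g = \<Phi> (k + 1) l m" and "g1 = \<Phi> (k + 2) (l + 1) (m + 1)"
  define p p1 p2 q q1 where "p = \<Psi> k l m" and "p1 = \<Psi> (k + 1) (l + 1) (m + 1)"
    and "p2 = \<Psi> (k + 2) (l + 2) (m + 2)" and "q = \<Psi> (k + 1) l m" and "q1 = \<Psi> (k + 2) (l + 1) (m + 1)"
  have nz: "C * (C + 1) \<noteq> 0"
    using standing_nonzero[OF st] by (auto simp: B_def C_def)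
  have 1: "C * g = C * f + B * x * f1" "(C + 1) * g1 = (C + 1) * f1 + (B + 1) * x * f2"
     "x * (1 - x) * (A + 1) * (B + 1) * f2 = (C + 1) * (C * f - (C - (A + B + 1) * x) * f1)"
     "C * q = C * p + B * x * p1" "(C + 1) * q1 = (C + 1) * p1 + (B + 1) * x * p2"
     "x * (1 - x) * (A + 1) * (B + 1) * p2 = (C + 1) * (C * p - (C - (A + B + 1) * x) * p1)"
    using contigD[OF \<Phi>, where k = k and l = l and m = m] contigD(1)[OF \<Phi>, of "m+1" "k+1" "l+1"]
     contigD[OF \<Psi>, where k = k and l = l and m = m] contigD(1)[OF \<Psi>, of "m+1" "k+1" "l+1"]
    unfolding A_def B_def C_def f_def f1_def f2_def g_def g1_def p_def p1_def p2_def q_def q1_def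
    by (simp_all add: add.assoc)
  \<comment> \<open>Eliminating f2 makes the second entry of the raised pair a combination of f and
    f1 again.\<close>
  have 2: "(1 - x) * (A + 1) * g1 = C * f + ((1 - x) * (A + 1) - (C - (A + B + 1) * x)) * f1"
    if "(C + 1) * g1 = (C + 1) * f1 + (B + 1) * x * f2"
     "x * (1 - x) * (A + 1) * (B + 1) * f2 = (C + 1) * (C * f - (C - (A + B + 1) * x) * f1)" for f f1 f2 g1
  proof -
    have "(C + 1) * ((1 - x) * (A + 1) * g1) = (C + 1) * (C * f + ((1 - x) * (A + 1) - (C - (A + B + 1) * x)) * f1)"
      using that by algebra
    then show ?thesis using nz by simp
  qed
  have "C * ((1 - x) * (A + 1) * (g * q1 - g1 * q)) = (C * g) * ((1 - x) * (A + 1) * q1) - ((1 - x) * (A + 1) * g1) * (C * q)"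
    by (simp add: algebra_simps)
  also have "\<dots> = C * ((A + 1 - C) * (f * p1 - f1 * p))"
    unfolding 1(1,4) 2[OF 1(2,3)] 2[OF 1(5,6)] by (simp add: algebra_simps)
  finally show ?thesis
    using nz unfolding casoratian_def A_def B_def C_def f_def f1_def f2_def g_def g1_def p_def p1_def p2_def q_def q1_def
    by (simp add: add.assoc diff_diff_eq)
qed

lemma casoratian_raise_b:
  assumes \<Phi>: "contig a b c x \<Phi>" and \<Psi>: "contig a b c x \<Psi>" and st: "standing a b c"
  shows "(1 - x) * (b + of_int l + 1) * casoratian \<Phi> \<Psi> k (l + 1) m
    = (b + of_int l + 1 - c - of_int m) * casoratian \<Phi> \<Psi> k l m"
  using casoratian_raise_a[OF contig_swap[OF \<Phi>] contig_swap[OF \<Psi>] standing_swap[OF st], of l k m]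
  by (simp add: casoratian_def)

text \<open>Discrete Abel formula: in a three-term recurrence the middle coefficient cancels from
  the determinant and only the two outer ones survive.\<close>

lemma casoratian_diagonal:
  assumes \<Phi>: "contig a b c x \<Phi>" and \<Psi>: "contig a b c x \<Psi>"
  shows "x * (1 - x) * (a + of_int k + 1) * (b + of_int l + 1) * casoratian \<Phi> \<Psi> (k + 1) (l + 1) (m + 1)
    = - ((c + of_int m) * (c + of_int m + 1) * casoratian \<Phi> \<Psi> k l m)"
proof -
  define A B C where "A = a + of_int k" and "B = b + of_int l" and "C = c + of_int m"
  define f f1 f2 where "f = \<Phi> k l m" and "f1 = \<Phi> (k + 1) (l + 1) (m + 1)"
    and "f2 = \<Phi> (k + 2) (l + 2) (m + 2)"
  define p p1 p2 where "p = \<Psi> k l m" and "p1 = \<Psi> (k + 1) (l + 1) (m + 1)"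
    and "p2 = \<Psi> (k + 2) (l + 2) (m + 2)"
  have 1:
     "x * (1 - x) * (A + 1) * (B + 1) * f2 = (C + 1) * (C * f - (C - (A + B + 1) * x) * f1)"
     "x * (1 - x) * (A + 1) * (B + 1) * p2 = (C + 1) * (C * p - (C - (A + B + 1) * x) * p1)"
    using contigD(3)[OF \<Phi>, of k l m] contigD(3)[OF \<Psi>, of k l m]
    unfolding A_def B_def C_def f_def f1_def f2_def p_def p1_def p2_def
    by (simp_all add: add.assoc)
  have "x * (1 - x) * (A + 1) * (B + 1) * (f1 * p2 - f2 * p1) = - (C * (C + 1) * (f * p1 - f1 * p))"
    using 1 by algebra
  then show ?thesis
    unfolding casoratian_def A_def B_def C_def f_def f1_def f2_def p_def p1_def p2_def
    by (simp add: add.assoc)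
qed

subsection \<open>Pochhammer symbols with integer index\<close>

lemma poch_add_1:
  assumes "\<alpha> \<notin> \<int>"
  shows "poch \<alpha> (n + 1) = (\<alpha> + of_int n) * poch \<alpha> n"
proof (cases "n \<ge> 0")
  case True
  then show ?thesis
    by (simp add: poch_def nat_add_distrib pochhammer_Suc mult.commute)
next
  case False
  \<comment> \<open>For negative n the inverted product has the j + 1 factors \<alpha> + n up to
    \<alpha> - 1; raising n drops the first of them.\<close>
  define j where "j = nat (- n - 1)"
  have n: "n = - 1 - int j" using False by (simp add: j_def)
  have nz: "\<alpha> + of_int n \<noteq> 0" using not_Ints_add_of_int[OF assms] .
  have "poch \<alpha> (n + 1) = inverse (pochhammer (\<alpha> + of_int n + 1) j)"
    by (cases j) (simp_all add: poch_def n nat_add_distrib algebra_simps)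
  moreover have "nat (- n) = Suc j" using n by simp
  then have "poch \<alpha> n = inverse ((\<alpha> + of_int n) * pochhammer (\<alpha> + of_int n + 1) j)"
    using False by (simp add: poch_def pochhammer_rec)
  ultimately show ?thesis using nz by simp
qed

lemma poch_nonzero: "\<alpha> \<notin> \<int> \<Longrightarrow> poch \<alpha> n \<noteq> 0"
proof -
  assume \<alpha>: "\<alpha> \<notin> \<int>"
  have "pochhammer (\<alpha> + of_int i) j \<noteq> 0" for i j
  proof
    assume "pochhammer (\<alpha> + of_int i) j = 0"
    then obtain k where "\<alpha> + of_int i = - of_nat k" by (auto simp: pochhammer_eq_0_iff)
    then have "\<alpha> + of_int (i + int k) = 0" by (simp add: add.assoc [symmetric])
    then show False using not_Ints_add_of_int[OF \<alpha>] by blast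
  qed
  from this[of 0 "nat n"] this[of n "nat (- n)"] show ?thesis by (simp add: poch_def)
qed

text \<open>Lets a quotient of Pochhammer symbols be rewritten as a product of such symbols, the
  form demanded of the prefactor. Total inversion makes it hold at poles as well.\<close>

lemma poch_inverse: "inverse (poch \<alpha> n) = poch (\<alpha> + of_int n) (- n)"
  by (cases "n > 0"; cases "n = 0") (auto simp: poch_def)

lemma poch_0 [simp]: "poch \<alpha> 0 = 1"
  by (simp add: poch_def)

lemma int_shift_invariant:
  fixes g :: "int \<Rightarrow> 'a"
  assumes "\<And>j. g (j + 1) = g j"
  shows "g j = g 0"
proof (induction j rule: int_induct[where k = 0])
  case (step2 i)
  then show ?case using assms[of "i - 1"] by simp
qed (simp_all add: assms)

text \<open>The three steps generate the lattice: a point first moves along its diagonal to third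
  index 0, then parallel to the two remaining axes.\<close>

lemma lattice_shift_invariant:
  fixes f :: "int \<Rightarrow> int \<Rightarrow> int \<Rightarrow> 'a"
  assumes "\<And>k l m. f (k + 1) l m = f k l m" "\<And>k l m. f k (l + 1) m = f k l m"
    "\<And>k l m. f (k + 1) (l + 1) (m + 1) = f k l m"
  shows "f k l m = f k' l' m'"
proof -
  have "f k l m = f 0 0 0" for k l m
    using int_shift_invariant[of "\<lambda>j. f (k - m + j) (l - m + j) j" m]
      int_shift_invariant[of "\<lambda>j. f j (l - m) 0" "k - m"]
      int_shift_invariant[of "\<lambda>j. f 0 j 0" "l - m"] assms
    by (simp flip: add.assoc)
  then show ?thesis by metis
qed

definition sig0_factor :: "int \<Rightarrow> int \<Rightarrow> int \<Rightarrow> fun4" where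
  "sig0_factor k l m a b c x = poch (c + 1) (m - 1) * poch c (m - 1) * (-1) powi (m - k - l) * x powi (1 - m)
          * (1 - x) powi (m + 1 - k - l)
        / (poch (a + 1) (k - 1) * poch (b + 1) (l - 1) * poch (c - a) (m - k) * poch (c - b) (m - l))"

text \<open>The Gamma quotient of Gauss's value F(a, b, c; 1) at the shifted parameters, divided by
  the same quotient at the original ones. It is thus the relative connection coefficient of F(a, b,
  a + b + 1 - c; 1 - x).\<close>

definition sig2_factor :: "int \<Rightarrow> int \<Rightarrow> int \<Rightarrow> complex \<Rightarrow> complex \<Rightarrow> complex \<Rightarrow> complex" where
  "sig2_factor k l m a b c
     = poch c m * poch (c - a - b) (m - k - l) / (poch (c - a) (m - k) * poch (c - b) (m - l))"

lemma standing_not_Ints: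
  assumes "standing a b c"
  shows "a \<notin> \<int>" "b \<notin> \<int>" "c \<notin> \<int>" "c - a \<notin> \<int>" "c - b \<notin> \<int>" "c - a - b \<notin> \<int>" "a - b \<notin> \<int>"
    "a + 1 \<notin> \<int>" "b + 1 \<notin> \<int>" "c + 1 \<notin> \<int>"
  using assms by (auto simp: standing_def)

section \<open>The reflection x to 1 - x and the closed form of the Casoratian\<close>

context
  fixes a b c :: complex
  assumes st: "standing a b c"
begin

lemma sig2_factor_raise:
  "(c + of_int m - a - of_int k - b - of_int l - 1) * sig2_factor (k + 1) l m a b c
      = (c + of_int m - a - of_int k - 1) * sig2_factor k l m a b c"
  "(c + of_int m - a - of_int k - b - of_int l - 1) * sig2_factor k (l + 1) m a b c
      = (c + of_int m - b - of_int l - 1) * sig2_factor k l m a b c"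
  "(c + of_int m - a - of_int k - b - of_int l - 1) * sig2_factor (k + 1) (l + 1) (m + 1) a b c
      = (c + of_int m) * sig2_factor k l m a b c"
proof -
  note n = standing_not_Ints[OF st]
  have *: "poch (c - a) (m - k) = (c + of_int m - a - of_int k - 1) * poch (c - a) (m - (k + 1))"
    using poch_add_1[OF n(4), of "m - (k + 1)"] by (simp add: algebra_simps)
  have **: "poch (c - b) (m - l) = (c + of_int m - b - of_int l - 1) * poch (c - b) (m - (l + 1))"
    using poch_add_1[OF n(5), of "m - (l + 1)"] by (simp add: algebra_simps)
  have ***: "poch (c - a - b) (m - k - l)
    = (c + of_int m - a - of_int k - b - of_int l - 1) * poch (c - a - b) (m - k - l - 1)"
    using poch_add_1[OF n(6), of "m - k - l - 1"] by (simp add: algebra_simps)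
  note nz = standing_nonzero[OF st] n[THEN poch_nonzero]
  show "(c + of_int m - a - of_int k - b - of_int l - 1) * sig2_factor (k + 1) l m a b c
      = (c + of_int m - a - of_int k - 1) * sig2_factor k l m a b c"
    using nz * *** by (simp add: sig2_factor_def divide_simps) (simp add: algebra_simps)
  show "(c + of_int m - a - of_int k - b - of_int l - 1) * sig2_factor k (l + 1) m a b c
      = (c + of_int m - b - of_int l - 1) * sig2_factor k l m a b c"
    using nz ** *** by (simp add: sig2_factor_def divide_simps) (simp add: algebra_simps)
  show "(c + of_int m - a - of_int k - b - of_int l - 1) * sig2_factor (k + 1) (l + 1) (m + 1) a b c
      = (c + of_int m) * sig2_factor k l m a b c"
    using nz *** poch_add_1[OF n(3), of m]
    by (simp add: sig2_factor_def divide_simps) (simp add: algebra_simps)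
qed

text \<open>The index map (k, l, m) to (k, l, k + l - m) preserves diagonal steps and turns raising
  k or l alone into raising it together with the third index. The factor absorbs the change of
  normalisation between the two sets of relations.\<close>

lemma contig_reflect:
  assumes \<Phi>: "contig a b (a + b + 1 - c) (1 - x) \<Phi>"
    and st': "standing a b (a + b + 1 - c)"
  shows "contig a b c x (\<lambda>k l m. sig2_factor k l m a b c * \<Phi> k l (k + l - m))"
  unfolding contig_def
proof (intro allI, goal_cases)
  case (1 k l m)
  \<comment> \<open>Here -D is the third parameter a + b + 1 - c + (k + l - m) of the source family,
    so D and D - 1 are the denominators that have to be cleared.\<close>
  define A B C D where "A = a + of_int k" and "B = b + of_int l" and "C = c + of_int m"
    and "D = C - A - B - 1"
  define \<pi> where "\<pi> = (\<lambda>k l m. sig2_factor k l m a b c)"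
  have D: "D \<noteq> 0" "D - 1 \<noteq> 0"
    using standing_nonzero(12)[OF st, of m k l] standing_nonzero(12)[OF st, of m "k + 1" l]
    by (auto simp: A_def B_def C_def D_def algebra_simps)
  have \<pi>: "D * \<pi> (k + 1) l m = (C - A - 1) * \<pi> k l m" "D * \<pi> k (l + 1) m = (C - B - 1) * \<pi> k l m"
    "D * \<pi> (k + 1) (l + 1) (m + 1) = C * \<pi> k l m"
    using sig2_factor_raise[of m k l] by (simp_all add: \<pi>_def A_def B_def C_def D_def algebra_simps)
  have \<pi>2: "(D - 1) * \<pi> (k + 2) (l + 2) (m + 2) = (C + 1) * \<pi> (k + 1) (l + 1) (m + 1)"
    using sig2_factor_raise(3)[of "m+1" "k+1" "l+1"] by (simp add: \<pi>_def A_def B_def C_def D_def algebra_simps)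
  define f f1 f2 g h where "f = \<Phi> k l (k + l - m)" and "f1 = \<Phi> (k + 1) (l + 1) (k + l - m + 1)"
    and "f2 = \<Phi> (k + 2) (l + 2) (k + l - m + 2)"
    and "g = \<Phi> (k + 1) l (k + l - m + 1)" and "h = \<Phi> k (l + 1) (k + l - m + 1)"
  have g: "(C - A - 1) * g = D * f + B * x * f1"
    using contig_raise_ac[OF \<Phi> st', of "k + l - m" l k]
    by (simp add: A_def B_def C_def D_def g_def f_def f1_def algebra_simps)
  have h: "(C - B - 1) * h = D * f + A * x * f1"
    using contig_raise_ac[OF contig_swap[OF \<Phi>], of "k + l - m" k l] standing_swap[OF st']
    by (simp add: A_def B_def C_def D_def h_def f_def f1_def algebra_simps)
  have f: "x * (1 - x) * (A + 1) * (B + 1) * f2 = (D - 1) * (D * f - (C - (A + B + 1) * x) * f1)"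
    using contigD(3)[OF \<Phi>, of k l "k + l - m"]
    by (simp add: A_def B_def C_def D_def f2_def f_def f1_def algebra_simps)
  have "D * (C * (\<pi> (k + 1) l m * g)) = D * (C * (\<pi> k l m * f) + B * x * (\<pi> (k + 1) (l + 1) (m + 1) * f1))"
    using \<pi> g by algebra
  moreover have "D * (C * (\<pi> k (l + 1) m * h)) = D * (C * (\<pi> k l m * f) + A * x * (\<pi> (k + 1) (l + 1) (m + 1) * f1))"
    using \<pi> h by algebra
  moreover have "D * (D - 1) * (x * (1 - x) * (A + 1) * (B + 1) * (\<pi> (k + 2) (l + 2) (m + 2) * f2))
     = D * (D - 1) * ((C + 1) * (C * (\<pi> k l m * f) - (C - (A + B + 1) * x) * (\<pi> (k + 1) (l + 1) (m + 1) * f1)))"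
  proof -
    have "D * ((D - 1) * \<pi> (k + 2) (l + 2) (m + 2)) = (C + 1) * C * \<pi> k l m"
      unfolding \<pi>2 using \<pi>(3) by algebra
    then show ?thesis using \<pi>(3) f by algebra
  qed
  ultimately have "C * (\<pi> (k + 1) l m * g) = C * (\<pi> k l m * f) + B * x * (\<pi> (k + 1) (l + 1) (m + 1) * f1)"
    "C * (\<pi> k (l + 1) m * h) = C * (\<pi> k l m * f) + A * x * (\<pi> (k + 1) (l + 1) (m + 1) * f1)"
    "x * (1 - x) * (A + 1) * (B + 1) * (\<pi> (k + 2) (l + 2) (m + 2) * f2)
     = (C + 1) * (C * (\<pi> k l m * f) - (C - (A + B + 1) * x) * (\<pi> (k + 1) (l + 1) (m + 1) * f1))"
    using D by simp_all
  moreover have "k + 1 + l - m = k + l - m + 1" "k + (l + 1) - m = k + l - m + 1"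
    "k + 1 + (l + 1) - (m + 1) = k + l - m + 1" "k + 2 + (l + 2) - (m + 2) = k + l - m + 2"
    by auto
  ultimately show ?case
    unfolding A_def B_def C_def \<pi>_def f_def f1_def f2_def g_def h_def by (simp only: add.assoc)
qed

text \<open>Both sides obey the same first-order recurrences, with nonvanishing coefficients, along
  three steps that generate the lattice; hence their quotient is constant. It is read off at (1, 1,
  1), where the shifted Casoratian sits at the origin and the factor is -1.\<close>

lemma casoratian_eq:
  assumes \<Phi>: "contig a b c x \<Phi>" and \<Psi>: "contig a b c x \<Psi>" and x: "x \<noteq> 0" "x \<noteq> 1"
  shows "casoratian \<Phi> \<Psi> (k - 1) (l - 1) (m - 1) = - sig0_factor k l m a b c x * casoratian \<Phi> \<Psi> 0 0 0"
proof -
  define P where "P = (\<lambda>k l m. sig0_factor k l m a b c x)"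
  define D where "D = (\<lambda>k l m. casoratian \<Phi> \<Psi> (k - 1) (l - 1) (m - 1))"
  note n = standing_not_Ints[OF st]
  have P: "P k l m \<noteq> 0" for k l m
    using n[THEN poch_nonzero] x by (simp add: P_def sig0_factor_def)
  have pw: "z powi (n - 1) = z powi n / z" if "z \<noteq> 0" for z :: complex and n
    using that by (simp add: power_int_diff)
  have P1: "(1 - x) * (a + of_int k) * P (k + 1) l m = (a + of_int k - c - of_int (m - 1)) * P k l m" for k l m
  proof -
    have *: "poch (c - a) (m - k) = (c + of_int m - a - of_int k - 1) * poch (c - a) (m - (k + 1))"
      using poch_add_1[OF n(4), of "m - (k + 1)"] by (simp add: algebra_simps)
    have **: "poch (a + 1) k = (a + of_int k) * poch (a + 1) (k - 1)"
      using poch_add_1[OF n(8), of "k - 1"] by (simp add: algebra_simps)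
    have 1: "(-1) powi (m - (k + 1) - l) = - ((-1) powi (m - k - l) :: complex)"
      using pw[of "-1" "m - k - l"] by (simp add: algebra_simps)
    have 2: "(1 - x) powi (m + 1 - (k + 1) - l) = (1 - x) powi (m + 1 - k - l) / (1 - x)"
      using pw[of "1 - x" "m + 1 - k - l"] x by (simp add: algebra_simps)
    have 3: "k + 1 - 1 = k" by simp
    show ?thesis
      unfolding P_def sig0_factor_def * ** 1 2 3
      using n[THEN poch_nonzero] x standing_nonzero[OF st]
      by (simp add: divide_simps) (simp add: algebra_simps)
  qed
  have P2: "(1 - x) * (b + of_int l) * P k (l + 1) m = (b + of_int l - c - of_int (m - 1)) * P k l m" for k l m
  proof -
    have *: "poch (c - b) (m - l) = (c + of_int m - b - of_int l - 1) * poch (c - b) (m - (l + 1))"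
      using poch_add_1[OF n(5), of "m - (l + 1)"] by (simp add: algebra_simps)
    have **: "poch (b + 1) l = (b + of_int l) * poch (b + 1) (l - 1)"
      using poch_add_1[OF n(9), of "l - 1"] by (simp add: algebra_simps)
    have 1: "(-1) powi (m - k - (l + 1)) = - ((-1) powi (m - k - l) :: complex)"
      using pw[of "-1" "m - k - l"] by (simp add: algebra_simps)
    have 2: "(1 - x) powi (m + 1 - k - (l + 1)) = (1 - x) powi (m + 1 - k - l) / (1 - x)"
      using pw[of "1 - x" "m + 1 - k - l"] x by (simp add: algebra_simps)
    have 3: "l + 1 - 1 = l" by simp
    show ?thesis
      unfolding P_def sig0_factor_def * ** 1 2 3
      using n[THEN poch_nonzero] x standing_nonzero[OF st]
      by (simp add: divide_simps) (simp add: algebra_simps)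
  qed
  have P3: "x * (1 - x) * (a + of_int k) * (b + of_int l) * P (k + 1) (l + 1) (m + 1)
     = - ((c + of_int (m - 1)) * (c + of_int m)) * P k l m" for k l m
  proof -
    have a: "poch (a + 1) k = (a + of_int k) * poch (a + 1) (k - 1)"
      using poch_add_1[OF n(8), of "k - 1"] by (simp add: algebra_simps)
    have b: "poch (b + 1) l = (b + of_int l) * poch (b + 1) (l - 1)"
      using poch_add_1[OF n(9), of "l - 1"] by (simp add: algebra_simps)
    have c: "poch (c + 1) m = (c + of_int m) * poch (c + 1) (m - 1)"
      using poch_add_1[OF n(10), of "m - 1"] by (simp add: algebra_simps)
    have c': "poch c m = (c + of_int (m - 1)) * poch c (m - 1)"
      using poch_add_1[OF n(3), of "m - 1"] by (simp add: algebra_simps)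
    have 1: "(-1) powi (m + 1 - (k + 1) - (l + 1)) = - ((-1) powi (m - k - l) :: complex)"
      using pw[of "-1" "m - k - l"] by (simp add: algebra_simps)
    have 2: "(1 - x) powi (m + 1 + 1 - (k + 1) - (l + 1)) = (1 - x) powi (m + 1 - k - l) / (1 - x)"
      using pw[of "1 - x" "m + 1 - k - l"] x by (simp add: algebra_simps)
    have 4: "x powi (1 - (m + 1)) = x powi (1 - m) / x"
      using pw[of x "1 - m"] x by (simp add: algebra_simps)
    have 3: "j + 1 - 1 = j" "m + 1 - (k + 1) = m - k" "m + 1 - (l + 1) = m - l" for j :: int by auto
    show ?thesis
      unfolding P_def sig0_factor_def 1 2 4 unfolding 3 a b c c'
      using n[THEN poch_nonzero] x standing_nonzero[OF st]
      by (simp add: divide_simps)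
  qed
  have ratio: "d' / p' = d / p" if "u * d' = v * d" "u * p' = v * p" "u \<noteq> 0" "v \<noteq> 0" for u v d d' p p' :: complex
    using that by (metis mult_divide_mult_cancel_left)
  have "D k l m / P k l m = D 1 1 1 / P 1 1 1"
  proof (rule lattice_shift_invariant[of "\<lambda>k l m. D k l m / P k l m"], goal_cases)
    case (1 k l m)
    have "a + of_int k - c - of_int (m - 1) = - (c + of_int (m - 1) - a - of_int k)" by simp
    then have "a + of_int k - c - of_int (m - 1) \<noteq> 0" "(1 - x) * (a + of_int k) \<noteq> 0"
      using standing_nonzero(1,7)[OF st] x by (simp_all only: neg_equal_0_iff_equal) simp_all
    moreover have "(1 - x) * (a + of_int k) * D (k + 1) l m = (a + of_int k - c - of_int (m - 1)) * D k l m"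
      using casoratian_raise_a[OF \<Phi> \<Psi> st, of "k - 1" "l - 1" "m - 1"] by (simp add: D_def)
    ultimately show ?case
      using P1[of k l m] by (intro ratio)
  next
    case (2 k l m)
    have "b + of_int l - c - of_int (m - 1) = - (c + of_int (m - 1) - b - of_int l)" by simp
    then have "b + of_int l - c - of_int (m - 1) \<noteq> 0" "(1 - x) * (b + of_int l) \<noteq> 0"
      using standing_nonzero(2,8)[OF st] x by (simp_all only: neg_equal_0_iff_equal) simp_all
    moreover have "(1 - x) * (b + of_int l) * D k (l + 1) m = (b + of_int l - c - of_int (m - 1)) * D k l m"
      using casoratian_raise_b[OF \<Phi> \<Psi> st, of "l - 1" "k - 1" "m - 1"] by (simp add: D_def)
    ultimately show ?case
      using P2[of l k m] by (intro ratio)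
  next
    case (3 k l m)
    have "x * (1 - x) * (a + of_int k) * (b + of_int l) \<noteq> 0" "- ((c + of_int (m - 1)) * (c + of_int m)) \<noteq> 0"
      using standing_nonzero(1-3)[OF st] x by (simp_all del: of_int_diff)
    moreover have "x * (1 - x) * (a + of_int k) * (b + of_int l) * D (k + 1) (l + 1) (m + 1)
       = - ((c + of_int (m - 1)) * (c + of_int m)) * D k l m"
      using casoratian_diagonal[OF \<Phi> \<Psi>, of "k - 1" "l - 1" "m - 1"] by (simp add: D_def algebra_simps)
    ultimately show ?case
      using P3[of k l m] by (intro ratio)
  qed
  moreover have "P 1 1 1 = -1" "D 1 1 1 = casoratian \<Phi> \<Psi> 0 0 0"
    by (simp_all add: P_def D_def sig0_factor_def)
  ultimately have "D k l m / P k l m = - casoratian \<Phi> \<Psi> 0 0 0" by simp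
  then have "D k l m = - P k l m * casoratian \<Phi> \<Psi> 0 0 0"
    using P[of k l m] by (simp add: field_simps)
  then show ?thesis by (simp add: D_def P_def)
qed

end

subsection \<open>Polynomial functions and regular coefficients\<close>

lemma polyfun4_uminus: "polyfun4 p \<Longrightarrow> polyfun4 (\<lambda>a b c x. - p a b c x)"
  using pmult[OF pconst[of "-1"], of p] by simp

lemma polyfun4_diff: "polyfun4 p \<Longrightarrow> polyfun4 q \<Longrightarrow> polyfun4 (\<lambda>a b c x. p a b c x - q a b c x)"
  using padd[OF _ polyfun4_uminus, of p q] by simp

lemmas polyfun4_intros = polyfun4.intros polyfun4_uminus polyfun4_diff

lemma polyfun4_line:
  assumes "polyfun4 p"
  shows "\<exists>P. \<forall>t. p (a0 + t * a1) (b0 + t * b1) (c0 + t * c1) (x0 + t * x1) = poly P t"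
  using assms
proof induction
  case (pconst k)
  show ?case by (rule exI[of _ "[:k:]"]) simp
next
  case pvar_a
  show ?case by (rule exI[of _ "[:a0, a1:]"]) simp
next
  case pvar_b
  show ?case by (rule exI[of _ "[:b0, b1:]"]) simp
next
  case pvar_c
  show ?case by (rule exI[of _ "[:c0, c1:]"]) simp
next
  case pvar_x
  show ?case by (rule exI[of _ "[:x0, x1:]"]) simp
next
  case (padd p q)
  then show ?case by (metis poly_add)
next
  case (pmult p q)
  then show ?case by (metis poly_mult)
qed

text \<open>On the line joining a point where p does not vanish to a point where q does not vanish,
  both restrictions are nonzero univariate polynomials, and so is their product.\<close>

lemma polyfun4_mult_eq_0:
  assumes "polyfun4 p" "polyfun4 q" and eq: "(\<lambda>a b c x. p a b c x * q a b c x) = (\<lambda>a b c x. 0)"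
  shows "p = (\<lambda>a b c x. 0) \<or> q = (\<lambda>a b c x. 0)"
proof (rule ccontr)
  assume "\<not> ?thesis"
  then obtain a b c x a' b' c' x' where nz: "p a b c x \<noteq> 0" "q a' b' c' x' \<noteq> 0"
    by (auto simp: fun_eq_iff)
  obtain P where P: "\<And>t. p (a + t * (a' - a)) (b + t * (b' - b)) (c + t * (c' - c)) (x + t * (x' - x)) = poly P t"
    using polyfun4_line[OF assms(1)] by metis
  obtain Q where Q: "\<And>t. q (a + t * (a' - a)) (b + t * (b' - b)) (c + t * (c' - c)) (x + t * (x' - x)) = poly Q t"
    using polyfun4_line[OF assms(2)] by metis
  have "poly (P * Q) t = 0" for t
    using eq by (simp flip: P Q add: fun_eq_iff)
  then have "P * Q = 0" by (simp add: poly_all_0_iff_0 [symmetric])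
  moreover have "poly P 0 \<noteq> 0" "poly Q 1 \<noteq> 0"
    using nz P[of 0] Q[of 1] by auto
  ultimately show False by auto
qed

lemma eventually_at_poly_nonzero:
  fixes P :: "complex poly"
  assumes "P \<noteq> 0"
  shows "eventually (\<lambda>t. poly P t \<noteq> 0) (at z)"
  using islimpt_finite[OF poly_roots_finite[OF assms], of z]
  by (simp add: islimpt_iff_eventually)

text \<open>Density of the permitted points. They are not the complement of an algebraic set, so p
  is followed along a line from a good point to a point where p is assumed nonzero: near the start
  the hypotheses hold and force p to vanish, whereas a nonzero polynomial has only finitely many
  zeros.\<close>

lemma polyfun4_eq_0I:
  assumes p: "polyfun4 p"
    and zero: "\<And>a b c x. standing a b c \<Longrightarrow> norm x < 1 \<Longrightarrow> p a b c x = 0"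
  shows "p = (\<lambda>a b c x. 0)"
proof (rule ccontr)
  assume "p \<noteq> (\<lambda>a b c x. 0)"
  then obtain a b c x where nz: "p a b c x \<noteq> 0" by (auto simp: fun_eq_iff)
  define line where "line = (\<lambda>w z t. w + t * (z - w :: complex))"
  \<comment> \<open>At (i, 3i, 9i) all seven forms in \<open>standing\<close> have nonzero imaginary
    part, so they stay non-integral for small t; x starts at the centre of the disc.\<close>
  obtain P where P: "\<And>t. p (line \<i> a t) (line (3 * \<i>) b t) (line (9 * \<i>) c t) (line 0 x t) = poly P t"
    using polyfun4_line[OF p] unfolding line_def by metis
  have "P \<noteq> 0" using nz P[of 1] by (auto simp: line_def)
  have tendsto: "(line w z \<longlongrightarrow> w) (at 0)" for w z
    unfolding line_def by (rule tendsto_eq_intros refl | simp)+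
  have not_Ints: "eventually (\<lambda>t. f t \<notin> \<int>) (at 0)" if "(f \<longlongrightarrow> w) (at 0)" "Im w \<noteq> 0"
    for f :: "complex \<Rightarrow> complex" and w
    using tendsto_imp_eventually_ne[OF tendsto_Im[OF that(1)] that(2)]
    by (rule eventually_mono) (auto elim: Ints_cases)
  have "eventually (\<lambda>t. standing (line \<i> a t) (line (3 * \<i>) b t) (line (9 * \<i>) c t)) (at 0)"
    unfolding standing_def
    by (intro eventually_conj not_Ints) (rule tendsto tendsto_diff | simp)+
  moreover have "eventually (\<lambda>t. norm (line 0 x t) < 1) (at 0)"
    using tendsto_norm[OF tendsto[of 0 x]] by (intro order_tendstoD(2)[where y = 0]) simp_all
  ultimately have "eventually (\<lambda>t. poly P t = 0) (at 0)"
    by eventually_elim (simp flip: P add: zero)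
  moreover have "eventually (\<lambda>t. poly P t \<noteq> 0) (at 0)"
    using \<open>P \<noteq> 0\<close> by (rule eventually_at_poly_nonzero)
  ultimately have "eventually (\<lambda>t :: complex. False) (at 0)"
    by eventually_elim simp
  then show False by simp
qed

text \<open>The denominator may not vanish at any permitted point, which is stronger than being a
  nonzero polynomial. In particular it stays nonzero as a polynomial in x once a, b, c are fixed, so
  independence over the rational functions of x applies to each such slice.\<close>

definition regular :: "fun4 \<Rightarrow> bool" where
  "regular f \<longleftrightarrow> (\<exists>p q. polyfun4 p \<and> polyfun4 q \<and>
     (\<forall>a b c x. standing a b c \<longrightarrow> x \<noteq> 0 \<longrightarrow> x \<noteq> 1 \<longrightarrow> q a b c x \<noteq> 0 \<and> f a b c x = p a b c x / q a b c x))"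

lemma regular_divide:
  assumes "regular f" "polyfun4 q"
    and "\<And>a b c x. standing a b c \<Longrightarrow> x \<noteq> 0 \<Longrightarrow> x \<noteq> 1 \<Longrightarrow> q a b c x \<noteq> 0"
  shows "regular (\<lambda>a b c x. f a b c x / q a b c x)"
proof -
  from assms(1) obtain p q' where pq: "polyfun4 p" "polyfun4 q'"
    "\<And>a b c x. standing a b c \<Longrightarrow> x \<noteq> 0 \<Longrightarrow> x \<noteq> 1 \<Longrightarrow> q' a b c x \<noteq> 0 \<and> f a b c x = p a b c x / q' a b c x"
    unfolding regular_def by metis
  show ?thesis
    unfolding regular_def
    by (rule exI[of _ p], rule exI[of _ "\<lambda>a b c x. q' a b c x * q a b c x"])
      (use pq assms in \<open>auto intro!: pmult\<close>)
qed

lemma regular_polyfun4: "polyfun4 p \<Longrightarrow> regular p"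
  unfolding regular_def using pconst[of 1] by fastforce

lemma regular_add:
  assumes "regular f" "regular g"
  shows "regular (\<lambda>a b c x. f a b c x + g a b c x)"
proof -
  from assms(1) obtain p q where pq: "polyfun4 p" "polyfun4 q"
    "\<And>a b c x. standing a b c \<Longrightarrow> x \<noteq> 0 \<Longrightarrow> x \<noteq> 1 \<Longrightarrow> q a b c x \<noteq> 0 \<and> f a b c x = p a b c x / q a b c x"
    unfolding regular_def by metis
  from assms(2) obtain p' q' where pq': "polyfun4 p'" "polyfun4 q'"
    "\<And>a b c x. standing a b c \<Longrightarrow> x \<noteq> 0 \<Longrightarrow> x \<noteq> 1 \<Longrightarrow> q' a b c x \<noteq> 0 \<and> g a b c x = p' a b c x / q' a b c x"
    unfolding regular_def by metis
  show ?thesis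
    unfolding regular_def
    by (rule exI[of _ "\<lambda>a b c x. p a b c x * q' a b c x + p' a b c x * q a b c x"],
        rule exI[of _ "\<lambda>a b c x. q a b c x * q' a b c x"])
      (use pq pq' in \<open>auto intro!: pmult padd simp: add_frac_eq\<close>)
qed

lemma regular_mult:
  assumes "regular f" "regular g"
  shows "regular (\<lambda>a b c x. f a b c x * g a b c x)"
proof -
  from assms(1) obtain p q where pq: "polyfun4 p" "polyfun4 q"
    "\<And>a b c x. standing a b c \<Longrightarrow> x \<noteq> 0 \<Longrightarrow> x \<noteq> 1 \<Longrightarrow> q a b c x \<noteq> 0 \<and> f a b c x = p a b c x / q a b c x"
    unfolding regular_def by metis
  from assms(2) obtain p' q' where pq': "polyfun4 p'" "polyfun4 q'"
    "\<And>a b c x. standing a b c \<Longrightarrow> x \<noteq> 0 \<Longrightarrow> x \<noteq> 1 \<Longrightarrow> q' a b c x \<noteq> 0 \<and> g a b c x = p' a b c x / q' a b c x"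
    unfolding regular_def by metis
  show ?thesis
    unfolding regular_def
    by (rule exI[of _ "\<lambda>a b c x. p a b c x * p' a b c x"], rule exI[of _ "\<lambda>a b c x. q a b c x * q' a b c x"])
      (use pq pq' in \<open>auto intro!: pmult\<close>)
qed

lemma regular_diff:
  assumes "regular f" "regular g"
  shows "regular (\<lambda>a b c x. f a b c x - g a b c x)"
  using regular_add[OF assms(1) regular_mult[OF regular_polyfun4[OF pconst[of "-1"]] assms(2)]]
  by simp

text \<open>The coefficients are chosen uniformly for all contiguous families, not only for the
  hypergeometric one.\<close>

definition expresses :: "int \<Rightarrow> int \<Rightarrow> int \<Rightarrow> fun4 \<Rightarrow> fun4 \<Rightarrow> bool" where
  "expresses k l m Q R \<longleftrightarrow> regular Q \<and> regular R \<and>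
     (\<forall>a b c x \<Phi>. standing a b c \<longrightarrow> x \<noteq> 0 \<longrightarrow> x \<noteq> 1 \<longrightarrow> contig a b c x \<Phi> \<longrightarrow>
        \<Phi> k l m = Q a b c x * \<Phi> 1 1 1 + R a b c x * \<Phi> 0 0 0)"

definition expressible :: "int \<Rightarrow> int \<Rightarrow> int \<Rightarrow> bool" where
  "expressible k l m \<longleftrightarrow> (\<exists>Q R. expresses k l m Q R)"

text \<open>Every step of the walk through the lattice is an instance: since \<open>w\<close> has no
  zero at a permitted point, solving for the new value keeps the coefficients regular.\<close>

lemma expressible_combine:
  assumes "expressible k l m" "expressible k' l' m'" "polyfun4 u" "polyfun4 v" "polyfun4 w"
    and w: "\<And>a b c x. standing a b c \<Longrightarrow> x \<noteq> 0 \<Longrightarrow> x \<noteq> 1 \<Longrightarrow> w a b c x \<noteq> 0"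
    and eq: "\<And>a b c x \<Phi>. standing a b c \<Longrightarrow> x \<noteq> 0 \<Longrightarrow> x \<noteq> 1 \<Longrightarrow> contig a b c x \<Phi> \<Longrightarrow>
        w a b c x * \<Phi> i j n = u a b c x * \<Phi> k l m + v a b c x * \<Phi> k' l' m'"
  shows "expressible i j n"
proof -
  from assms obtain Q R Q' R' where *: "expresses k l m Q R" "expresses k' l' m' Q' R'"
    unfolding expressible_def by metis
  have "expresses i j n (\<lambda>a b c x. (u a b c x * Q a b c x + v a b c x * Q' a b c x) / w a b c x)
     (\<lambda>a b c x. (u a b c x * R a b c x + v a b c x * R' a b c x) / w a b c x)"
    unfolding expresses_def
  proof (intro conjI allI impI)
    fix a b c x \<Phi>
    assume st: "standing a b c" and x: "x \<noteq> 0" "x \<noteq> 1" and \<Phi>: "contig a b c x \<Phi>"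
    have "\<Phi> i j n = (u a b c x * \<Phi> k l m + v a b c x * \<Phi> k' l' m') / w a b c x"
      using eq[OF st x \<Phi>] w[OF st x] by (simp add: field_simps)
    moreover have "\<Phi> k l m = Q a b c x * \<Phi> 1 1 1 + R a b c x * \<Phi> 0 0 0"
      "\<Phi> k' l' m' = Q' a b c x * \<Phi> 1 1 1 + R' a b c x * \<Phi> 0 0 0"
      using * st x \<Phi> unfolding expresses_def by blast+
    ultimately show "\<Phi> i j n = (u a b c x * Q a b c x + v a b c x * Q' a b c x) / w a b c x * \<Phi> 1 1 1 +
       (u a b c x * R a b c x + v a b c x * R' a b c x) / w a b c x * \<Phi> 0 0 0"
      by (simp add: algebra_simps add_divide_distrib)
  qed (use * in \<open>auto simp: expresses_def w intro!: regular_divide regular_add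
      regular_mult[OF regular_polyfun4] assms\<close>)
  then show ?thesis unfolding expressible_def by blast
qed

lemma expressible_diagonal: "expressible j j j"
proof -
  have "expressible j j j \<and> expressible (j + 1) (j + 1) (j + 1)"
  proof (induction j rule: int_induct[where k = 0])
    case base
    have "expresses 0 0 0 (\<lambda>a b c x. 0) (\<lambda>a b c x. 1)" "expresses 1 1 1 (\<lambda>a b c x. 1) (\<lambda>a b c x. 0)"
      unfolding expresses_def by (auto intro: regular_polyfun4 pconst)
    then show ?case unfolding expressible_def by auto
  next
    case (step1 j)
    then have E: "expressible j j j" "expressible (j + 1) (j + 1) (j + 1)" by auto
    have "expressible (j + 2) (j + 2) (j + 2)"
    proof (rule expressible_combine[OF E, where
        u = "\<lambda>a b c x. (c + of_int j + 1) * (c + of_int j)" and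
        v = "\<lambda>a b c x. - ((c + of_int j + 1) * (c + of_int j - (a + of_int j + b + of_int j + 1) * x))" and
        w = "\<lambda>a b c x. x * (1 - x) * (a + of_int j + 1) * (b + of_int j + 1)"], goal_cases)
      case (4 a b c x)
      then show ?case using standing_nonzero(4,5)[OF 4(1)] by auto
    next
      case (5 a b c x \<Phi>)
      show ?case
        unfolding contig_diagonal[OF 5(4)] by (simp add: algebra_simps)
    qed (intro polyfun4_intros)+
    then show ?case using E by (simp add: add.assoc)
  next
    case (step2 j)
    then have E: "expressible j j j" "expressible (j + 1) (j + 1) (j + 1)" by auto
    have "expressible (j - 1) (j - 1) (j - 1)"
    proof (rule expressible_combine[OF E, where
        w = "\<lambda>a b c x. (c + of_int j) * (c + of_int (j - 1))" and
        u = "\<lambda>a b c x. (c + of_int j) * (c + of_int j - 1 - (a + of_int j + b + of_int j - 1) * x)" and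
        v = "\<lambda>a b c x. x * (1 - x) * (a + of_int j) * (b + of_int j)"], goal_cases)
      case (4 a b c x)
      then show ?case using standing_nonzero(3)[OF 4(1)] by (simp del: of_int_diff)
    next
      case (5 a b c x \<Phi>)
      show ?case
        using contig_diagonal[OF 5(4), of "j - 1" "j - 1" "j - 1"] by (simp add: algebra_simps)
    qed (intro polyfun4_intros)+
    then show ?case using E by simp
  qed
  then show ?thesis ..
qed

lemma expressible_raise_lower:
  assumes E: "expressible k l m" "expressible (k + 1) (l + 1) (m + 1)"
  shows "expressible (k + 1) l m" "expressible k (l + 1) m" "expressible (k - 1) l m" "expressible k (l - 1) m"
proof -
  show "expressible (k + 1) l m"
  proof (rule expressible_combine[OF E, where w = "\<lambda>a b c x. c + of_int m" and u = "\<lambda>a b c x. c + of_int m"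
        and v = "\<lambda>a b c x. (b + of_int l) * x"], goal_cases)
    case (4 a b c x)
    then show ?case using standing_nonzero(3)[OF 4(1)] by simp
  next
    case (5 a b c x \<Phi>)
    show ?case using contig_raise_a[OF 5(4), of m k l] by simp
  qed (intro polyfun4_intros)+
  show "expressible k (l + 1) m"
  proof (rule expressible_combine[OF E, where w = "\<lambda>a b c x. c + of_int m" and u = "\<lambda>a b c x. c + of_int m"
        and v = "\<lambda>a b c x. (a + of_int k) * x"], goal_cases)
    case (4 a b c x)
    then show ?case using standing_nonzero(3)[OF 4(1)] by simp
  next
    case (5 a b c x \<Phi>)
    show ?case using contig_raise_b[OF 5(4), of m k l] by simp
  qed (intro polyfun4_intros)+
  show "expressible (k - 1) l m"
  proof (rule expressible_combine[OF E, where
        w = "\<lambda>a b c x. (c + of_int m) * (c + of_int m - a - of_int k)"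
        and u = "\<lambda>a b c x. (c + of_int m) * (c + of_int m - a - of_int k - (b + of_int l) * x)"
        and v = "\<lambda>a b c x. x * (1 - x) * (a + of_int k) * (b + of_int l)"], goal_cases)
    case (4 a b c x)
    then show ?case using standing_nonzero(3,7)[OF 4(1)] by simp
  next
    case (5 a b c x \<Phi>)
    show ?case using contig_lower_a[OF 5(4,1), of m k l] by simp
  qed (intro polyfun4_intros)+
  show "expressible k (l - 1) m"
  proof (rule expressible_combine[OF E, where
        w = "\<lambda>a b c x. (c + of_int m) * (c + of_int m - b - of_int l)"
        and u = "\<lambda>a b c x. (c + of_int m) * (c + of_int m - b - of_int l - (a + of_int k) * x)"
        and v = "\<lambda>a b c x. x * (1 - x) * (a + of_int k) * (b + of_int l)"], goal_cases)
    case (4 a b c x)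
    then show ?case using standing_nonzero(3,8)[OF 4(1)] by simp
  next
    case (5 a b c x \<Phi>)
    show ?case using contig_lower_b[OF 5(4,1), of m l k] by simp
  qed (intro polyfun4_intros)+
qed

lemma expressible: "expressible k l m"
proof -
  \<comment> \<open>Neighbouring points of one diagonal are what
    \<open>expressible_raise_lower\<close> starts from, so whole diagonals are treated at once and
    the induction runs over their offsets.\<close>
  define L where "L = (\<lambda>p q. \<forall>m. expressible (p + m) (q + m) m)"
  have step: "L (p + 1) q" "L p (q + 1)" "L (p - 1) q" "L p (q - 1)" if "L p q" for p q
  proof -
    have "expressible (p + m) (q + m) m" "expressible (p + m + 1) (q + m + 1) (m + 1)" for m
      using that unfolding L_def by (simp_all flip: add.assoc)
        (metis add.assoc)
    from expressible_raise_lower[OF this]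
    show "L (p + 1) q" "L p (q + 1)" "L (p - 1) q" "L p (q - 1)"
      unfolding L_def by (simp_all add: algebra_simps)
  qed
  have "L p 0" for p
  proof (induction p rule: int_induct[where k = 0])
    case base
    show ?case by (simp add: L_def expressible_diagonal)
  qed (use step in auto)
  then have "L p q" for p q
    by (induction q rule: int_induct[where k = 0]) (use step in auto)
  from this[of "k - m" "l - m"] show ?thesis
    by (simp add: L_def) (metis diff_add_cancel)
qed

subsection \<open>The hypergeometric series\<close>

definition hyp_coeff :: "complex \<Rightarrow> complex \<Rightarrow> complex \<Rightarrow> nat \<Rightarrow> complex" where
  "hyp_coeff a b c n = pochhammer a n * pochhammer b n / (pochhammer c n * fact n)"

definition hyp_fps :: "complex \<Rightarrow> complex \<Rightarrow> complex \<Rightarrow> complex fps" where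
  "hyp_fps a b c = Abs_fps (hyp_coeff a b c)"

lemma eval_hyp_fps: "eval_fps (hyp_fps a b c) x = hypF a b c x"
  by (simp add: eval_fps_def hyp_fps_def hypF_def hyp_coeff_def)

lemma not_Ints_add_of_nat: "z \<notin> \<int> \<Longrightarrow> z + of_nat n \<noteq> 0" for z :: complex
  using not_Ints_add_of_int[of z "int n"] by simp

lemma pochhammer_nonzero: "z \<notin> \<int> \<Longrightarrow> pochhammer z n \<noteq> 0" for z :: complex
  using not_Ints_add_of_nat[of z] by (auto simp: pochhammer_eq_0_iff eq_neg_iff_add_eq_0)

lemma of_nat_add_1_nonzero: "of_nat n + 1 \<noteq> (0 :: complex)"
  by (metis of_nat_Suc add.commute of_nat_eq_0_iff nat.distinct(2))

context
  fixes a b c :: complex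
  assumes not_Ints: "a \<notin> \<int>" "b \<notin> \<int>" "c \<notin> \<int>"
begin

lemma hyp_coeff_nonzero: "hyp_coeff a b c n \<noteq> 0"
  using not_Ints by (simp add: hyp_coeff_def pochhammer_nonzero)

lemma hyp_coeff_Suc:
  "(c + of_nat n) * (of_nat n + 1) * hyp_coeff a b c (Suc n) = (a + of_nat n) * (b + of_nat n) * hyp_coeff a b c n"
  using not_Ints of_nat_add_1_nonzero[of n] not_Ints_add_of_nat[of c n] pochhammer_nonzero[of c n]
  by (simp add: hyp_coeff_def pochhammer_Suc divide_simps) (simp add: algebra_simps)

text \<open>Ratio test: nonintegral parameters keep every coefficient nonzero, and the quotient of
  consecutive coefficients is a product of two fractions of the form (z + n) / (w + n), each tending
  to 1.\<close>

lemma hyp_fps_conv_radius: "fps_conv_radius (hyp_fps a b c) \<ge> 1"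
proof -
  have lim: "(\<lambda>n. (z + of_nat n) / (w + of_nat n)) \<longlonglongrightarrow> 1" if "w \<notin> \<int>" for z w :: complex
  proof -
    have "(\<lambda>n. (z - w) / (w + of_nat n)) \<longlonglongrightarrow> 0"
      by (intro tendsto_divide_0[OF tendsto_const] tendsto_add_filterlim_at_infinity[OF tendsto_const]
          tendsto_of_nat)
    then have "(\<lambda>n. 1 + (z - w) / (w + of_nat n)) \<longlonglongrightarrow> 1 + 0"
      by (intro tendsto_intros)
    moreover have "1 + (z - w) / (w + of_nat n) = (z + of_nat n) / (w + of_nat n)" for n
      using not_Ints_add_of_nat[OF that, of n] by (simp add: field_simps)
    ultimately show ?thesis by simp
  qed
  have "(\<lambda>n. norm ((c + of_nat n) / (a + of_nat n) * ((1 + of_nat n) / (b + of_nat n)))) \<longlonglongrightarrow> norm (1 * 1 :: complex)"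
    by (intro tendsto_norm tendsto_mult lim not_Ints)
  moreover have "(c + of_nat n) / (a + of_nat n) * ((1 + of_nat n) / (b + of_nat n))
     = hyp_coeff a b c n / hyp_coeff a b c (Suc n)" for n
    using hyp_coeff_Suc[of n] hyp_coeff_nonzero[of n] hyp_coeff_nonzero[of "Suc n"]
      not_Ints[THEN not_Ints_add_of_nat, of n]
    by (simp add: frac_eq_eq mult_ac add.commute[of 1])
  ultimately have "(\<lambda>n. norm (hyp_coeff a b c n) / norm (hyp_coeff a b c (Suc n))) \<longlonglongrightarrow> 1"
    by (simp only: norm_divide norm_one mult_1)
  then have "conv_radius (hyp_coeff a b c) = ereal 1"
    by (intro conv_radius_ratio_limit_nonzero[OF refl]) simp_all
  then show ?thesis by (simp add: fps_conv_radius_def hyp_fps_def)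
qed

lemma hyp_coeff_raise_all:
  "a * b * hyp_coeff (a + 1) (b + 1) (c + 1) n = c * (of_nat n + 1) * hyp_coeff a b c (Suc n)"
proof -
  have "a \<noteq> 0" "b \<noteq> 0" "c \<noteq> 0" "c + 1 \<notin> \<int>" using not_Ints by auto
  then show ?thesis
    using of_nat_add_1_nonzero[of n] pochhammer_nonzero[of "c + 1" n]
    by (simp add: hyp_coeff_def pochhammer_rec divide_simps) (simp add: algebra_simps)
qed

lemma hyp_coeff_raise_a: "a * hyp_coeff (a + 1) b c n = (a + of_nat n) * hyp_coeff a b c n"
proof -
  have "a * pochhammer (a + 1) n = (a + of_nat n) * pochhammer a n"
    by (simp flip: pochhammer_rec add: pochhammer_Suc)
  then show ?thesis by (simp add: hyp_coeff_def)
qed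

text \<open>Coefficients of a b x F1 = c x F', where F1 has all three parameters raised:
  differentiation turns F into a multiple of F1.\<close>

lemma hyp_fps_raise_all_nth:
  "a * b * fps_nth (fps_X * hyp_fps (a + 1) (b + 1) (c + 1)) n = c * of_nat n * hyp_coeff a b c n"
  using hyp_coeff_raise_all[of "n - 1"] by (cases n) (simp_all add: hyp_fps_def algebra_simps)

end

context
  fixes a b c :: complex
  assumes not_Ints: "a \<notin> \<int>" "b \<notin> \<int>" "c \<notin> \<int>"
begin

lemma hyp_fps_raise_a:
  "fps_const c * hyp_fps (a + 1) b c
     = fps_const c * hyp_fps a b c + fps_const b * fps_X * hyp_fps (a + 1) (b + 1) (c + 1)"
proof (rule fps_ext)
  fix n
  define f where "f = fps_nth (fps_X * hyp_fps (a + 1) (b + 1) (c + 1)) n"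
  have "a * (c * hyp_coeff (a + 1) b c n) = a * (c * hyp_coeff a b c n + b * f)"
    using hyp_fps_raise_all_nth[OF not_Ints, of n] hyp_coeff_raise_a[OF not_Ints, of n]
    unfolding f_def[symmetric] by algebra
  then show "fps_nth (fps_const c * hyp_fps (a + 1) b c) n
     = fps_nth (fps_const c * hyp_fps a b c + fps_const b * fps_X * hyp_fps (a + 1) (b + 1) (c + 1)) n"
    using not_Ints by (auto simp: f_def mult.assoc) (simp_all add: hyp_fps_def)
qed

text \<open>The hypergeometric differential equation divided by a b. After multiplication by a b
  every term becomes a multiple of one of two consecutive coefficients of F, and their ratio
  \<open>5\<close> closes the identity. The terms in F2 arise by applying the derivative rule at
  raised parameters.\<close>

lemma hyp_fps_diagonal:
  "fps_const ((a + 1) * (b + 1)) * (fps_X * (1 - fps_X) * hyp_fps (a + 2) (b + 2) (c + 2))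
     = fps_const (c + 1) * (fps_const c * hyp_fps a b c
        - (fps_const c - fps_const (a + b + 1) * fps_X) * hyp_fps (a + 1) (b + 1) (c + 1))"
proof (rule fps_ext)
  fix n
  define h h' where "h = hyp_coeff a b c n" and "h' = hyp_coeff a b c (Suc n)"
  define F1 F2 where "F1 = hyp_fps (a + 1) (b + 1) (c + 1)" and "F2 = hyp_fps (a + 2) (b + 2) (c + 2)"
  have not_Ints': "a + 1 \<notin> \<int>" "b + 1 \<notin> \<int>" "c + 1 \<notin> \<int>" using not_Ints by auto
  note two = hyp_fps_raise_all_nth[OF not_Ints', unfolded add.assoc one_add_one, folded F2_def]
  have 1: "a * b * fps_nth F1 n = c * (of_nat n + 1) * h'"
    using hyp_coeff_raise_all[OF not_Ints, of n] by (simp add: F1_def h'_def hyp_fps_def)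
  have 2: "a * b * fps_nth (fps_X * F1) n = c * of_nat n * h"
    using hyp_fps_raise_all_nth[OF not_Ints, of n] by (simp add: F1_def h_def)
  have 3: "a * b * ((a + 1) * (b + 1) * fps_nth (fps_X * F2) n) = c * (c + 1) * of_nat n * (of_nat n + 1) * h'"
    using two[of n] hyp_coeff_raise_all[OF not_Ints, of n] unfolding h'_def[symmetric] by algebra
  have 4: "a * b * ((a + 1) * (b + 1) * fps_nth (fps_X * (fps_X * F2)) n) = c * (c + 1) * (of_nat n - 1) * of_nat n * h"
  proof (cases n)
    case (Suc m)
    then have "fps_nth (fps_X * (fps_X * F2)) n = fps_nth (fps_X * F2) m" "of_nat n = of_nat m + (1 :: complex)"
      by (simp_all add: fps_X_mult_nth[of "fps_X * F2"])
    moreover have "a * b * ((a + 1) * (b + 1) * fps_nth (fps_X * F2) m)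
        = c * (c + 1) * of_nat m * (of_nat m + 1) * hyp_coeff a b c (Suc m)"
      using two[of m] hyp_coeff_raise_all[OF not_Ints, of m] by algebra
    ultimately show ?thesis
      by (simp only: h_def Suc add_diff_cancel_right')
  qed simp
  have 5: "(c + of_nat n) * (of_nat n + 1) * h' = (a + of_nat n) * (b + of_nat n) * h"
    unfolding h_def h'_def by (rule hyp_coeff_Suc[OF not_Ints])
  have "a * b * ((a + 1) * (b + 1) * (fps_nth (fps_X * F2) n - fps_nth (fps_X * (fps_X * F2)) n))
     = a * b * ((c + 1) * (c * h - (c * fps_nth F1 n - (a + b + 1) * fps_nth (fps_X * F1) n)))"
    using 1 2 3 4 5 by algebra
  then have "(a + 1) * (b + 1) * (fps_nth (fps_X * F2) n - fps_nth (fps_X * (fps_X * F2)) n)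
     = (c + 1) * (c * h - (c * fps_nth F1 n - (a + b + 1) * fps_nth (fps_X * F1) n))"
    using not_Ints by auto
  then show "fps_nth (fps_const ((a + 1) * (b + 1)) * (fps_X * (1 - fps_X) * F2)) n
     = fps_nth (fps_const (c + 1) * (fps_const c * hyp_fps a b c - (fps_const c - fps_const (a + b + 1) * fps_X) * F1)) n"
    by (simp add: h_def hyp_fps_def left_diff_distrib right_diff_distrib mult.assoc del: fps_const_add fps_const_mult fps_X_mult_nth)
qed

end

lemma fps_conv_radius_ge_1:
  fixes f g :: "complex fps"
  assumes "fps_conv_radius f \<ge> 1" "fps_conv_radius g \<ge> 1"
  shows "fps_conv_radius (f + g) \<ge> 1" "fps_conv_radius (f - g) \<ge> 1" "fps_conv_radius (f * g) \<ge> 1"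
  using fps_conv_radius_add[of f g] fps_conv_radius_diff[of f g] fps_conv_radius_mult[of f g] assms
  by (auto intro: order_trans[rotated])

lemma eval_fps_unit_disc:
  fixes f g :: "complex fps"
  assumes "fps_conv_radius f \<ge> 1" "fps_conv_radius g \<ge> 1" "norm x < 1"
  shows "eval_fps (f + g) x = eval_fps f x + eval_fps g x" "eval_fps (f - g) x = eval_fps f x - eval_fps g x"
    "eval_fps (f * g) x = eval_fps f x * eval_fps g x"
proof -
  have "ereal (norm x) < 1" using assms by simp
  then have "ereal (norm x) < fps_conv_radius f" "ereal (norm x) < fps_conv_radius g"
    using assms by (auto intro: less_le_trans[of _ 1])
  then show "eval_fps (f + g) x = eval_fps f x + eval_fps g x" "eval_fps (f - g) x = eval_fps f x - eval_fps g x"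
    "eval_fps (f * g) x = eval_fps f x * eval_fps g x"
    by (simp_all add: eval_fps_add eval_fps_diff eval_fps_mult)
qed

lemma hypF_swap: "hypF a b c x = hypF b a c x"
  by (simp add: hypF_def mult.commute)

lemma hypF_raise_a:
  assumes "a \<notin> \<int>" "b \<notin> \<int>" "c \<notin> \<int>" "norm x < 1"
  shows "c * hypF (a + 1) b c x = c * hypF a b c x + b * x * hypF (a + 1) (b + 1) (c + 1) x"
  using arg_cong[OF hyp_fps_raise_a[OF assms(1-3)], of "\<lambda>f. eval_fps f x"] assms
  by (simp add: eval_fps_unit_disc fps_conv_radius_ge_1 hyp_fps_conv_radius eval_hyp_fps)

lemma hypF_raise_b:
  assumes "a \<notin> \<int>" "b \<notin> \<int>" "c \<notin> \<int>" "norm x < 1"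
  shows "c * hypF a (b + 1) c x = c * hypF a b c x + a * x * hypF (a + 1) (b + 1) (c + 1) x"
  using hypF_raise_a[of b a c x] assms by (simp add: hypF_swap[of b] hypF_swap[of "b + 1"])

lemma hypF_diagonal:
  assumes "a \<notin> \<int>" "b \<notin> \<int>" "c \<notin> \<int>" "norm x < 1"
  shows "x * (1 - x) * (a + 1) * (b + 1) * hypF (a + 2) (b + 2) (c + 2) x
     = (c + 1) * (c * hypF a b c x - (c - (a + b + 1) * x) * hypF (a + 1) (b + 1) (c + 1) x)"
  using arg_cong[OF hyp_fps_diagonal[OF assms(1-3)], of "\<lambda>f. eval_fps f x"] assms
  by (simp add: eval_fps_unit_disc fps_conv_radius_ge_1 hyp_fps_conv_radius eval_hyp_fps mult_ac
      del: fps_const_add fps_const_mult)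

lemma not_Ints_shift: "z + of_int n \<in> \<int> \<longleftrightarrow> z \<in> \<int>" for z :: complex
  by (metis Ints_add Ints_diff Ints_of_int add_diff_cancel_right')

lemma contig_hypF:
  assumes st: "standing a b c" and x: "norm x < 1"
  shows "contig a b c x (\<lambda>k l m. hypF (a + of_int k) (b + of_int l) (c + of_int m) x)"
  unfolding contig_def
proof (intro allI, goal_cases)
  case (1 k l m)
  have n: "a + of_int k \<notin> \<int>" "b + of_int l \<notin> \<int>" "c + of_int m \<notin> \<int>"
    using st by (auto simp: standing_def not_Ints_shift)
  show ?case
    using hypF_raise_a[OF n x] hypF_raise_b[OF n x] hypF_diagonal[OF n x] by (simp add: add.assoc)
qed

section \<open>Linear independence of the two basis series\<close>

lemma poly_pochhammer: "poly (pochhammer p n) z = pochhammer (poly p z) n"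
  for p :: "complex poly"
  by (induction n) (simp_all add: pochhammer_Suc)

lemma hyp_coeff_add:
  assumes "c \<notin> \<int>"
  shows "hyp_coeff a b c (n + r) * (pochhammer (c + of_nat n) r * pochhammer (1 + of_nat n) r)
    = hyp_coeff a b c n * (pochhammer (a + of_nat n) r * pochhammer (b + of_nat n) r)"
proof -
  have "pochhammer c n \<noteq> 0" "pochhammer (c + of_nat n) r \<noteq> 0"
    using assms by (auto intro!: pochhammer_nonzero simp: not_Ints_shift[of _ "int n", simplified])
  moreover have "fact (n + r) = fact n * (pochhammer (1 + of_nat n) r :: complex)"
    using pochhammer_product'[of 1 n r] by (simp add: pochhammer_fact)
  moreover from this have "pochhammer (1 + of_nat n) r \<noteq> (0 :: complex)"
    by (metis fact_nonzero mult_zero_right)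
  ultimately show ?thesis
    by (simp add: hyp_coeff_def pochhammer_product' divide_simps)
qed

text \<open>A recurrence with coefficients linear in the index becomes a polynomial identity in the index;
  evaluating it where the index cancels \<^term>\<open>a\<close> or \<^term>\<open>b\<close> isolates the lowest coefficient.\<close>

lemma hyp_coeff_recurrence_lowest:
  fixes \<alpha> \<beta> :: "nat \<Rightarrow> complex"
  assumes st: "standing a b c"
    and rec: "\<And>j. j \<ge> J \<Longrightarrow> (\<Sum>s\<le>N. (\<alpha> s + of_nat (j + s) * \<beta> s) * hyp_coeff a b c (j + s)) = 0"
  shows "\<alpha> 0 = 0 \<and> \<beta> 0 = 0"
proof -
  have n: "a \<notin> \<int>" "b \<notin> \<int>" "c \<notin> \<int>" using st by (auto simp: standing_def)
  \<comment> \<open>This is the recurrence divided by the coefficient of index j and multiplied by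
    (c + j)_N (1 + j)_N, with j replaced by a variable. It vanishes at all large natural numbers,
    hence identically.\<close>
  define P where "P = (\<Sum>s\<le>N. [:\<alpha> s + of_nat s * \<beta> s, \<beta> s:] * pochhammer [:a, 1:] s * pochhammer [:b, 1:] s
    * pochhammer [:c + of_nat s, 1:] (N - s) * pochhammer [:1 + of_nat s, 1:] (N - s))"
  have P: "poly P z = (\<Sum>s\<le>N. (\<alpha> s + (z + of_nat s) * \<beta> s) * pochhammer (a + z) s * pochhammer (b + z) s
    * pochhammer (c + z + of_nat s) (N - s) * pochhammer (1 + z + of_nat s) (N - s))" for z
  proof -
    have *: "\<alpha> s + of_nat s * \<beta> s + z * \<beta> s = \<alpha> s + (z + of_nat s) * \<beta> s" "c + of_nat s + z = c + z + of_nat s"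
      "1 + of_nat s + z = 1 + z + of_nat s" for s
      by (simp_all add: algebra_simps)
    show ?thesis by (simp add: P_def poly_sum poly_pochhammer * del: mult_pCons_left mult_pCons_right)
  qed
  have "poly P (of_nat j) = 0" if "j \<ge> J" for j
  proof -
    have "hyp_coeff a b c j * poly P (of_nat j)
      = pochhammer (c + of_nat j) N * pochhammer (1 + of_nat j) N *
         (\<Sum>s\<le>N. (\<alpha> s + of_nat (j + s) * \<beta> s) * hyp_coeff a b c (j + s))"
      unfolding P sum_distrib_left
    proof (rule sum.cong[OF refl], goal_cases)
      case (1 s)
      have *: "pochhammer w N = pochhammer w s * pochhammer (w + of_nat s) (N - s)" for w :: complex
        using pochhammer_product[of s N w] 1 by simp
      have ring: "h * (X * pa * pb * pc' * p1') = pc * pc' * (p1 * p1') * (X * h')"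
        if "h' * (pc * p1) = h * (pa * pb)" for h h' X pa pb pc pc' p1 p1' :: complex
      proof -
        have "h * (X * pa * pb * pc' * p1') = h * (pa * pb) * (X * pc' * p1')" by (simp add: mult_ac)
        then show ?thesis unfolding that[symmetric] by (simp add: mult_ac)
      qed
      show ?case
        unfolding *[of "c + of_nat j"] *[of "1 + of_nat j"] of_nat_add
        by (rule ring[OF hyp_coeff_add[OF n(3), of a b j s]])
    qed
    then show ?thesis
      using rec[OF that] hyp_coeff_nonzero[OF n, of j] by simp
  qed
  then have "(of_nat ` {J..} :: complex set) \<subseteq> {z. poly P z = 0}" by auto
  moreover have "infinite (of_nat ` {J..} :: complex set)"
    by (subst finite_image_iff) (auto simp: inj_on_def infinite_Ici)
  ultimately have "infinite {z. poly P z = 0}" by (rule infinite_super)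
  then have "P = 0" using poly_roots_finite by blast
  have single: "poly P (- w) = (\<alpha> 0 - w * \<beta> 0) * pochhammer (c - w) N * pochhammer (1 - w) N"
    if "w = a \<or> w = b" for w
  proof -
    have "poly P (- w) = (\<Sum>s\<in>{0}. (\<alpha> s + (- w + of_nat s) * \<beta> s) * pochhammer (a - w) s * pochhammer (b - w) s
      * pochhammer (c - w + of_nat s) (N - s) * pochhammer (1 - w + of_nat s) (N - s))"
      unfolding P using that
      by (intro sum.mono_neutral_cong_right) (auto simp: pochhammer_0_left)
    then show ?thesis by simp
  qed
  \<comment> \<open>These conditions keep the remaining Pochhammer factors at -a and -b nonzero. The
    linear form in \<alpha> 0 and \<beta> 0 then vanishes at the two distinct points a and
    b.\<close>
  have "c - a \<notin> \<int>" "c - b \<notin> \<int>" "1 - a \<notin> \<int>" "1 - b \<notin> \<int>" "a \<noteq> b"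
    using st minus_in_Ints_iff[of a] minus_in_Ints_iff[of b] Ints_diff[of "1 - a" 1] Ints_diff[of "1 - b" 1]
    by (auto simp: standing_def)
  then have "\<alpha> 0 - a * \<beta> 0 = 0" "\<alpha> 0 - b * \<beta> 0 = 0" "a \<noteq> b"
    using single[of a] single[of b] \<open>P = 0\<close> by (simp_all add: pochhammer_nonzero)
  moreover from this have "(a - b) * \<beta> 0 = 0" by algebra
  ultimately show ?thesis by simp
qed

text \<open>Once the lowest pair is known to vanish, the rest is a shorter recurrence shifted by one
  index. For this reason the hypothesis is only required from some J on, and J grows in the
  induction.\<close>

lemma hyp_coeff_no_linear_recurrence:
  fixes \<alpha> \<beta> :: "nat \<Rightarrow> complex"
  assumes st: "standing a b c"
    and rec: "\<And>j. j \<ge> J \<Longrightarrow> (\<Sum>s\<le>N. (\<alpha> s + of_nat (j + s) * \<beta> s) * hyp_coeff a b c (j + s)) = 0"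
    and "s \<le> N"
  shows "\<alpha> s = 0 \<and> \<beta> s = 0"
  using rec \<open>s \<le> N\<close>
proof (induction N arbitrary: \<alpha> \<beta> J s)
  case 0
  then show ?case using hyp_coeff_recurrence_lowest[OF st "0.prems"(1)] by simp
next
  case (Suc N)
  have z: "\<alpha> 0 = 0 \<and> \<beta> 0 = 0" using hyp_coeff_recurrence_lowest[OF st Suc.prems(1)] .
  show ?case
  proof (cases s)
    case (Suc s')
    have "\<alpha> (Suc s') = 0 \<and> \<beta> (Suc s') = 0"
    proof (rule Suc.IH[of "Suc J" "\<lambda>s. \<alpha> (Suc s)" "\<lambda>s. \<beta> (Suc s)"])
      fix j assume j: "j \<ge> Suc J"
      then obtain i where i: "j = Suc i" "i \<ge> J" by (cases j) auto
      have "(\<Sum>s\<le>Suc N. (\<alpha> s + of_nat (i + s) * \<beta> s) * hyp_coeff a b c (i + s)) = 0"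
        using Suc.prems(1)[OF i(2)] .
      then show "(\<Sum>s\<le>N. (\<alpha> (Suc s) + of_nat (j + s) * \<beta> (Suc s)) * hyp_coeff a b c (j + s)) = 0"
        unfolding sum.atMost_Suc_shift using z by (simp add: i)
    qed (use Suc Suc.prems in simp)
    then show ?thesis using Suc by simp
  qed (use z in simp)
qed

text \<open>Multiplied by X, the raised series has n-th coefficient proportional to n times that of
  F. A relation with polynomial coefficients thus becomes a recurrence with coefficients linear in
  the index, which has just been excluded.\<close>

lemma hypF_independent:
  assumes st: "standing a b c"
    and eq: "\<And>x. norm x < 1 \<Longrightarrow> poly P x * hypF (a + 1) (b + 1) (c + 1) x + poly Q x * hypF a b c x = 0"
  shows "P = 0 \<and> Q = 0"
proof -
  have n: "a \<notin> \<int>" "b \<notin> \<int>" "c \<notin> \<int>" using st by (auto simp: standing_def)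
  define F F1 where "F = hyp_fps a b c" and "F1 = hyp_fps (a + 1) (b + 1) (c + 1)"
  have r: "fps_conv_radius F \<ge> 1" "fps_conv_radius F1 \<ge> 1"
    unfolding F_def F1_def using n by (auto intro!: hyp_fps_conv_radius)
  define G where "G = fps_of_poly P * F1 + fps_of_poly Q * F"
  have "fps_conv_radius G \<ge> 1"
    unfolding G_def using r by (intro fps_conv_radius_ge_1) auto
  moreover have "eval_fps G x = 0" if "norm x < 1" for x
    unfolding G_def using r that eq[OF that]
    by (simp add: eval_fps_unit_disc fps_conv_radius_ge_1 F_def F1_def eval_hyp_fps)
  then have "eventually (\<lambda>x. eval_fps G x = eval_fps 0 x) (nhds 0)"
    by (auto simp: eventually_nhds_metric intro!: exI[of _ 1])
  ultimately have "G = 0"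
    by (intro eval_fps_eqD) (auto intro: less_le_trans[of 0 1])
  define \<kappa> where "\<kappa> = c / (a * b)"
  have nz: "a \<noteq> 0" "b \<noteq> 0" "\<kappa> \<noteq> 0" using n by (auto simp: \<kappa>_def)
  have F1: "fps_nth (fps_X * F1) i = \<kappa> * of_nat i * hyp_coeff a b c i" for i
    using hyp_fps_raise_all_nth[OF n, of i] nz unfolding F1_def[symmetric] \<kappa>_def
    by (simp add: field_simps del: fps_X_mult_nth)
  define Q' where "Q' = pCons 0 Q"
  have "fps_of_poly P * (fps_X * F1) + fps_of_poly Q' * F = fps_X * G"
    by (simp add: G_def Q'_def fps_of_poly_pCons algebra_simps)
  with \<open>G = 0\<close> have H: "fps_of_poly P * (fps_X * F1) + fps_of_poly Q' * F = 0" by simp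
  have co: "(\<Sum>i\<le>n. (coeff Q' i + of_nat (n - i) * (\<kappa> * coeff P i)) * hyp_coeff a b c (n - i)) = 0" for n
  proof -
    have "(\<Sum>i\<le>n. (coeff Q' i + of_nat (n - i) * (\<kappa> * coeff P i)) * hyp_coeff a b c (n - i))
      = fps_nth (fps_of_poly P * (fps_X * F1) + fps_of_poly Q' * F) n"
      unfolding fps_add_nth fps_mult_nth[of "fps_of_poly P"] fps_mult_nth[of _ F] F1
      by (simp add: F_def hyp_fps_def distrib_right distrib_left mult_ac add.commute atLeast0AtMost sum.distrib
          del: fps_X_mult_nth of_nat_diff)
    then show ?thesis using H by simp
  qed
  define N where "N = max (degree P) (degree Q')"
  have big: "coeff P i = 0" "coeff Q' i = 0" if "i > N" for i
    using that by (auto simp: N_def coeff_eq_0)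
  \<comment> \<open>The Cauchy product runs downwards in the index of F. Substituting N - s turns it
    upwards, and only degrees N + j are used, so that all coefficients of P and Q' take part in each
    equation.\<close>
  have zero: "coeff Q' (N - s) = 0 \<and> \<kappa> * coeff P (N - s) = 0" if "s \<le> N" for s
  proof (rule hyp_coeff_no_linear_recurrence[OF st _ that])
    fix j :: nat
    have "(\<Sum>s\<le>N. (coeff Q' (N - s) + of_nat (j + s) * (\<kappa> * coeff P (N - s))) * hyp_coeff a b c (j + s))
       = (\<Sum>i\<le>N. (coeff Q' i + of_nat (N + j - i) * (\<kappa> * coeff P i)) * hyp_coeff a b c (N + j - i))"
      by (rule sum.reindex_bij_witness[of _ "\<lambda>i. N - i" "\<lambda>i. N - i"]) (auto simp: algebra_simps)
    also have "\<dots> = (\<Sum>i\<le>N + j. (coeff Q' i + of_nat (N + j - i) * (\<kappa> * coeff P i)) * hyp_coeff a b c (N + j - i))"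
      by (rule sum.mono_neutral_left) (auto simp: big)
    also have "\<dots> = 0" by (rule co)
    finally show "(\<Sum>s\<le>N. (coeff Q' (N - s) + of_nat (j + s) * (\<kappa> * coeff P (N - s))) * hyp_coeff a b c (j + s)) = 0" .
  qed
  have "coeff P i = 0 \<and> coeff Q' i = 0" for i
    using zero[of "N - i"] big[of i] nz by (cases "i \<le> N") auto
  then show ?thesis
    by (auto simp: Q'_def poly_eq_iff) (metis coeff_pCons_Suc)
qed

subsection \<open>The coefficients as contiguous families\<close>

text \<open>A choice separate from \<open>Rcoef\<close>: it is made among regular pairs valid for
  all contiguous families, so its values can be used at each permitted point, also outside the unit
  disc.\<close>

definition canon :: "int \<Rightarrow> int \<Rightarrow> int \<Rightarrow> fun4 \<times> fun4" where
  "canon k l m = (SOME (Q, R). expresses k l m Q R)"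

definition Qcan :: "int \<Rightarrow> int \<Rightarrow> int \<Rightarrow> fun4" where "Qcan k l m = fst (canon k l m)"
definition Rcan :: "int \<Rightarrow> int \<Rightarrow> int \<Rightarrow> fun4" where "Rcan k l m = snd (canon k l m)"

lemma expresses_can: "expresses k l m (Qcan k l m) (Rcan k l m)"
  using someI_ex[of "\<lambda>(Q, R). expresses k l m Q R"] expressible[of k l m]
  unfolding expressible_def Qcan_def Rcan_def canon_def by (auto simp: case_prod_unfold)

lemma regular_can: "regular (Qcan k l m)" "regular (Rcan k l m)"
  using expresses_can[of k l m] by (auto simp: expresses_def)

lemma contig_can:
  "standing a b c \<Longrightarrow> x \<noteq> 0 \<Longrightarrow> x \<noteq> 1 \<Longrightarrow> contig a b c x \<Phi> \<Longrightarrow>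
    \<Phi> k l m = Qcan k l m a b c x * \<Phi> 1 1 1 + Rcan k l m a b c x * \<Phi> 0 0 0"
  using expresses_can[of k l m] by (auto simp: expresses_def)

lemma polyfun4_in_x:
  assumes "polyfun4 p"
  obtains P where "\<And>x. p a b c x = poly P x"
  using polyfun4_line[OF assms, of a 0 b 0 c 0 0 1] by auto

text \<open>The leap from the disc to all x: with a, b, c fixed the numerators are polynomials in x,
  so independence makes them vanish identically and not only where the series converges.\<close>

lemma regular_independent:
  assumes S: "regular S" and T: "regular T" and st: "standing a b c"
    and eq: "\<And>x. x \<noteq> 0 \<Longrightarrow> norm x < 1 \<Longrightarrow>
       S a b c x * hypF (a + 1) (b + 1) (c + 1) x + T a b c x * hypF a b c x = 0"
    and x: "x \<noteq> 0" "x \<noteq> 1"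
  shows "S a b c x = 0 \<and> T a b c x = 0"
proof -
  obtain p q where pq: "polyfun4 p" "polyfun4 q"
    and S: "\<And>x. x \<noteq> 0 \<Longrightarrow> x \<noteq> 1 \<Longrightarrow> q a b c x \<noteq> 0 \<and> S a b c x = p a b c x / q a b c x"
    using S st unfolding regular_def by metis
  obtain p' q' where pq': "polyfun4 p'" "polyfun4 q'"
    and T: "\<And>x. x \<noteq> 0 \<Longrightarrow> x \<noteq> 1 \<Longrightarrow> q' a b c x \<noteq> 0 \<and> T a b c x = p' a b c x / q' a b c x"
    using T st unfolding regular_def by metis
  obtain P where P: "\<And>x. p a b c x = poly P x" by (rule polyfun4_in_x[OF pq(1)]) blast
  obtain Q where Q: "\<And>x. q a b c x = poly Q x" by (rule polyfun4_in_x[OF pq(2)]) blast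
  obtain P' where P': "\<And>x. p' a b c x = poly P' x" by (rule polyfun4_in_x[OF pq'(1)]) blast
  obtain Q' where Q': "\<And>x. q' a b c x = poly Q' x" by (rule polyfun4_in_x[OF pq'(2)]) blast
  \<comment> \<open>The extra factor x covers the point 0, at which nothing is assumed.\<close>
  have "pCons 0 (P * Q') = 0 \<and> pCons 0 (P' * Q) = 0"
  proof (rule hypF_independent[OF st])
    fix x :: complex assume x: "norm x < 1"
    show "poly (pCons 0 (P * Q')) x * hypF (a + 1) (b + 1) (c + 1) x + poly (pCons 0 (P' * Q)) x * hypF a b c x = 0"
    proof (cases "x = 0")
      case False
      with x have "x \<noteq> 1" by auto
      note S = S[OF False this] and T = T[OF False this]
      have "poly (pCons 0 (P * Q')) x * hypF (a + 1) (b + 1) (c + 1) x + poly (pCons 0 (P' * Q)) x * hypF a b c x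
        = x * poly Q x * poly Q' x * (S a b c x * hypF (a + 1) (b + 1) (c + 1) x + T a b c x * hypF a b c x)"
        using S T unfolding P Q P' Q' by (simp add: field_simps)
      then show ?thesis using eq[OF False x] by simp
    qed simp
  qed
  moreover have "poly Q x \<noteq> 0" "poly Q' x \<noteq> 0" using S[OF x] T[OF x] by (auto simp: Q Q')
  ultimately show ?thesis
    using S[OF x] T[OF x] by (auto simp: P P' pCons_eq_0_iff)
qed

text \<open>Inside the disc the relation is applied to the hypergeometric family and expanded in the
  two basis series; independence splits it into one relation for each coefficient, valid for all x
  other than 0 and 1.\<close>

lemma can_relation:
  assumes poly: "polyfun4 u" "polyfun4 v" "polyfun4 w"
    and rel: "\<And>a b c x \<Phi>. standing a b c \<Longrightarrow> contig a b c x \<Phi> \<Longrightarrow>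
      u a b c x * \<Phi> k l m = v a b c x * \<Phi> k' l' m' + w a b c x * \<Phi> k'' l'' m''"
    and st: "standing a b c" and x: "x \<noteq> 0" "x \<noteq> 1"
  shows "u a b c x * Qcan k l m a b c x = v a b c x * Qcan k' l' m' a b c x + w a b c x * Qcan k'' l'' m'' a b c x
    \<and> u a b c x * Rcan k l m a b c x = v a b c x * Rcan k' l' m' a b c x + w a b c x * Rcan k'' l'' m'' a b c x"
proof -
  define comb where "comb = (\<lambda>f g h a b c x. u a b c x * f a b c x - (v a b c x * g a b c x + w a b c x * h a b c x))"
  have "comb (Qcan k l m) (Qcan k' l' m') (Qcan k'' l'' m'') a b c x = 0 \<and>
    comb (Rcan k l m) (Rcan k' l' m') (Rcan k'' l'' m'') a b c x = 0"
  proof (rule regular_independent[OF _ _ st _ x])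
    fix x :: complex assume x: "x \<noteq> 0" "norm x < 1"
    then have "x \<noteq> 1" by auto
    define F where "F = (\<lambda>k l m. hypF (a + of_int k) (b + of_int l) (c + of_int m) x)"
    have F: "contig a b c x F" unfolding F_def using st x by (intro contig_hypF)
    have *: "F i j n = Qcan i j n a b c x * F 1 1 1 + Rcan i j n a b c x * F 0 0 0" for i j n
      using contig_can[OF st x(1) \<open>x \<noteq> 1\<close> F] .
    have "u a b c x * F k l m = v a b c x * F k' l' m' + w a b c x * F k'' l'' m''"
      using rel[OF st F] .
    then have "comb (Qcan k l m) (Qcan k' l' m') (Qcan k'' l'' m'') a b c x * F 1 1 1 +
      comb (Rcan k l m) (Rcan k' l' m') (Rcan k'' l'' m'') a b c x * F 0 0 0 = 0"
      unfolding comb_def *[of k l m] *[of k' l' m'] *[of k'' l'' m''] by algebra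
    then show "comb (Qcan k l m) (Qcan k' l' m') (Qcan k'' l'' m'') a b c x * hypF (a + 1) (b + 1) (c + 1) x +
      comb (Rcan k l m) (Rcan k' l' m') (Rcan k'' l'' m'') a b c x * hypF a b c x = 0"
      by (simp add: F_def)
  qed (auto simp: comb_def intro!: regular_diff regular_add regular_mult[OF regular_polyfun4] regular_can poly)
  then show ?thesis
    by (simp_all add: comb_def)
qed

lemma contig_Qcan_Rcan:
  assumes st: "standing a b c" and x: "x \<noteq> 0" "x \<noteq> 1"
  shows "contig a b c x (\<lambda>k l m. Qcan k l m a b c x)" "contig a b c x (\<lambda>k l m. Rcan k l m a b c x)"
proof -
  have raise_a: "(c + of_int m) * Qcan (k + 1) l m a b c x
      = (c + of_int m) * Qcan k l m a b c x + (b + of_int l) * x * Qcan (k + 1) (l + 1) (m + 1) a b c x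
    \<and> (c + of_int m) * Rcan (k + 1) l m a b c x
      = (c + of_int m) * Rcan k l m a b c x + (b + of_int l) * x * Rcan (k + 1) (l + 1) (m + 1) a b c x" for k l m
  proof (rule can_relation[where u = "\<lambda>a b c x. c + of_int m" and v = "\<lambda>a b c x. c + of_int m"
      and w = "\<lambda>a b c x. (b + of_int l) * x", OF _ _ _ _ st x], goal_cases)
    case 4 show ?case by (rule contig_raise_a[OF 4(2)])
  qed (intro polyfun4_intros)+
  have raise_b: "(c + of_int m) * Qcan k (l + 1) m a b c x
      = (c + of_int m) * Qcan k l m a b c x + (a + of_int k) * x * Qcan (k + 1) (l + 1) (m + 1) a b c x
    \<and> (c + of_int m) * Rcan k (l + 1) m a b c x
      = (c + of_int m) * Rcan k l m a b c x + (a + of_int k) * x * Rcan (k + 1) (l + 1) (m + 1) a b c x" for k l m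
  proof (rule can_relation[where u = "\<lambda>a b c x. c + of_int m" and v = "\<lambda>a b c x. c + of_int m"
      and w = "\<lambda>a b c x. (a + of_int k) * x", OF _ _ _ _ st x], goal_cases)
    case 4 show ?case by (rule contig_raise_b[OF 4(2)])
  qed (intro polyfun4_intros)+
  have diagonal: "x * (1 - x) * (a + of_int k + 1) * (b + of_int l + 1) * Qcan (k + 2) (l + 2) (m + 2) a b c x
     = (c + of_int m + 1) * (c + of_int m) * Qcan k l m a b c x
       + - ((c + of_int m + 1) * (c + of_int m - (a + of_int k + b + of_int l + 1) * x))
         * Qcan (k + 1) (l + 1) (m + 1) a b c x
    \<and> x * (1 - x) * (a + of_int k + 1) * (b + of_int l + 1) * Rcan (k + 2) (l + 2) (m + 2) a b c x
     = (c + of_int m + 1) * (c + of_int m) * Rcan k l m a b c x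
       + - ((c + of_int m + 1) * (c + of_int m - (a + of_int k + b + of_int l + 1) * x))
         * Rcan (k + 1) (l + 1) (m + 1) a b c x" for k l m
  proof (rule can_relation[where u = "\<lambda>a b c x. x * (1 - x) * (a + of_int k + 1) * (b + of_int l + 1)"
        and v = "\<lambda>a b c x. (c + of_int m + 1) * (c + of_int m)"
        and w = "\<lambda>a b c x. - ((c + of_int m + 1) * (c + of_int m - (a + of_int k + b + of_int l + 1) * x))",
        OF _ _ _ _ st x], goal_cases)
    case 4 show ?case by (subst contig_diagonal[OF 4(2)]) (simp add: algebra_simps)
  qed (intro polyfun4_intros)+
  have *: "p * q * X + - (p * r) * Y = p * (q * X - r * Y)" for p q r X Y :: complex
    by (simp add: algebra_simps)
  show "contig a b c x (\<lambda>k l m. Qcan k l m a b c x)" "contig a b c x (\<lambda>k l m. Rcan k l m a b c x)"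
    unfolding contig_def using raise_a raise_b diagonal[unfolded *] by blast+
qed

text \<open>The chosen pairs need not be the obvious ones at the two base points; their values there
  are forced by expanding each basis series in terms of both.\<close>

lemma can_initial:
  assumes st: "standing a b c" and x: "x \<noteq> 0" "x \<noteq> 1"
  shows "Qcan 0 0 0 a b c x = 0" "Rcan 0 0 0 a b c x = 1" "Qcan 1 1 1 a b c x = 1" "Rcan 1 1 1 a b c x = 0"
proof -
  have *: "hypF (a + of_int k) (b + of_int l) (c + of_int m) x
     = Qcan k l m a b c x * hypF (a + 1) (b + 1) (c + 1) x + Rcan k l m a b c x * hypF a b c x"
    if "x \<noteq> 0" "norm x < 1" for k l m x
    using contig_can[OF st that(1) _ contig_hypF[OF st that(2)], of k l m] that by (cases "x = 1") simp_all
  have "Qcan 0 0 0 a b c x = 0 \<and> Rcan 0 0 0 a b c x - 1 = 0"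
    by (rule regular_independent[OF _ _ st _ x, where T = "\<lambda>a b c x. Rcan 0 0 0 a b c x - 1"])
      (use *[of _ 0 0 0] in \<open>auto intro!: regular_can regular_diff regular_polyfun4[OF pconst] simp: algebra_simps\<close>)
  moreover have "Qcan 1 1 1 a b c x - 1 = 0 \<and> Rcan 1 1 1 a b c x = 0"
    by (rule regular_independent[OF _ _ st _ x, where S = "\<lambda>a b c x. Qcan 1 1 1 a b c x - 1"])
      (use *[of _ 1 1 1] in \<open>auto intro!: regular_can regular_diff regular_polyfun4[OF pconst] simp: algebra_simps\<close>)
  ultimately show "Qcan 0 0 0 a b c x = 0" "Rcan 0 0 0 a b c x = 1" "Qcan 1 1 1 a b c x = 1" "Rcan 1 1 1 a b c x = 0"
    by simp_all
qed

lemma Rcan_unique: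
  assumes "standing a b c" "x \<noteq> 0" "x \<noteq> 1" "contig a b c x \<Phi>" "\<Phi> 0 0 0 = 1" "\<Phi> 1 1 1 = 0"
  shows "Rcan k l m a b c x = \<Phi> k l m"
  using contig_can[OF assms(1-4), of k l m] assms(5,6) by simp

section \<open>The four symmetries of the regular coefficient\<close>

lemma Ints_shift_1: "z + 1 \<in> \<int> \<longleftrightarrow> z \<in> \<int>" "z - 1 \<in> \<int> \<longleftrightarrow> z \<in> \<int>" "1 + z \<in> \<int> \<longleftrightarrow> z \<in> \<int>"
  for z :: complex
  using not_Ints_shift[of z 1] not_Ints_shift[of z "-1"] by (simp_all add: add.commute)

lemma standing_sig0:
  assumes "standing a b c"
  shows "standing (a + of_int i) (b + of_int j) (c + of_int n)"
proof -
  have "c + of_int n - (a + of_int i) = (c - a) + of_int (n - i)"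
    "c + of_int n - (b + of_int j) = (c - b) + of_int (n - j)"
    "c + of_int n - (a + of_int i) - (b + of_int j) = (c - a - b) + of_int (n - i - j)"
    "a + of_int i - (b + of_int j) = (a - b) + of_int (i - j)"
    by (simp_all add: algebra_simps)
  then show ?thesis
    using assms unfolding standing_def by (simp only: not_Ints_shift) blast
qed

lemma standing_sig1:
  assumes "standing a b c"
  shows "standing (c - a - 1) b c"
proof -
  have "c - (c - a - 1) = a + 1" "c - (c - a - 1) - b = (a - b) + 1" "c - a - 1 - b = (c - a - b) - 1"
    by simp_all
  then show ?thesis
    using assms unfolding standing_def by (simp only: Ints_shift_1) blast
qed

lemma standing_sig2:
  assumes "standing a b c"
  shows "standing a b (a + b + 1 - c)"
proof -
  have "a + b + 1 - c - a = - (c - b) + 1" "a + b + 1 - c - b = - (c - a) + 1"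
    "a + b + 1 - c - a - b = - c + 1" "a + b + 1 - c = - (c - a - b) + 1"
    by simp_all
  then show ?thesis
    using assms unfolding standing_def by (simp only: Ints_shift_1 minus_in_Ints_iff) blast
qed

text \<open>Expressing the values at \<open>(1, 1, 1)\<close> through the basis at \<open>(k, l, m)\<close> and \<open>(k-1, l-1, m-1)\<close> and solving
  for the second coefficient brings in the Casoratian.\<close>

lemma Rcan_sig0:
  assumes st: "standing a b c" and x: "x \<noteq> 0" "x \<noteq> 1"
  shows "Rcan k l m a b c x = sig0_factor k l m a b c x
    * Rcan (2 - k) (2 - l) (2 - m) (a + of_int (k - 1)) (b + of_int (l - 1)) (c + of_int (m - 1)) x"
proof -
  note contig = contig_Qcan_Rcan[OF st x]
  define Q R where "Q = Qcan (2 - k) (2 - l) (2 - m) (a + of_int (k - 1)) (b + of_int (l - 1)) (c + of_int (m - 1)) x"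
    and "R = Rcan (2 - k) (2 - l) (2 - m) (a + of_int (k - 1)) (b + of_int (l - 1)) (c + of_int (m - 1)) x"
  \<comment> \<open>With (k - 1, l - 1, m - 1) as new origin, the new second base point is (k, l,
    m), and the old point (1, 1, 1) acquires the coordinates (2 - k, 2 - l, 2 - m); this is where
    \<open>sig0\<close> comes from.\<close>
  have *: "\<Phi> 1 1 1 = Q * \<Phi> k l m + R * \<Phi> (k - 1) (l - 1) (m - 1)" if "contig a b c x \<Phi>" for \<Phi>
    using contig_can[OF standing_sig0[OF st] x contig_shift[OF that], where k = "2 - k" and l = "2 - l" and m = "2 - m"
        and i1 = "k - 1" and j1 = "l - 1" and n1 = "m - 1"]
    by (simp add: Q_def R_def)
  have "casoratian (\<lambda>k l m. Rcan k l m a b c x) (\<lambda>k l m. Qcan k l m a b c x) (k - 1) (l - 1) (m - 1)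
     = - sig0_factor k l m a b c x"
    unfolding casoratian_eq[OF st contig(2,1) x] by (simp add: casoratian_def can_initial[OF st x])
  then have "Rcan (k - 1) (l - 1) (m - 1) a b c x * Qcan k l m a b c x
     - Rcan k l m a b c x * Qcan (k - 1) (l - 1) (m - 1) a b c x = - sig0_factor k l m a b c x"
    by (simp add: casoratian_def)
  moreover have "1 = Q * Qcan k l m a b c x + R * Qcan (k - 1) (l - 1) (m - 1) a b c x"
    "0 = Q * Rcan k l m a b c x + R * Rcan (k - 1) (l - 1) (m - 1) a b c x"
    using *[OF contig(1)] *[OF contig(2)] by (simp_all add: can_initial[OF st x])
  ultimately show ?thesis unfolding R_def[symmetric] by algebra
qed

lemma Rcan_sig1:
  assumes st: "standing a b c" and x: "x \<noteq> 0" "x \<noteq> 1"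
  shows "Rcan k l m a b c x = (1 - x) powi (- l) * Rcan (m + 1 - k) l m (c - a - 1) b c (x / (x - 1))"
proof (rule Rcan_unique[OF st x contig_pfaff[OF st x]])
  have y: "x / (x - 1) \<noteq> 0" "x / (x - 1) \<noteq> 1" using x by (auto simp: field_simps)
  note st' = standing_sig1[OF st]
  show contig: "contig (c - a - 1) b c (x / (x - 1)) (\<lambda>k l m. Rcan k l m (c - a - 1) b c (x / (x - 1)))"
    by (rule contig_Qcan_Rcan[OF st' y])
  \<comment> \<open>The origin is sent to (1, 0, 0). There the raising relation gives the value at
    the origin, namely 1, because the value at (1, 1, 1) is 0.\<close>
  show "(1 - x) powi - 0 * Rcan (0 + 1 - 0) 0 0 (c - a - 1) b c (x / (x - 1)) = 1"
    using contig_raise_a[OF contig, of 0 0 0] can_initial[OF st' y] st by (simp add: standing_def) auto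
  show "(1 - x) powi - 1 * Rcan (1 + 1 - 1) 1 1 (c - a - 1) b c (x / (x - 1)) = 0"
    using can_initial[OF st' y] by simp
qed

lemma Rcan_sig2:
  assumes st: "standing a b c" and x: "x \<noteq> 0" "x \<noteq> 1"
  shows "Rcan k l m a b c x = sig2_factor k l m a b c * Rcan k l (k + l - m) a b (a + b + 1 - c) (1 - x)"
proof (rule Rcan_unique[OF st x contig_reflect[OF st]])
  have y: "1 - x \<noteq> 0" "1 - x \<noteq> 1" using x by auto
  show st': "standing a b (a + b + 1 - c)" by (rule standing_sig2[OF st])
  show contig: "contig a b (a + b + 1 - c) (1 - x) (\<lambda>k l m. Rcan k l m a b (a + b + 1 - c) (1 - x))"
    by (rule contig_Qcan_Rcan[OF st' y])
qed (use can_initial[OF standing_sig2[OF st], of "1 - x"] x in \<open>simp_all add: sig2_factor_def\<close>)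

lemma Rcan_sig3:
  assumes st: "standing a b c" and x: "x \<noteq> 0" "x \<noteq> 1"
  shows "Rcan k l m a b c x = Rcan l k m b a c x"
  by (rule Rcan_unique[OF st x contig_swap[OF contig_Qcan_Rcan(2)[OF standing_swap[OF st] x]]])
    (simp_all add: can_initial[OF standing_swap[OF st] x])

section \<open>Comparison of \<open>Rcoef\<close> with the regular coefficient\<close>

lemma standing_exists: "standing \<i> (3 * \<i>) (9 * \<i>)"
  unfolding standing_def by (auto elim!: Ints_cases simp: complex_eq_iff)

lemma standing_nonzero_polyfun4:
  fixes q :: fun4
  assumes "\<And>a b c x. standing a b c \<Longrightarrow> x \<noteq> 0 \<Longrightarrow> x \<noteq> 1 \<Longrightarrow> q a b c x \<noteq> 0"
  shows "q \<noteq> (\<lambda>a b c x. 0)"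
proof
  assume "q = (\<lambda>a b c x. 0)"
  then show False using assms[OF standing_exists, of "1 / 2"] by simp
qed

lemma contig_pair_exists: "\<exists>R Q. contig_pair k l m Q R"
proof -
  obtain p q where pq: "polyfun4 p" "polyfun4 q"
    and Q: "\<And>a b c x. standing a b c \<Longrightarrow> x \<noteq> 0 \<Longrightarrow> x \<noteq> 1 \<Longrightarrow> q a b c x \<noteq> 0 \<and> Qcan k l m a b c x = p a b c x / q a b c x"
    using regular_can(1)[of k l m] unfolding regular_def by metis
  obtain p' q' where pq': "polyfun4 p'" "polyfun4 q'"
    and R: "\<And>a b c x. standing a b c \<Longrightarrow> x \<noteq> 0 \<Longrightarrow> x \<noteq> 1 \<Longrightarrow> q' a b c x \<noteq> 0 \<and> Rcan k l m a b c x = p' a b c x / q' a b c x"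
    using regular_can(2)[of k l m] unfolding regular_def by metis
  \<comment> \<open>Both fractions are extended by x: \<open>contig_pair\<close> asks for the
    identity wherever the denominators are nonzero, and regularity says nothing at x = 0. The point
    1 is excluded by the disc.\<close>
  have "contig_pair k l m (\<lambda>a b c x. p a b c x * x / (q a b c x * x)) (\<lambda>a b c x. p' a b c x * x / (q' a b c x * x))"
    unfolding contig_pair_def
  proof (rule exI[of _ "\<lambda>a b c x. p a b c x * x"], rule exI[of _ "\<lambda>a b c x. q a b c x * x"],
      rule exI[of _ "\<lambda>a b c x. p' a b c x * x"], rule exI[of _ "\<lambda>a b c x. q' a b c x * x"],
      intro conjI allI impI)
    fix a b c x
    assume "standing a b c \<and> norm x < 1 \<and> q a b c x * x \<noteq> 0 \<and> q' a b c x * x \<noteq> 0"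
    then have st: "standing a b c" and x: "norm x < 1" "x \<noteq> 0" "x \<noteq> 1" by auto
    show "hypF (a + of_int k) (b + of_int l) (c + of_int m) x
             = p a b c x * x / (q a b c x * x) * hypF (a + 1) (b + 1) (c + 1) x
               + p' a b c x * x / (q' a b c x * x) * hypF a b c x"
      using contig_can[OF st x(2,3) contig_hypF[OF st x(1)], of k l m] Q[OF st x(2,3)] R[OF st x(2,3)] x
      by simp
  qed (intro pmult pq pq' pvar_x refl standing_nonzero_polyfun4; use Q R in simp)+
  then show ?thesis by blast
qed

lemma polyfun4_mult_nonzero:
  "polyfun4 p \<Longrightarrow> polyfun4 q \<Longrightarrow> p \<noteq> (\<lambda>a b c x. 0) \<Longrightarrow> q \<noteq> (\<lambda>a b c x. 0) \<Longrightarrow>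
    (\<lambda>a b c x. p a b c x * q a b c x) \<noteq> (\<lambda>a b c x. 0)"
  using polyfun4_mult_eq_0 by blast

text \<open>The cross-multiplied difference f is a polynomial that vanishes identically, so
  agreement holds wherever the given denominator is nonzero and not merely generically. Since
  \<open>qQ\<close> or \<open>qR\<close> may vanish identically on a slice of fixed a, b, c, it is
  their product with f that is first shown to be zero.\<close>

lemma contig_pair_unique:
  assumes "contig_pair k l m Q R"
  obtains p q where "polyfun4 p" "polyfun4 q" "q \<noteq> (\<lambda>a b c x. 0)" "R = (\<lambda>a b c x. p a b c x / q a b c x)"
    "\<And>a b c x. standing a b c \<Longrightarrow> x \<noteq> 0 \<Longrightarrow> x \<noteq> 1 \<Longrightarrow> q a b c x \<noteq> 0 \<Longrightarrow> R a b c x = Rcan k l m a b c x"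
proof -
  obtain p1 q1 where pq1: "polyfun4 p1" "polyfun4 q1"
    and Q1: "\<And>a b c x. standing a b c \<Longrightarrow> x \<noteq> 0 \<Longrightarrow> x \<noteq> 1 \<Longrightarrow> q1 a b c x \<noteq> 0 \<and> Qcan k l m a b c x = p1 a b c x / q1 a b c x"
    using regular_can(1)[of k l m] unfolding regular_def by metis
  obtain p2 q2 where pq2: "polyfun4 p2" "polyfun4 q2"
    and R2: "\<And>a b c x. standing a b c \<Longrightarrow> x \<noteq> 0 \<Longrightarrow> x \<noteq> 1 \<Longrightarrow> q2 a b c x \<noteq> 0 \<and> Rcan k l m a b c x = p2 a b c x / q2 a b c x"
    using regular_can(2)[of k l m] unfolding regular_def by metis
  obtain pQ qQ pR qR where poly: "polyfun4 pQ" "polyfun4 qQ" "polyfun4 pR" "polyfun4 qR"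
    and nz: "qQ \<noteq> (\<lambda>a b c x. 0)" "qR \<noteq> (\<lambda>a b c x. 0)"
    and QR: "Q = (\<lambda>a b c x. pQ a b c x / qQ a b c x)" "R = (\<lambda>a b c x. pR a b c x / qR a b c x)"
    and eq: "\<And>a b c x. standing a b c \<Longrightarrow> norm x < 1 \<Longrightarrow> qQ a b c x \<noteq> 0 \<Longrightarrow> qR a b c x \<noteq> 0 \<Longrightarrow>
           hypF (a + of_int k) (b + of_int l) (c + of_int m) x
             = Q a b c x * hypF (a + 1) (b + 1) (c + 1) x + R a b c x * hypF a b c x"
    using assms unfolding contig_pair_def by blast
  define f where "f = (\<lambda>a b c x. pR a b c x * q2 a b c x - p2 a b c x * qR a b c x)"
  have f: "polyfun4 f" unfolding f_def by (intro polyfun4_diff pmult poly pq2)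
  have "(\<lambda>a b c x. f a b c x * (qQ a b c x * qR a b c x)) = (\<lambda>a b c x. 0)"
  proof (rule polyfun4_eq_0I)
    show "polyfun4 (\<lambda>a b c x. f a b c x * (qQ a b c x * qR a b c x))" by (intro pmult f poly)
    fix a b c x0 :: complex
    assume st: "standing a b c"
    show "f a b c x0 * (qQ a b c x0 * qR a b c x0) = 0"
    proof (cases "qQ a b c x0 * qR a b c x0 = 0")
      case False
      obtain P1 where P1: "\<And>x. p1 a b c x = poly P1 x" by (rule polyfun4_in_x[OF pq1(1)]) blast
      obtain Q1' where Q1': "\<And>x. q1 a b c x = poly Q1' x" by (rule polyfun4_in_x[OF pq1(2)]) blast
      obtain P2 where P2: "\<And>x. p2 a b c x = poly P2 x" by (rule polyfun4_in_x[OF pq2(1)]) blast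
      obtain Q2 where Q2: "\<And>x. q2 a b c x = poly Q2 x" by (rule polyfun4_in_x[OF pq2(2)]) blast
      obtain PQ where PQ: "\<And>x. pQ a b c x = poly PQ x" by (rule polyfun4_in_x[OF poly(1)]) blast
      obtain QQ where QQ: "\<And>x. qQ a b c x = poly QQ x" by (rule polyfun4_in_x[OF poly(2)]) blast
      obtain PR where PR: "\<And>x. pR a b c x = poly PR x" by (rule polyfun4_in_x[OF poly(3)]) blast
      obtain QR' where QR': "\<And>x. qR a b c x = poly QR' x" by (rule polyfun4_in_x[OF poly(4)]) blast
      \<comment> \<open>A and B are the differences of the two pairs of coefficients after clearing
        all four denominators; Z kills the values of x at which the two expansions cannot be
        compared.\<close>
      define A B Z where "A = (PQ * Q1' - P1 * QQ) * (QR' * Q2)" and "B = (PR * Q2 - P2 * QR') * (QQ * Q1')"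
        and "Z = [:0, 1:] * (QQ * QR')"
      have "Z * A = 0 \<and> Z * B = 0"
      proof (rule hypF_independent[OF st])
        fix x :: complex assume x: "norm x < 1"
        show "poly (Z * A) x * hypF (a + 1) (b + 1) (c + 1) x + poly (Z * B) x * hypF a b c x = 0"
        proof (cases "poly Z x = 0")
          case False
          then have nz: "x \<noteq> 0" "poly QQ x \<noteq> 0" "poly QR' x \<noteq> 0" by (auto simp: Z_def)
          have x1: "x \<noteq> 1" using x by auto
          have nz': "poly Q1' x \<noteq> 0" "poly Q2 x \<noteq> 0"
            using Q1[OF st nz(1) x1] R2[OF st nz(1) x1] by (auto simp: Q1' Q2)
          have Qc: "Qcan k l m a b c x = poly P1 x / poly Q1' x"
            using Q1[OF st nz(1) x1] by (simp add: P1 Q1')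
          have Rc: "Rcan k l m a b c x = poly P2 x / poly Q2 x"
            using R2[OF st nz(1) x1] by (simp add: P2 Q2)
          have "Q a b c x * hypF (a + 1) (b + 1) (c + 1) x + R a b c x * hypF a b c x
            = Qcan k l m a b c x * hypF (a + 1) (b + 1) (c + 1) x + Rcan k l m a b c x * hypF a b c x"
            using eq[OF st x] contig_can[OF st nz(1) x1 contig_hypF[OF st x], of k l m] nz
            by (simp add: QQ QR')
          then have "(Q a b c x - Qcan k l m a b c x) * hypF (a + 1) (b + 1) (c + 1) x
            + (R a b c x - Rcan k l m a b c x) * hypF a b c x = 0"
            by (simp add: algebra_simps)
          moreover have "poly A x = poly QQ x * poly Q1' x * poly QR' x * poly Q2 x * (Q a b c x - Qcan k l m a b c x)"
            unfolding Qc using nz nz' by (simp add: A_def QR PQ QQ divide_simps)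
          moreover have "poly B x = poly QQ x * poly Q1' x * poly QR' x * poly Q2 x * (R a b c x - Rcan k l m a b c x)"
            unfolding Rc using nz nz' by (simp add: B_def QR PR QR' divide_simps)
          ultimately have "poly A x * hypF (a + 1) (b + 1) (c + 1) x + poly B x * hypF a b c x = 0"
            by algebra
          then show ?thesis unfolding poly_mult by algebra
        qed simp
      qed
      moreover have "QQ \<noteq> 0" "QR' \<noteq> 0" using False by (auto simp: QQ QR')
      moreover have "Q1' \<noteq> 0" using Q1[OF st, of "1/2"] by (auto simp: Q1')
      ultimately have "PR * Q2 - P2 * QR' = 0" by (auto simp: Z_def B_def)
      then have "poly (PR * Q2 - P2 * QR') x0 = 0" by simp
      then show ?thesis by (simp add: f_def PR P2 Q2 QR')
    qed simp
  qed
  then have "f = (\<lambda>a b c x. 0)"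
    using polyfun4_mult_eq_0[OF f pmult[OF poly(2,4)]] polyfun4_mult_nonzero[OF poly(2,4) nz] by blast
  then have f0: "pR a b c x * q2 a b c x = p2 a b c x * qR a b c x" for a b c x
    by (simp add: f_def fun_eq_iff)
  show ?thesis
  proof (rule that[of pR qR])
    fix a b c x
    assume "standing a b c" "x \<noteq> 0" "x \<noteq> 1" "qR a b c x \<noteq> 0"
    then show "R a b c x = Rcan k l m a b c x"
      using f0[of a b c x] R2[of a b c x] by (simp add: QR frac_eq_eq)
  qed (use poly nz QR in simp_all)
qed

lemma Rcoef_Rcan:
  obtains p q where "polyfun4 p" "polyfun4 q" "q \<noteq> (\<lambda>a b c x. 0)" "Rcoef k l m = (\<lambda>a b c x. p a b c x / q a b c x)"
    "\<And>a b c x. standing a b c \<Longrightarrow> x \<noteq> 0 \<Longrightarrow> x \<noteq> 1 \<Longrightarrow> q a b c x \<noteq> 0 \<Longrightarrow> Rcoef k l m a b c x = Rcan k l m a b c x"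
proof -
  have "\<exists>Q. contig_pair k l m Q (Rcoef k l m)"
    unfolding Rcoef_def by (rule someI_ex[OF contig_pair_exists])
  then show ?thesis using contig_pair_unique that by blast
qed

subsection \<open>Rational functions and generic equality\<close>

text \<open>The fraction is prescribed only off the zeros of its denominator, so the values that
  total division and inversion assign at poles do not obstruct closure under the field
  operations.\<close>

definition rational :: "fun4 \<Rightarrow> bool" where
  "rational f \<longleftrightarrow> (\<exists>p q. polyfun4 p \<and> polyfun4 q \<and> q \<noteq> (\<lambda>a b c x. 0) \<and>
     (\<forall>a b c x. q a b c x \<noteq> 0 \<longrightarrow> f a b c x = p a b c x / q a b c x))"

lemma rationalE:
  assumes "rational f"
  obtains p q where "polyfun4 p" "polyfun4 q" "q \<noteq> (\<lambda>a b c x. 0)"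
    "\<And>a b c x. q a b c x \<noteq> 0 \<Longrightarrow> f a b c x = p a b c x / q a b c x"
  using assms unfolding rational_def by blast

lemma rationalI:
  assumes "polyfun4 p" "polyfun4 q" "q \<noteq> (\<lambda>a b c x. 0)"
    "\<And>a b c x. q a b c x \<noteq> 0 \<Longrightarrow> f a b c x = p a b c x / q a b c x"
  shows "rational f"
  using assms unfolding rational_def by blast

lemma rational_polyfun4: "polyfun4 p \<Longrightarrow> rational p"
  by (rule rationalI[OF _ pconst[of 1]]) (simp_all add: fun_eq_iff)

lemma rational_mult:
  assumes "rational f" "rational g"
  shows "rational (\<lambda>a b c x. f a b c x * g a b c x)"
proof -
  obtain p q where pq: "polyfun4 p" "polyfun4 q" "q \<noteq> (\<lambda>a b c x. 0)"
    and f: "\<And>a b c x. q a b c x \<noteq> 0 \<Longrightarrow> f a b c x = p a b c x / q a b c x"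
    using assms(1) by (rule rationalE) blast
  obtain p' q' where pq': "polyfun4 p'" "polyfun4 q'" "q' \<noteq> (\<lambda>a b c x. 0)"
    and g: "\<And>a b c x. q' a b c x \<noteq> 0 \<Longrightarrow> g a b c x = p' a b c x / q' a b c x"
    using assms(2) by (rule rationalE) blast
  show ?thesis
    by (rule rationalI[OF pmult[OF pq(1) pq'(1)] pmult[OF pq(2) pq'(2)]
          polyfun4_mult_nonzero[OF pq(2) pq'(2) pq(3) pq'(3)]]) (simp add: f g)
qed

lemma rational_inverse:
  assumes "rational f"
  shows "rational (\<lambda>a b c x. inverse (f a b c x))"
proof -
  obtain p q where pq: "polyfun4 p" "polyfun4 q" "q \<noteq> (\<lambda>a b c x. 0)"
    and f: "\<And>a b c x. q a b c x \<noteq> 0 \<Longrightarrow> f a b c x = p a b c x / q a b c x"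
    using assms by (rule rationalE) blast
  show ?thesis
  proof (cases "p = (\<lambda>a b c x. 0)")
    case True
    then show ?thesis using f by (intro rationalI[OF pq]) simp
  next
    case False
    show ?thesis
      \<comment> \<open>The inverse is written as q * q over p * q, so that a nonzero denominator
        also guarantees that the formula for f applies.\<close>
      by (rule rationalI[OF pmult[OF pq(2,2)] pmult[OF pq(1,2)] polyfun4_mult_nonzero[OF pq(1,2) False pq(3)]])
        (simp add: f)
  qed
qed

lemma rational_divide:
  "rational f \<Longrightarrow> rational g \<Longrightarrow> rational (\<lambda>a b c x. f a b c x / g a b c x)"
  unfolding divide_inverse by (intro rational_mult rational_inverse)

lemma rational_power:
  assumes "rational f"
  shows "rational (\<lambda>a b c x. f a b c x ^ n)"
proof (induction n)
  case 0
  show ?case using rational_polyfun4[OF pconst[of 1]] by simp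
next
  case (Suc n)
  then show ?case using rational_mult[OF assms Suc] by simp
qed

lemma rational_power_int: "rational f \<Longrightarrow> rational (\<lambda>a b c x. f a b c x powi n)"
  using rational_power[of f] rational_power[OF rational_inverse, of f]
  unfolding power_int_def by (cases "n \<ge> 0") simp_all

lemma polyfun4_pochhammer:
  assumes "polyfun4 p"
  shows "polyfun4 (\<lambda>a b c x. pochhammer (p a b c x) n)"
proof (induction n)
  case 0
  show ?case using pconst[of 1] by simp
next
  case (Suc n)
  then show ?case
    unfolding pochhammer_Suc by (intro pmult padd pconst assms)
qed

lemma rational_poch: "polyfun4 p \<Longrightarrow> rational (\<lambda>a b c x. poch (p a b c x) n)"
  using rational_polyfun4[OF polyfun4_pochhammer, of p "nat n"]
    rational_inverse[OF rational_polyfun4[OF polyfun4_pochhammer[OF padd[OF _ pconst]]], of p "of_int n" "nat (- n)"]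
  unfolding poch_def by (cases "n \<ge> 0") simp_all

text \<open>Trades validity at standing points off a hypersurface for validity on a Zariski open
  set: the cross-multiplied difference is a polynomial, and the standing points are dense enough to
  make it zero.\<close>

lemma generically_eqI:
  assumes "rational f" "rational g" and r: "polyfun4 r" "r \<noteq> (\<lambda>a b c x. 0)"
    and eq: "\<And>a b c x. standing a b c \<Longrightarrow> r a b c x \<noteq> 0 \<Longrightarrow> f a b c x = g a b c x"
  shows "generically (\<lambda>a b c x. f a b c x = g a b c x)"
proof -
  obtain p q where pq: "polyfun4 p" "polyfun4 q" "q \<noteq> (\<lambda>a b c x. 0)"
    and f: "\<And>a b c x. q a b c x \<noteq> 0 \<Longrightarrow> f a b c x = p a b c x / q a b c x"
    using assms(1) by (rule rationalE) blast
  obtain p' q' where pq': "polyfun4 p'" "polyfun4 q'" "q' \<noteq> (\<lambda>a b c x. 0)"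
    and g: "\<And>a b c x. q' a b c x \<noteq> 0 \<Longrightarrow> g a b c x = p' a b c x / q' a b c x"
    using assms(2) by (rule rationalE) blast
  define h where "h = (\<lambda>a b c x. p a b c x * q' a b c x - p' a b c x * q a b c x)"
  define d where "d = (\<lambda>a b c x. q a b c x * q' a b c x)"
  have d: "polyfun4 d" "d \<noteq> (\<lambda>a b c x. 0)"
    unfolding d_def using pmult[OF pq(2) pq'(2)] polyfun4_mult_nonzero[OF pq(2) pq'(2) pq(3) pq'(3)] by simp_all
  have h: "polyfun4 h" unfolding h_def by (intro polyfun4_diff pmult pq pq')
  have "(\<lambda>a b c x. h a b c x * (d a b c x * r a b c x)) = (\<lambda>a b c x. 0)"
  proof (rule polyfun4_eq_0I)
    show "polyfun4 (\<lambda>a b c x. h a b c x * (d a b c x * r a b c x))" by (intro pmult h d r)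
    fix a b c x assume st: "standing a b c"
    show "h a b c x * (d a b c x * r a b c x) = 0"
    proof (cases "d a b c x * r a b c x = 0")
      case False
      then have "p a b c x / q a b c x = p' a b c x / q' a b c x" "q a b c x \<noteq> 0" "q' a b c x \<noteq> 0"
        using eq[OF st, of x] f[of a b c x] g[of a b c x] by (auto simp: d_def)
      then show ?thesis by (simp add: h_def frac_eq_eq)
    qed simp
  qed
  then have "h = (\<lambda>a b c x. 0)"
    using polyfun4_mult_eq_0[OF h pmult[OF d(1) r(1)]] polyfun4_mult_nonzero[OF d(1) r(1) d(2) r(2)] by blast
  then have "p a b c x * q' a b c x = p' a b c x * q a b c x" for a b c x
    by (simp add: h_def fun_eq_iff)
  then have "f a b c x = g a b c x" if "d a b c x \<noteq> 0" for a b c x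
    using that f[of a b c x] g[of a b c x] by (simp add: d_def frac_eq_eq)
  then show ?thesis unfolding generically_def using d by blast
qed

subsection \<open>The group action\<close>

lemma eval_aff_arith:
  "eval_aff (aff_shift j \<alpha>) a b c = eval_aff \<alpha> a b c + of_int j"
  "eval_aff (aff_add \<alpha> \<beta>) a b c = eval_aff \<alpha> a b c + eval_aff \<beta> a b c"
  "eval_aff (aff_sub \<alpha> \<beta>) a b c = eval_aff \<alpha> a b c - eval_aff \<beta> a b c"
  by (cases \<alpha>; cases \<beta>; simp add: algebra_simps)+

lemma polyfun4_eval_aff: "polyfun4 (\<lambda>a b c x. eval_aff \<alpha> a b c)"
  by (cases \<alpha>) (simp, intro polyfun4_intros)

lemma eval_x_nontrivial: "x \<noteq> 0 \<Longrightarrow> x \<noteq> 1 \<Longrightarrow> eval_x \<beta> x \<noteq> 0 \<and> eval_x \<beta> x \<noteq> 1"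
  by (cases \<beta>) (auto simp: field_simps)

lemma eval_x_div_xm1: "x \<noteq> 0 \<Longrightarrow> x \<noteq> 1 \<Longrightarrow> eval_x (x_div_xm1 \<beta>) x = eval_x \<beta> x / (eval_x \<beta> x - 1)"
  by (cases \<beta>) (auto simp: divide_simps)

lemma eval_x_one_minus: "x \<noteq> 0 \<Longrightarrow> x \<noteq> 1 \<Longrightarrow> eval_x (one_minus \<beta>) x = 1 - eval_x \<beta> x"
  by (cases \<beta>) (simp_all add: field_simps)

fun Rcan_map :: "spt \<Rightarrow> fun4" where
  "Rcan_map (Spt k l m \<alpha>1 \<alpha>2 \<alpha>3 \<beta>) =
     (\<lambda>a b c x. Rcan k l m (eval_aff \<alpha>1 a b c) (eval_aff \<alpha>2 a b c) (eval_aff \<alpha>3 a b c) (eval_x \<beta> x))"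

text \<open>The substitution encoded by a point must be dominant, since otherwise a nonzero denominator
  could become zero.\<close>

fun admissible :: "spt \<Rightarrow> bool" where
  "admissible (Spt k l m \<alpha>1 \<alpha>2 \<alpha>3 \<beta>) \<longleftrightarrow>
     (\<forall>a b c. standing a b c \<longrightarrow> standing (eval_aff \<alpha>1 a b c) (eval_aff \<alpha>2 a b c) (eval_aff \<alpha>3 a b c)) \<and>
     (\<forall>a' b' c'. \<exists>a b c. eval_aff \<alpha>1 a b c = a' \<and> eval_aff \<alpha>2 a b c = b' \<and> eval_aff \<alpha>3 a b c = c')"

lemma admissible_base: "admissible (base k l m)"
  by (simp add: base_def)

lemma admissible_sig0: "admissible z \<Longrightarrow> admissible (sig0 z)"
proof (cases z)
  case (Spt k l m \<alpha>1 \<alpha>2 \<alpha>3 \<beta>)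
  assume "admissible z"
  then have st: "\<And>a b c. standing a b c \<Longrightarrow> standing (eval_aff \<alpha>1 a b c) (eval_aff \<alpha>2 a b c) (eval_aff \<alpha>3 a b c)"
    and surj: "\<And>a' b' c'. \<exists>a b c. eval_aff \<alpha>1 a b c = a' \<and> eval_aff \<alpha>2 a b c = b' \<and> eval_aff \<alpha>3 a b c = c'"
    using Spt by simp_all
  have "\<exists>a b c. eval_aff \<alpha>1 a b c + of_int (k - 1) = a' \<and> eval_aff \<alpha>2 a b c + of_int (l - 1) = b'
      \<and> eval_aff \<alpha>3 a b c + of_int (m - 1) = c'" for a' b' c'
    using surj[of "a' - of_int (k - 1)" "b' - of_int (l - 1)" "c' - of_int (m - 1)"] by (simp add: eq_diff_eq)
  then show ?thesis
    using standing_sig0[OF st] Spt by (simp add: eval_aff_arith del: of_int_diff)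
qed

lemma admissible_sig1: "admissible z \<Longrightarrow> admissible (sig1 z)"
proof (cases z)
  case (Spt k l m \<alpha>1 \<alpha>2 \<alpha>3 \<beta>)
  assume "admissible z"
  then have st: "\<And>a b c. standing a b c \<Longrightarrow> standing (eval_aff \<alpha>1 a b c) (eval_aff \<alpha>2 a b c) (eval_aff \<alpha>3 a b c)"
    and surj: "\<And>a' b' c'. \<exists>a b c. eval_aff \<alpha>1 a b c = a' \<and> eval_aff \<alpha>2 a b c = b' \<and> eval_aff \<alpha>3 a b c = c'"
    using Spt by simp_all
  have "\<exists>a b c. eval_aff \<alpha>3 a b c - eval_aff \<alpha>1 a b c - 1 = a' \<and> eval_aff \<alpha>2 a b c = b' \<and> eval_aff \<alpha>3 a b c = c'"
    for a' b' c'
    using surj[of "c' - a' - 1" b' c'] by force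
  then show ?thesis
    using standing_sig1[OF st] Spt by (simp add: eval_aff_arith)
qed

lemma admissible_sig2: "admissible z \<Longrightarrow> admissible (sig2 z)"
proof (cases z)
  case (Spt k l m \<alpha>1 \<alpha>2 \<alpha>3 \<beta>)
  assume "admissible z"
  then have st: "\<And>a b c. standing a b c \<Longrightarrow> standing (eval_aff \<alpha>1 a b c) (eval_aff \<alpha>2 a b c) (eval_aff \<alpha>3 a b c)"
    and surj: "\<And>a' b' c'. \<exists>a b c. eval_aff \<alpha>1 a b c = a' \<and> eval_aff \<alpha>2 a b c = b' \<and> eval_aff \<alpha>3 a b c = c'"
    using Spt by simp_all
  have "\<exists>a b c. eval_aff \<alpha>1 a b c = a' \<and> eval_aff \<alpha>2 a b c = b' \<and> eval_aff \<alpha>1 a b c + eval_aff \<alpha>2 a b c - eval_aff \<alpha>3 a b c + 1 = c'"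
    for a' b' c'
    using surj[of a' b' "a' + b' + 1 - c'"] by force
  moreover have "standing (eval_aff \<alpha>1 a b c) (eval_aff \<alpha>2 a b c) (eval_aff \<alpha>1 a b c + eval_aff \<alpha>2 a b c - eval_aff \<alpha>3 a b c + 1)"
    if "standing a b c" for a b c
    using standing_sig2[OF st[OF that]] by (simp add: algebra_simps)
  ultimately show ?thesis
    using Spt by (simp add: eval_aff_arith)
qed

lemma admissible_sig3: "admissible z \<Longrightarrow> admissible (sig3 z)"
  by (cases z) (use standing_swap in \<open>simp; metis\<close>)

text \<open>The shape of prefactor that the theorem allows. These functions are closed under
  products and inverses, so the factors can be accumulated along a word in the generators.\<close>

definition equiv_factor :: "fun4 \<Rightarrow> bool" where
  "equiv_factor f \<longleftrightarrow> (\<exists>(ps :: (aff \<times> int) list) n1 n2 n3. \<forall>a b c x. standing a b c \<longrightarrow> x \<noteq> 0 \<longrightarrow> x \<noteq> 1 \<longrightarrow>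
      f a b c x = (\<Prod>(\<alpha>, n)\<leftarrow>ps. poch (eval_aff \<alpha> a b c) n) * (-1) powi n1 * x powi n2 * (1 - x) powi n3)"

lemma equiv_factorI:
  fixes ps :: "(aff \<times> int) list"
  assumes "\<And>a b c x. standing a b c \<Longrightarrow> x \<noteq> 0 \<Longrightarrow> x \<noteq> 1 \<Longrightarrow>
      f a b c x = (\<Prod>(\<alpha>, n)\<leftarrow>ps. poch (eval_aff \<alpha> a b c) n) * (-1) powi n1 * x powi n2 * (1 - x) powi n3"
  shows "equiv_factor f"
  using assms unfolding equiv_factor_def by blast

lemma equiv_factor_poch: "equiv_factor (\<lambda>a b c x. poch (eval_aff \<alpha> a b c) n)"
  by (rule equiv_factorI[where ps = "[(\<alpha>, n)]" and ?n1.0 = 0 and ?n2.0 = 0 and ?n3.0 = 0]) simp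

lemma equiv_factor_1: "equiv_factor (\<lambda>a b c x. 1)"
  by (rule equiv_factorI[where ps = "[]" and ?n1.0 = 0 and ?n2.0 = 0 and ?n3.0 = 0]) simp

lemma equiv_factor_mult:
  assumes "equiv_factor f" "equiv_factor g"
  shows "equiv_factor (\<lambda>a b c x. f a b c x * g a b c x)"
proof -
  obtain ps n1 n2 n3 where f: "\<And>a b c x. standing a b c \<Longrightarrow> x \<noteq> 0 \<Longrightarrow> x \<noteq> 1 \<Longrightarrow>
      f a b c x = (\<Prod>(\<alpha>, n)\<leftarrow>ps. poch (eval_aff \<alpha> a b c) n) * (-1) powi n1 * x powi n2 * (1 - x) powi n3"
    using assms(1) unfolding equiv_factor_def by blast
  obtain ps' n1' n2' n3' where g: "\<And>a b c x. standing a b c \<Longrightarrow> x \<noteq> 0 \<Longrightarrow> x \<noteq> 1 \<Longrightarrow>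
      g a b c x = (\<Prod>(\<alpha>, n)\<leftarrow>ps'. poch (eval_aff \<alpha> a b c) n) * (-1) powi n1' * x powi n2' * (1 - x) powi n3'"
    using assms(2) unfolding equiv_factor_def by blast
  show ?thesis
    by (rule equiv_factorI[where ps = "ps @ ps'" and ?n1.0 = "n1 + n1'" and ?n2.0 = "n2 + n2'" and ?n3.0 = "n3 + n3'"])
      (simp add: f g power_int_add mult_ac)
qed

lemma equiv_factor_inverse:
  assumes "equiv_factor f"
  shows "equiv_factor (\<lambda>a b c x. inverse (f a b c x))"
proof -
  obtain ps n1 n2 n3 where f: "\<And>a b c x. standing a b c \<Longrightarrow> x \<noteq> 0 \<Longrightarrow> x \<noteq> 1 \<Longrightarrow>
      f a b c x = (\<Prod>(\<alpha>, n)\<leftarrow>ps. poch (eval_aff \<alpha> a b c) n) * (-1) powi n1 * x powi n2 * (1 - x) powi n3"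
    using assms(1) unfolding equiv_factor_def by blast
  have "inverse (\<Prod>(\<alpha>, n)\<leftarrow>ps. poch (eval_aff \<alpha> a b c) n)
     = (\<Prod>(\<alpha>, n)\<leftarrow>map (\<lambda>(\<alpha>, n). (aff_shift n \<alpha>, - n)) ps. poch (eval_aff \<alpha> a b c) n)" for a b c
    by (induction ps) (simp_all add: case_prod_unfold poch_inverse eval_aff_arith)
  then show ?thesis
    by (intro equiv_factorI[where ps = "map (\<lambda>(\<alpha>, n). (aff_shift n \<alpha>, - n)) ps" and ?n1.0 = "-n1"
          and ?n2.0 = "-n2" and ?n3.0 = "-n3"])
      (simp add: f power_int_minus)
qed

lemma equiv_factor_divide:
  "equiv_factor f \<Longrightarrow> equiv_factor g \<Longrightarrow> equiv_factor (\<lambda>a b c x. f a b c x / g a b c x)"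
  unfolding divide_inverse by (intro equiv_factor_mult equiv_factor_inverse)

lemma equiv_factor_power:
  assumes "equiv_factor f"
  shows "equiv_factor (\<lambda>a b c x. f a b c x ^ n)"
proof (induction n)
  case 0
  show ?case using equiv_factor_1 by simp
next
  case (Suc n)
  then show ?case using equiv_factor_mult[OF assms Suc] by simp
qed

lemma equiv_factor_power_int: "equiv_factor f \<Longrightarrow> equiv_factor (\<lambda>a b c x. f a b c x powi n)"
  using equiv_factor_power[of f] equiv_factor_power[OF equiv_factor_inverse, of f]
  unfolding power_int_def by (cases "n \<ge> 0") simp_all

lemma equiv_factor_minus_1: "equiv_factor (\<lambda>a b c x. -1)"
  by (rule equiv_factorI[where ps = "[]" and ?n1.0 = 1 and ?n2.0 = 0 and ?n3.0 = 0]) simp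

lemma equiv_factor_x: "equiv_factor (\<lambda>a b c x. x)" "equiv_factor (\<lambda>a b c x. 1 - x)"
  by (rule equiv_factorI[where ps = "[]" and ?n1.0 = 0 and ?n2.0 = 1 and ?n3.0 = 0], simp)
     (rule equiv_factorI[where ps = "[]" and ?n1.0 = 0 and ?n2.0 = 0 and ?n3.0 = 1], simp)

lemma equiv_factor_cong:
  assumes "equiv_factor g" "\<And>a b c x. standing a b c \<Longrightarrow> x \<noteq> 0 \<Longrightarrow> x \<noteq> 1 \<Longrightarrow> f a b c x = g a b c x"
  shows "equiv_factor f"
proof -
  obtain ps n1 n2 n3 where "\<And>a b c x. standing a b c \<Longrightarrow> x \<noteq> 0 \<Longrightarrow> x \<noteq> 1 \<Longrightarrow>
      g a b c x = (\<Prod>(\<alpha>, n)\<leftarrow>ps. poch (eval_aff \<alpha> a b c) n) * (-1) powi n1 * x powi n2 * (1 - x) powi n3"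
    using assms(1) unfolding equiv_factor_def by blast
  then show ?thesis
    by (intro equiv_factorI[where ps = ps and ?n1.0 = n1 and ?n2.0 = n2 and ?n3.0 = n3]) (simp add: assms(2))
qed

text \<open>Each of the six transforms of x is, up to sign, a product of integer powers of x and 1 -
  x, so powers of the substituted variable keep the required form.\<close>

lemma equiv_factor_eval_x: "equiv_factor (\<lambda>a b c x. eval_x \<beta> x)"
proof -
  note intros = equiv_factor_mult equiv_factor_divide equiv_factor_minus_1 equiv_factor_x equiv_factor_1
  have "equiv_factor (\<lambda>a b c x. -1 * (x / (1 - x)))" "equiv_factor (\<lambda>a b c x. -1 * ((1 - x) / x))"
    "equiv_factor (\<lambda>a b c x. 1 / x)" "equiv_factor (\<lambda>a b c x. 1 / (1 - x))"
    by (intro intros)+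
  note * = this
  have "equiv_factor (\<lambda>a b c x. x / (x - 1))"
    by (rule equiv_factor_cong[OF *(1)]) (simp add: field_simps)
  moreover have "equiv_factor (\<lambda>a b c x. (x - 1) / x)"
    by (rule equiv_factor_cong[OF *(2)]) (simp add: field_simps)
  ultimately show ?thesis
    using equiv_factor_x *(3,4) by (cases \<beta>) simp_all
qed

lemma equiv_factor_one_minus_eval_x: "equiv_factor (\<lambda>a b c x. 1 - eval_x \<beta> x)"
  by (rule equiv_factor_cong[OF equiv_factor_eval_x[of "one_minus \<beta>"]]) (simp add: eval_x_one_minus)

definition linked :: "spt \<Rightarrow> spt \<Rightarrow> bool" where
  "linked z z' \<longleftrightarrow> (\<exists>f. equiv_factor f \<and>
     (\<forall>a b c x. standing a b c \<longrightarrow> x \<noteq> 0 \<longrightarrow> x \<noteq> 1 \<longrightarrow> Rcan_map z a b c x = f a b c x * Rcan_map z' a b c x))"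

lemma linkedI:
  assumes "equiv_factor f" "\<And>a b c x. standing a b c \<Longrightarrow> x \<noteq> 0 \<Longrightarrow> x \<noteq> 1 \<Longrightarrow>
     Rcan_map z a b c x = f a b c x * Rcan_map z' a b c x"
  shows "linked z z'"
  using assms unfolding linked_def by blast

lemma linked_refl: "linked z z"
  by (rule linkedI[OF equiv_factor_1]) simp

lemma linked_trans:
  assumes "linked z z'" "linked z' z''"
  shows "linked z z''"
proof -
  obtain f where f: "equiv_factor f" "\<And>a b c x. standing a b c \<Longrightarrow> x \<noteq> 0 \<Longrightarrow> x \<noteq> 1 \<Longrightarrow>
     Rcan_map z a b c x = f a b c x * Rcan_map z' a b c x"
    using assms(1) unfolding linked_def by blast
  obtain g where g: "equiv_factor g" "\<And>a b c x. standing a b c \<Longrightarrow> x \<noteq> 0 \<Longrightarrow> x \<noteq> 1 \<Longrightarrow>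
     Rcan_map z' a b c x = g a b c x * Rcan_map z'' a b c x"
    using assms(2) unfolding linked_def by blast
  show ?thesis
    by (rule linkedI[OF equiv_factor_mult[OF f(1) g(1)]]) (simp add: f g)
qed

text \<open>The four symmetries hold at the substituted parameters of z; what has to be added is
  that their factors, rewritten in the original a, b, c, x, still have the allowed shape.\<close>

lemma linked_sig:
  assumes "admissible z"
  shows linked_sig0: "linked z (sig0 z)" and linked_sig1: "linked z (sig1 z)"
    and linked_sig2: "linked z (sig2 z)" and linked_sig3: "linked z (sig3 z)"
proof -
  obtain k l m \<alpha>1 \<alpha>2 \<alpha>3 \<beta> where z: "z = Spt k l m \<alpha>1 \<alpha>2 \<alpha>3 \<beta>" by (cases z)
  have st: "standing (eval_aff \<alpha>1 a b c) (eval_aff \<alpha>2 a b c) (eval_aff \<alpha>3 a b c)" if "standing a b c" for a b c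
    using assms that by (simp add: z)
  note intros = equiv_factor_mult equiv_factor_divide equiv_factor_power_int equiv_factor_minus_1
    equiv_factor_eval_x equiv_factor_one_minus_eval_x equiv_factor_poch
  have shift: "equiv_factor (\<lambda>a b c x. poch (eval_aff \<alpha> a b c + 1) n)"
    "equiv_factor (\<lambda>a b c x. poch (eval_aff \<alpha> a b c - eval_aff \<beta> a b c) n)"
    "equiv_factor (\<lambda>a b c x. poch (eval_aff \<alpha> a b c - eval_aff \<beta> a b c - eval_aff \<gamma> a b c) n)" for \<alpha> \<beta> \<gamma> n
    using equiv_factor_poch[of "aff_shift 1 \<alpha>" n] equiv_factor_poch[of "aff_sub \<alpha> \<beta>" n]
     equiv_factor_poch[of "aff_sub (aff_sub \<alpha> \<beta>) \<gamma>" n] by (simp_all add: eval_aff_arith)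
  show "linked z (sig0 z)"
  proof (rule linkedI)
    show "equiv_factor (\<lambda>a b c x. sig0_factor k l m (eval_aff \<alpha>1 a b c) (eval_aff \<alpha>2 a b c) (eval_aff \<alpha>3 a b c) (eval_x \<beta> x))"
      unfolding sig0_factor_def by (intro intros shift)
  next
    fix a b c x :: complex assume *: "standing a b c" "x \<noteq> 0" "x \<noteq> 1"
    show "Rcan_map z a b c x = sig0_factor k l m (eval_aff \<alpha>1 a b c) (eval_aff \<alpha>2 a b c) (eval_aff \<alpha>3 a b c) (eval_x \<beta> x)
        * Rcan_map (sig0 z) a b c x"
      using Rcan_sig0[OF st[OF *(1)], of "eval_x \<beta> x" k l m] eval_x_nontrivial[OF *(2,3)]
      by (simp add: z eval_aff_arith)
  qed
  show "linked z (sig1 z)"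
  proof (rule linkedI)
    show "equiv_factor (\<lambda>a b c x. (1 - eval_x \<beta> x) powi (- l))"
      by (intro intros)
  next
    fix a b c x :: complex assume *: "standing a b c" "x \<noteq> 0" "x \<noteq> 1"
    show "Rcan_map z a b c x = (1 - eval_x \<beta> x) powi (- l) * Rcan_map (sig1 z) a b c x"
      using Rcan_sig1[OF st[OF *(1)], of "eval_x \<beta> x" k l m] eval_x_nontrivial[OF *(2,3)] eval_x_div_xm1[OF *(2,3)]
      by (simp add: z eval_aff_arith)
  qed
  show "linked z (sig2 z)"
  proof (rule linkedI)
    show "equiv_factor (\<lambda>a b c x. sig2_factor k l m (eval_aff \<alpha>1 a b c) (eval_aff \<alpha>2 a b c) (eval_aff \<alpha>3 a b c))"
      unfolding sig2_factor_def by (intro intros shift)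
  next
    fix a b c x :: complex assume *: "standing a b c" "x \<noteq> 0" "x \<noteq> 1"
    show "Rcan_map z a b c x = sig2_factor k l m (eval_aff \<alpha>1 a b c) (eval_aff \<alpha>2 a b c) (eval_aff \<alpha>3 a b c)
        * Rcan_map (sig2 z) a b c x"
      using Rcan_sig2[OF st[OF *(1)], of "eval_x \<beta> x" k l m] eval_x_nontrivial[OF *(2,3)] eval_x_one_minus[OF *(2,3)]
      by (simp add: z eval_aff_arith diff_add_eq)
  qed
  show "linked z (sig3 z)"
  proof (rule linkedI[OF equiv_factor_1])
    fix a b c x :: complex assume *: "standing a b c" "x \<noteq> 0" "x \<noteq> 1"
    show "Rcan_map z a b c x = 1 * Rcan_map (sig3 z) a b c x"
      using Rcan_sig3[OF st[OF *(1)], of "eval_x \<beta> x" k l m] eval_x_nontrivial[OF *(2,3)]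
      by (simp add: z)
  qed
qed

section \<open>From the generators to the whole group\<close>

lemma x_div_xm1_invol: "x_div_xm1 (x_div_xm1 \<beta>) = \<beta>" and one_minus_invol: "one_minus (one_minus \<beta>) = \<beta>"
  by (cases \<beta>; simp)+

lemma gens_invol: "g \<in> gens \<Longrightarrow> g (g z) = z"
  unfolding gens_def by (cases z) (auto simp: x_div_xm1_invol one_minus_invol)

lemma gens_bij: "g \<in> gens \<Longrightarrow> bij g"
  using gens_invol by (intro o_bij[of g g]) auto

lemma gens_inv: "g \<in> gens \<Longrightarrow> inv g = g"
  using gens_invol by (intro inv_unique_comp) auto

lemma gens_admissible_linked: "g \<in> gens \<Longrightarrow> admissible z \<Longrightarrow> admissible (g z) \<and> linked z (g z)"
  unfolding gens_def
  using admissible_sig0 admissible_sig1 admissible_sig2 admissible_sig3 linked_sig by auto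

text \<open>The inverse of g composed with \<sigma> applies g first and \<open>inv \<sigma>\<close>
  afterwards. The induction therefore moves the point, which is why it is stated for all admissible
  points and not just for the base point.\<close>

lemma Gt_admissible_linked:
  assumes "\<sigma> \<in> Gt"
  shows "bij \<sigma> \<and> (\<forall>z. admissible z \<longrightarrow> admissible (inv \<sigma> z) \<and> linked z (inv \<sigma> z))"
proof -
  have step: "bij (g \<circ> \<sigma>) \<and> (\<forall>z. admissible z \<longrightarrow> admissible (inv (g \<circ> \<sigma>) z) \<and> linked z (inv (g \<circ> \<sigma>) z))"
    if IH: "bij \<sigma> \<and> (\<forall>z. admissible z \<longrightarrow> admissible (inv \<sigma> z) \<and> linked z (inv \<sigma> z))" and g: "g \<in> gens" for g \<sigma>
  proof -
    have "inv (g \<circ> \<sigma>) = inv \<sigma> \<circ> g"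
      using IH gens_bij[OF g] gens_inv[OF g] by (simp add: o_inv_distrib)
    then show ?thesis
      using IH gens_admissible_linked[OF g] gens_bij[OF g] by (auto intro: bij_comp linked_trans)
  qed
  show ?thesis
    using assms
  proof induction
    case Gt_id
    show ?case by (simp add: linked_refl bij_id[unfolded id_def])
  next
    case (Gt_gen \<sigma> g)
    then show ?case by (intro step)
  next
    case (Gt_inv \<sigma> g)
    then show ?case by (simp only: gens_inv) (intro step)
  qed
qed

text \<open>The six transforms of x have poles only at 0 and 1, and these are simple, so a power of
  x * (1 - x) serves as common denominator.\<close>

lemma polyfun4_substitute:
  assumes "polyfun4 p"
  shows "\<exists>p' n. polyfun4 p' \<and> (\<forall>a b c x. x \<noteq> 0 \<longrightarrow> x \<noteq> 1 \<longrightarrow>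
     p (eval_aff \<alpha>1 a b c) (eval_aff \<alpha>2 a b c) (eval_aff \<alpha>3 a b c) (eval_x \<beta> x) = p' a b c x / (x * (1 - x)) ^ n)"
  using assms
proof induction
  case (pconst k)
  show ?case by (rule exI[of _ "\<lambda>a b c x. k"], rule exI[of _ 0]) (simp add: polyfun4.pconst)
next
  case pvar_a
  show ?case by (rule exI[of _ "\<lambda>a b c x. eval_aff \<alpha>1 a b c"], rule exI[of _ 0]) (simp add: polyfun4_eval_aff)
next
  case pvar_b
  show ?case by (rule exI[of _ "\<lambda>a b c x. eval_aff \<alpha>2 a b c"], rule exI[of _ 0]) (simp add: polyfun4_eval_aff)
next
  case pvar_c
  show ?case by (rule exI[of _ "\<lambda>a b c x. eval_aff \<alpha>3 a b c"], rule exI[of _ 0]) (simp add: polyfun4_eval_aff)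
next
  case pvar_x
  \<comment> \<open>This is \<open>eval_x \<beta> x\<close> multiplied by x * (1 - x), in polynomial
    form for each of the six cases.\<close>
  define r where "r = (\<lambda>(a :: complex) (b :: complex) (c :: complex) x :: complex. case \<beta> of XId \<Rightarrow> x * (x * (1 - x)) | XDivXm1 \<Rightarrow> - (x * x) | OneMinusX \<Rightarrow> (1 - x) * (x * (1 - x))
     | Xm1DivX \<Rightarrow> - ((1 - x) * (1 - x)) | InvX \<Rightarrow> 1 - x | InvOneMinusX \<Rightarrow> x)"
  have "polyfun4 r"
    unfolding r_def by (cases \<beta>) (simp_all del: minus_diff_eq mult_minus_left, (intro polyfun4_intros)+)
  moreover have "eval_x \<beta> x = r a b c x / (x * (1 - x)) ^ 1" if "x \<noteq> 0" "x \<noteq> 1" for a b c x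
    using that by (cases \<beta>) (simp_all add: r_def field_simps)
  ultimately show ?case by blast
next
  case (padd p q)
  then obtain p' n q' n' where p': "polyfun4 p'" "polyfun4 q'" and eq: "\<And>a b c x. x \<noteq> 0 \<Longrightarrow> x \<noteq> 1 \<Longrightarrow>
     p (eval_aff \<alpha>1 a b c) (eval_aff \<alpha>2 a b c) (eval_aff \<alpha>3 a b c) (eval_x \<beta> x) = p' a b c x / (x * (1 - x)) ^ n"
     "\<And>a b c x. x \<noteq> 0 \<Longrightarrow> x \<noteq> 1 \<Longrightarrow>
     q (eval_aff \<alpha>1 a b c) (eval_aff \<alpha>2 a b c) (eval_aff \<alpha>3 a b c) (eval_x \<beta> x) = q' a b c x / (x * (1 - x)) ^ n'"
    by blast
  have pow: "polyfun4 (\<lambda>a b c x. (x * (1 - x)) ^ n)" for n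
  proof (induction n)
    case (Suc n)
    then show ?case by (simp only: power_Suc) (intro polyfun4_intros)
  qed (simp add: polyfun4.pconst)
  show ?case
  proof (rule exI[of _ "\<lambda>a b c x. p' a b c x * (x * (1 - x)) ^ n' + q' a b c x * (x * (1 - x)) ^ n"],
      rule exI[of _ "n + n'"], intro conjI allI impI)
    show "polyfun4 (\<lambda>a b c x. p' a b c x * (x * (1 - x)) ^ n' + q' a b c x * (x * (1 - x)) ^ n)"
      by (intro polyfun4.padd polyfun4.pmult[OF p'(1)] polyfun4.pmult[OF p'(2)] pow)
  next
    fix a b c x :: complex assume x: "x \<noteq> 0" "x \<noteq> 1"
    then have "x * (1 - x) \<noteq> 0" by simp
    then show "p (eval_aff \<alpha>1 a b c) (eval_aff \<alpha>2 a b c) (eval_aff \<alpha>3 a b c) (eval_x \<beta> x)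
       + q (eval_aff \<alpha>1 a b c) (eval_aff \<alpha>2 a b c) (eval_aff \<alpha>3 a b c) (eval_x \<beta> x)
       = (p' a b c x * (x * (1 - x)) ^ n' + q' a b c x * (x * (1 - x)) ^ n) / (x * (1 - x)) ^ (n + n')"
      unfolding eq[OF x] by (simp only: power_add add_frac_eq power_not_zero not_False_eq_True)
  qed
next
  case (pmult p q)
  then obtain p' n q' n' where p': "polyfun4 p'" "polyfun4 q'" and eq: "\<And>a b c x. x \<noteq> 0 \<Longrightarrow> x \<noteq> 1 \<Longrightarrow>
     p (eval_aff \<alpha>1 a b c) (eval_aff \<alpha>2 a b c) (eval_aff \<alpha>3 a b c) (eval_x \<beta> x) = p' a b c x / (x * (1 - x)) ^ n"
     "\<And>a b c x. x \<noteq> 0 \<Longrightarrow> x \<noteq> 1 \<Longrightarrow>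
     q (eval_aff \<alpha>1 a b c) (eval_aff \<alpha>2 a b c) (eval_aff \<alpha>3 a b c) (eval_x \<beta> x) = q' a b c x / (x * (1 - x)) ^ n'"
    by blast
  show ?case
  proof (rule exI[of _ "\<lambda>a b c x. p' a b c x * q' a b c x"], rule exI[of _ "n + n'"], intro conjI allI impI)
    show "polyfun4 (\<lambda>a b c x. p' a b c x * q' a b c x)" using p' by (rule polyfun4.pmult)
  next
    fix a b c x :: complex assume x: "x \<noteq> 0" "x \<noteq> 1"
    show "p (eval_aff \<alpha>1 a b c) (eval_aff \<alpha>2 a b c) (eval_aff \<alpha>3 a b c) (eval_x \<beta> x)
       * q (eval_aff \<alpha>1 a b c) (eval_aff \<alpha>2 a b c) (eval_aff \<alpha>3 a b c) (eval_x \<beta> x)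
       = p' a b c x * q' a b c x / (x * (1 - x)) ^ (n + n')"
      unfolding eq[OF x] by (simp only: power_add times_divide_times_eq)
  qed
qed

lemma eval_x_surj:
  assumes "y \<noteq> 0" "y \<noteq> 1"
  obtains x where "x \<noteq> 0" "x \<noteq> 1" "eval_x \<beta> x = y"
proof -
  \<comment> \<open>Four of the transforms are involutions; the other two have order three and are
    inverse to each other.\<close>
  define \<beta>' where "\<beta>' = (case \<beta> of Xm1DivX \<Rightarrow> InvOneMinusX | InvOneMinusX \<Rightarrow> Xm1DivX | _ \<Rightarrow> \<beta>)"
  have "eval_x \<beta> (eval_x \<beta>' y) = y"
    using assms by (cases \<beta>) (auto simp: \<beta>'_def divide_simps)
  then show ?thesis using that eval_x_nontrivial[OF assms, of \<beta>'] by blast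
qed

text \<open>Carries the comparison of \<open>Rcoef\<close> with \<open>Rcan\<close> through a
  substitution. The polynomial r collects the substituted denominator and the exceptional points 0
  and 1.\<close>

lemma Rmap_Rcan_map:
  assumes adm: "admissible z"
  obtains r where "rational (Rmap z)" "polyfun4 r" "r \<noteq> (\<lambda>a b c x. 0)"
    "\<And>a b c x. r a b c x \<noteq> 0 \<Longrightarrow> x \<noteq> 0 \<and> x \<noteq> 1"
    "\<And>a b c x. standing a b c \<Longrightarrow> r a b c x \<noteq> 0 \<Longrightarrow> Rmap z a b c x = Rcan_map z a b c x"
proof -
  obtain k l m \<alpha>1 \<alpha>2 \<alpha>3 \<beta> where z: "z = Spt k l m \<alpha>1 \<alpha>2 \<alpha>3 \<beta>" by (cases z)
  define sub :: "fun4 \<Rightarrow> fun4" where "sub = (\<lambda>p a b c x. p (eval_aff \<alpha>1 a b c) (eval_aff \<alpha>2 a b c) (eval_aff \<alpha>3 a b c) (eval_x \<beta> x))"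
  obtain p q where pq: "polyfun4 p" "polyfun4 q" "q \<noteq> (\<lambda>a b c x. 0)"
    and R: "Rcoef k l m = (\<lambda>a b c x. p a b c x / q a b c x)"
    and Rcan: "\<And>a b c x. standing a b c \<Longrightarrow> x \<noteq> 0 \<Longrightarrow> x \<noteq> 1 \<Longrightarrow> q a b c x \<noteq> 0 \<Longrightarrow> Rcoef k l m a b c x = Rcan k l m a b c x"
    by (rule Rcoef_Rcan[of k l m]) blast
  obtain p' n where p': "polyfun4 p'" "\<And>a b c x. x \<noteq> 0 \<Longrightarrow> x \<noteq> 1 \<Longrightarrow> sub p a b c x = p' a b c x / (x * (1 - x)) ^ n"
    using polyfun4_substitute[OF pq(1)] unfolding sub_def by blast
  obtain q' n' where q': "polyfun4 q'" "\<And>a b c x. x \<noteq> 0 \<Longrightarrow> x \<noteq> 1 \<Longrightarrow> sub q a b c x = q' a b c x / (x * (1 - x)) ^ n'"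
    using polyfun4_substitute[OF pq(2)] unfolding sub_def by blast
  have x: "polyfun4 (\<lambda>a b c x. x * (1 - x))" "(\<lambda>(a::complex) (b::complex) (c::complex) (x::complex). x * (1 - x)) \<noteq> (\<lambda>a b c x. 0)"
    by (intro polyfun4_intros) (auto simp: fun_eq_iff intro!: exI[of _ 2])
  \<comment> \<open>A point where q does not vanish, with last coordinate other than 0 and 1, is
    pulled back along the surjective substitution; this shows that the substituted denominator is
    not identically zero.\<close>
  from polyfun4_mult_nonzero[OF pq(2) x(1) pq(3) x(2)]
  obtain a' b' c' y where y: "q a' b' c' y \<noteq> 0" "y \<noteq> 0" "y \<noteq> 1" by (auto simp: fun_eq_iff)
  obtain a b c where abc: "eval_aff \<alpha>1 a b c = a'" "eval_aff \<alpha>2 a b c = b'" "eval_aff \<alpha>3 a b c = c'"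
    using adm unfolding z by simp blast
  obtain t where t: "t \<noteq> 0" "t \<noteq> 1" "eval_x \<beta> t = y" using y(2,3) by (rule eval_x_surj)
  have "sub q a b c t \<noteq> 0" using y abc t by (simp add: sub_def)
  then have "q' a b c t \<noteq> 0" using q'(2) t by auto
  then have q'0: "q' \<noteq> (\<lambda>a b c x. 0)" by auto
  define r where "r = (\<lambda>a b c x. q' a b c x * (x * (1 - x)))"
  have r: "polyfun4 r" "r \<noteq> (\<lambda>a b c x. 0)"
    unfolding r_def using pmult[OF q'(1) x(1)] polyfun4_mult_nonzero[OF q'(1) x(1) q'0 x(2)] by simp_all
  have r0: "x \<noteq> 0 \<and> x \<noteq> 1" if "r a b c x \<noteq> 0" for a b c x using that by (auto simp: r_def)
  have "rational (\<lambda>a b c x. p' a b c x / (x * (1 - x)) ^ n / (q' a b c x / (x * (1 - x)) ^ n'))"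
    by (intro rational_divide rational_power rational_polyfun4 p' q' x)
  then obtain P Q where PQ: "polyfun4 P" "polyfun4 Q" "Q \<noteq> (\<lambda>a b c x. 0)"
    "\<And>a b c x. Q a b c x \<noteq> 0 \<Longrightarrow> p' a b c x / (x * (1 - x)) ^ n / (q' a b c x / (x * (1 - x)) ^ n') = P a b c x / Q a b c x"
    by (rule rationalE) blast
  have Rmap: "Rmap z a b c x = sub p a b c x / sub q a b c x" for a b c x
    by (simp add: z R sub_def)
  have "rational (Rmap z)"
  proof (rule rationalI[OF pmult[OF PQ(1) r(1)] pmult[OF PQ(2) r(1)] polyfun4_mult_nonzero[OF PQ(2) r(1) PQ(3) r(2)]])
    fix a b c x assume "Q a b c x * r a b c x \<noteq> 0"
    then show "Rmap z a b c x = P a b c x * r a b c x / (Q a b c x * r a b c x)"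
      using PQ(4)[of a b c x] r0[of a b c x] p'(2) q'(2) unfolding Rmap by simp
  qed
  moreover have "Rmap z a b c x = Rcan_map z a b c x" if "standing a b c" "r a b c x \<noteq> 0" for a b c x
  proof -
    have "x \<noteq> 0" "x \<noteq> 1" "q' a b c x \<noteq> 0" using that(2) by (auto simp: r_def)
    then have "sub q a b c x \<noteq> 0" using q'(2) by simp
    moreover have "standing (eval_aff \<alpha>1 a b c) (eval_aff \<alpha>2 a b c) (eval_aff \<alpha>3 a b c)"
      using adm that(1) by (simp add: z)
    ultimately show ?thesis
      using Rcan eval_x_nontrivial[OF \<open>x \<noteq> 0\<close> \<open>x \<noteq> 1\<close>] by (simp add: z sub_def)
  qed
  ultimately show ?thesis using that r r0 by blast
qed

lemma Rmap_base: "Rmap (base k l m) = Rcoef k l m"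
  by (simp add: base_def fun_eq_iff)

lemma Rcan_map_base: "Rcan_map (base k l m) = Rcan k l m"
  by (simp add: base_def fun_eq_iff)

lemma generically_Rcoef_eq:
  assumes adm: "admissible z" and f: "rational f"
    and eq: "\<And>a b c x. standing a b c \<Longrightarrow> x \<noteq> 0 \<Longrightarrow> x \<noteq> 1 \<Longrightarrow> Rcan k l m a b c x = f a b c x * Rcan_map z a b c x"
  shows "generically (\<lambda>a b c x. Rcoef k l m a b c x = f a b c x * Rmap z a b c x)"
proof -
  obtain r where r: "rational (Rmap z)" "polyfun4 r" "r \<noteq> (\<lambda>a b c x. 0)"
    "\<And>a b c x. r a b c x \<noteq> 0 \<Longrightarrow> x \<noteq> 0 \<and> x \<noteq> 1"
    "\<And>a b c x. standing a b c \<Longrightarrow> r a b c x \<noteq> 0 \<Longrightarrow> Rmap z a b c x = Rcan_map z a b c x"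
    using adm by (rule Rmap_Rcan_map) blast
  obtain r' where r': "rational (Rcoef k l m)" "polyfun4 r'" "r' \<noteq> (\<lambda>a b c x. 0)"
    "\<And>a b c x. standing a b c \<Longrightarrow> r' a b c x \<noteq> 0 \<Longrightarrow> Rcoef k l m a b c x = Rcan k l m a b c x"
    by (rule Rmap_Rcan_map[OF admissible_base[of k l m]]) (metis Rmap_base Rcan_map_base)
  show ?thesis
    by (rule generically_eqI[OF r'(1) rational_mult[OF f r(1)] pmult[OF r(2) r'(2)]
          polyfun4_mult_nonzero[OF r(2) r'(2) r(3) r'(3)]])
      (use r r' eq in auto)
qed

subsection \<open>The order of the group\<close>

text \<open>The symmetries \<open>\<sigma>\<^sub>1, \<sigma>\<^sub>2, \<sigma>\<^sub>3\<close> generate a Coxeter group of type \<open>B\<^sub>3\<close>, which has six cosets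
  of the dihedral group \<open>\<langle>\<sigma>\<^sub>1, \<sigma>\<^sub>3\<rangle>\<close> of order eight; \<open>\<sigma>\<^sub>0\<close> is central.\<close>

definition cosets :: "(spt \<Rightarrow> spt) list" where
  "cosets = [id, sig2, sig1 \<circ> sig2, sig3 \<circ> (sig1 \<circ> sig2), sig1 \<circ> (sig3 \<circ> (sig1 \<circ> sig2)),
     sig2 \<circ> (sig1 \<circ> (sig3 \<circ> (sig1 \<circ> sig2)))]"

definition dihedral :: "(spt \<Rightarrow> spt) list" where
  "dihedral = [id, sig1, sig3, sig1 \<circ> sig3, sig3 \<circ> sig1, sig1 \<circ> (sig3 \<circ> sig1), sig3 \<circ> (sig1 \<circ> sig3),
     sig1 \<circ> (sig3 \<circ> (sig1 \<circ> sig3))]"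

definition elements :: "(spt \<Rightarrow> spt) list" where
  "elements = map (\<lambda>(r, h, z). r \<circ> (h \<circ> z)) (List.product cosets (List.product dihedral [id, sig0]))"

lemma set_elements: "set elements = {r \<circ> (h \<circ> z) | r h z. r \<in> set cosets \<and> h \<in> set dihedral \<and> z \<in> {id, sig0}}"
  unfolding elements_def by (auto simp: image_iff) blast+

lemma sig_invol: "sig1 (sig1 s) = s" "sig2 (sig2 s) = s" "sig3 (sig3 s) = s" "sig0 (sig0 s) = s"
  using gens_invol[of _ s] by (simp_all add: gens_def)

lemma sig0_central: "sig0 (sig1 s) = sig1 (sig0 s)" "sig0 (sig2 s) = sig2 (sig0 s)" "sig0 (sig3 s) = sig3 (sig0 s)"
  by (cases s rule: sig1.cases; simp; (case_tac a; case_tac b; case_tac c; simp)?)+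

lemma spt_exhaust:
  obtains k l m a0 a1 a2 a3 b0 b1 b2 b3 c0 c1 c2 c3 x
  where "s = Spt k l m (a0, a1, a2, a3) (b0, b1, b2, b3) (c0, c1, c2, c3) x"
  by (cases s) (metis prod_cases4)

lemma sig_dihedral:
  "sig3 (sig1 (sig3 (sig1 s))) = sig1 (sig3 (sig1 (sig3 s)))"
  by (cases s rule: spt_exhaust) simp

text \<open>The second and fourth equations are the Coxeter relations involving \<open>sig2\<close>;
  together with \<open>sig_dihedral\<close> and the involutions they imply the others. The list is
  the part of the coset table in which a generator has to be moved to the right.\<close>

lemma sig_cosets:
  "sig1 (sig2 (sig1 (sig3 (sig1 (sig2 s))))) = sig2 (sig1 (sig3 (sig1 (sig2 (sig1 s)))))"
  "sig2 (sig1 (sig2 s)) = sig1 (sig2 (sig1 s))"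
  "sig2 (sig3 (sig1 (sig2 s))) = sig3 (sig1 (sig2 (sig1 s)))"
  "sig3 (sig2 s) = sig2 (sig3 s)"
  "sig3 (sig1 (sig3 (sig1 (sig2 s)))) = sig1 (sig3 (sig1 (sig2 (sig3 s))))"
  "sig3 (sig2 (sig1 (sig3 (sig1 (sig2 s))))) = sig2 (sig1 (sig3 (sig1 (sig2 (sig3 s)))))"
  by (cases s rule: spt_exhaust; cases "case s of Spt _ _ _ _ _ _ x \<Rightarrow> x"; simp)+

lemma dihedral_closed:
  assumes "h \<in> set dihedral" "g \<in> {id, sig1, sig3}"
  shows "g \<circ> h \<in> set dihedral"
proof -
  have invol: "sig1 \<circ> (sig1 \<circ> f) = f" "sig3 \<circ> (sig3 \<circ> f) = f" "sig1 \<circ> sig1 = id" "sig3 \<circ> sig3 = id"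
    for f :: "spt \<Rightarrow> spt"
    by (simp_all add: fun_eq_iff sig_invol)
  have braid: "sig3 \<circ> (sig1 \<circ> (sig3 \<circ> sig1)) = sig1 \<circ> (sig3 \<circ> (sig1 \<circ> sig3))"
    "sig3 \<circ> (sig1 \<circ> (sig3 \<circ> (sig1 \<circ> sig3))) = sig1 \<circ> (sig3 \<circ> sig1)"
    by (simp_all add: fun_eq_iff sig_dihedral sig_invol)
  show ?thesis
    using assms unfolding dihedral_def by (elim insertE emptyE; simp only: list.set insert_iff empty_iff; elim disjE FalseE; simp add: invol braid)
qed

text \<open>Coset enumeration: a generator multiplied from the left permutes the representatives up
  to a single letter of the dihedral subgroup on the right.\<close>

lemma cosets_step:
  assumes "r \<in> set cosets" "g \<in> {sig1, sig2, sig3}"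
  shows "\<exists>r' \<in> set cosets. \<exists>h \<in> {id, sig1, sig3}. g \<circ> r = r' \<circ> h"
proof -
  have invol: "sig1 \<circ> (sig1 \<circ> f) = f" "sig2 \<circ> (sig2 \<circ> f) = f" "sig3 \<circ> (sig3 \<circ> f) = f" "sig2 \<circ> sig2 = id"
    for f :: "spt \<Rightarrow> spt"
    by (simp_all add: fun_eq_iff sig_invol)
  have moves:
    "sig1 \<circ> (sig2 \<circ> (sig1 \<circ> (sig3 \<circ> (sig1 \<circ> sig2)))) = (sig2 \<circ> (sig1 \<circ> (sig3 \<circ> (sig1 \<circ> sig2)))) \<circ> sig1"
    "sig2 \<circ> (sig1 \<circ> sig2) = (sig1 \<circ> sig2) \<circ> sig1"
    "sig2 \<circ> (sig3 \<circ> (sig1 \<circ> sig2)) = (sig3 \<circ> (sig1 \<circ> sig2)) \<circ> sig1"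
    "sig3 \<circ> sig2 = sig2 \<circ> sig3"
    "sig3 \<circ> (sig1 \<circ> (sig3 \<circ> (sig1 \<circ> sig2))) = (sig1 \<circ> (sig3 \<circ> (sig1 \<circ> sig2))) \<circ> sig3"
    "sig3 \<circ> (sig2 \<circ> (sig1 \<circ> (sig3 \<circ> (sig1 \<circ> sig2)))) = (sig2 \<circ> (sig1 \<circ> (sig3 \<circ> (sig1 \<circ> sig2)))) \<circ> sig3"
    by (simp_all only: fun_eq_iff comp_apply sig_cosets) simp_all
  have "\<forall>g\<in>{sig1, sig2, sig3}. \<forall>r\<in>set cosets. g \<circ> r \<in> set cosets
      \<or> g \<circ> r \<in> (\<lambda>r. r \<circ> sig1) ` set cosets \<or> g \<circ> r \<in> (\<lambda>r. r \<circ> sig3) ` set cosets"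
    unfolding cosets_def by (simp add: invol moves)
  then have "g \<circ> r \<in> set cosets \<or> g \<circ> r \<in> (\<lambda>r. r \<circ> sig1) ` set cosets \<or> g \<circ> r \<in> (\<lambda>r. r \<circ> sig3) ` set cosets"
    using assms by blast
  then show ?thesis
  proof (elim disjE)
    assume "g \<circ> r \<in> set cosets"
    then show ?thesis by (intro bexI[of _ "g \<circ> r"] bexI[of _ id]) simp_all
  qed blast+
qed

lemma sig0_commutes:
  assumes "f \<in> set cosets \<union> set dihedral"
  shows "sig0 \<circ> f = f \<circ> sig0"
  using assms unfolding cosets_def dihedral_def by (auto simp: fun_eq_iff sig0_central)

lemma gens_elements:
  assumes "g \<in> gens" "\<sigma> \<in> set elements"
  shows "g \<circ> \<sigma> \<in> set elements"
proof -
  obtain r h z where \<sigma>: "\<sigma> = r \<circ> (h \<circ> z)" and r: "r \<in> set cosets" and h: "h \<in> set dihedral" and z: "z \<in> {id, sig0}"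
    using assms(2) unfolding set_elements by blast
  show ?thesis
  proof (cases "g = sig0")
    case True
    have "sig0 \<circ> (r \<circ> (h \<circ> z)) = (sig0 \<circ> r) \<circ> (h \<circ> z)" by (simp add: comp_assoc)
    also have "\<dots> = r \<circ> ((sig0 \<circ> h) \<circ> z)" using sig0_commutes[of r] r by (simp add: comp_assoc)
    also have "\<dots> = r \<circ> (h \<circ> (sig0 \<circ> z))" using sig0_commutes[of h] h by (simp add: comp_assoc)
    finally have "g \<circ> \<sigma> = r \<circ> (h \<circ> (sig0 \<circ> z))" using True \<sigma> by simp
    moreover have "sig0 \<circ> z \<in> {id, sig0}" using z by (auto simp: fun_eq_iff sig_invol)
    ultimately show ?thesis using r h unfolding set_elements by blast
  next
    case False
    then obtain r' g' where r': "r' \<in> set cosets" and g': "g' \<in> {id, sig1, sig3}" and eq: "g \<circ> r = r' \<circ> g'"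
      using cosets_step[OF r, of g] assms(1) unfolding gens_def by blast
    have "g \<circ> \<sigma> = r' \<circ> ((g' \<circ> h) \<circ> z)"
      using eq unfolding \<sigma> by (metis comp_assoc)
    then show ?thesis using r' dihedral_closed[OF h g'] z unfolding set_elements by blast
  qed
qed

lemma Gt_comp: "\<sigma> \<in> Gt \<Longrightarrow> \<tau> \<in> Gt \<Longrightarrow> \<sigma> \<circ> \<tau> \<in> Gt"
  by (induction rule: Gt.induct) (auto simp: comp_assoc intro: Gt.intros)

lemma gens_Gt: "g \<in> gens \<Longrightarrow> g \<in> Gt"
  using Gt_gen[OF Gt_id, of g] by simp

lemma Gt_elements: "Gt = set elements"
proof (intro equalityI subsetI)
  fix \<sigma> assume "\<sigma> \<in> Gt"
  then show "\<sigma> \<in> set elements"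
  proof induction
    case Gt_id
    show ?case unfolding set_elements
      by (intro CollectI exI[of _ id] conjI) (simp_all add: cosets_def dihedral_def fun_eq_iff)
  next
    case (Gt_gen \<sigma> g)
    then show ?case by (intro gens_elements)
  next
    case (Gt_inv \<sigma> g)
    then show ?case by (simp only: gens_inv gens_elements)
  qed
next
  fix \<sigma> assume "\<sigma> \<in> set elements"
  then obtain r h z where \<sigma>: "\<sigma> = r \<circ> (h \<circ> z)" and r: "r \<in> set cosets" and h: "h \<in> set dihedral" and z: "z \<in> {id, sig0}"
    unfolding set_elements by blast
  have gen: "sig0 \<in> Gt" "sig1 \<in> Gt" "sig2 \<in> Gt" "sig3 \<in> Gt"
    by (auto intro: gens_Gt simp: gens_def)
  have "r \<in> Gt" using r unfolding cosets_def by (auto intro!: Gt_comp gen Gt_id)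
  moreover have "h \<in> Gt" using h unfolding dihedral_def by (auto intro!: Gt_comp gen Gt_id)
  moreover have "z \<in> Gt" using z gen Gt_id by auto
  ultimately show "\<sigma> \<in> Gt" unfolding \<sigma> by (intro Gt_comp)
qed

text \<open>One point with 96 different images suffices. Its indices must be far from special
  positions: \<open>sig0\<close>, for instance, fixes \<open>base 1 1 1\<close>.\<close>

lemma distinct_elements: "distinct elements"
proof -
  have "distinct (map (\<lambda>f. f (base 5 17 100)) elements)"
    unfolding elements_def cosets_def dihedral_def base_def
    by code_simp
  then show ?thesis by (simp add: distinct_map)
qed

lemma card_Gt: "card Gt = 96"
  unfolding Gt_elements distinct_card[OF distinct_elements]
  by (simp add: elements_def cosets_def dihedral_def)

theorem theorem1p2:
  shows "card Gt = 96 \<and>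
    (\<forall>\<sigma>\<in>Gt. \<forall>k l m. \<exists>(ps :: (aff \<times> int) list) n1 n2 n3.
        generically (\<lambda>a b c x. Rcoef k l m a b c x =
          (\<Prod>(\<alpha>, n)\<leftarrow>ps. poch (eval_aff \<alpha> a b c) n) * (-1) powi n1 * x powi n2 * (1 - x) powi n3
          * act \<sigma> Rmap (base k l m) a b c x)) \<and>
    (\<forall>k l m. generically (\<lambda>a b c x. Rcoef k l m a b c x =
        poch (c + 1) (m - 1) * poch c (m - 1) * (-1) powi (m - k - l) * x powi (1 - m)
          * (1 - x) powi (m + 1 - k - l)
        / (poch (a + 1) (k - 1) * poch (b + 1) (l - 1) * poch (c - a) (m - k) * poch (c - b) (m - l))
        * act sig0 Rmap (base k l m) a b c x)) \<and>
    (\<forall>k l m. generically (\<lambda>a b c x. Rcoef k l m a b c x =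
        (1 - x) powi (- l) * act sig1 Rmap (base k l m) a b c x)) \<and>
    (\<forall>k l m. generically (\<lambda>a b c x. Rcoef k l m a b c x =
        poch c m * poch (c - a - b) (m - k - l) / (poch (c - a) (m - k) * poch (c - b) (m - l))
        * act sig2 Rmap (base k l m) a b c x)) \<and>
    (\<forall>k l m. generically (\<lambda>a b c x. Rcoef k l m a b c x = act sig3 Rmap (base k l m) a b c x))"
proof (intro conjI ballI allI)
  show "card Gt = 96" by (rule card_Gt)
next
  fix \<sigma> k l m
  assume "\<sigma> \<in> Gt"
  then have adm: "admissible (inv \<sigma> (base k l m))" and "linked (base k l m) (inv \<sigma> (base k l m))"
    using Gt_admissible_linked admissible_base by blast+
  then obtain f where f: "equiv_factor f" "\<And>a b c x. standing a b c \<Longrightarrow> x \<noteq> 0 \<Longrightarrow> x \<noteq> 1 \<Longrightarrow>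
      Rcan k l m a b c x = f a b c x * Rcan_map (inv \<sigma> (base k l m)) a b c x"
    unfolding linked_def Rcan_map_base by blast
  then obtain ps :: "(aff \<times> int) list" and n1 n2 n3 where ps: "\<And>a b c x. standing a b c \<Longrightarrow> x \<noteq> 0 \<Longrightarrow> x \<noteq> 1 \<Longrightarrow>
      f a b c x = (\<Prod>(\<alpha>, n)\<leftarrow>ps. poch (eval_aff \<alpha> a b c) n) * (-1) powi n1 * x powi n2 * (1 - x) powi n3"
    unfolding equiv_factor_def by blast
  have prod: "rational (\<lambda>a b c x. \<Prod>(\<alpha>, n)\<leftarrow>ps. poch (eval_aff \<alpha> a b c) n)"
  proof (induction ps)
    case Nil
    show ?case using rational_polyfun4[OF pconst[of 1]] by simp
  next
    case (Cons p ps)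
    then show ?case
      using rational_mult[OF rational_poch[OF polyfun4_eval_aff, of "fst p" "snd p"]]
      by (simp add: case_prod_unfold)
  qed
  have "rational (\<lambda>a b c x. (\<Prod>(\<alpha>, n)\<leftarrow>ps. poch (eval_aff \<alpha> a b c) n) * (-1) powi n1 * x powi n2 * (1 - x) powi n3)"
    by (intro rational_mult[OF rational_mult[OF rational_mult[OF prod]]] rational_power_int
        rational_polyfun4 polyfun4_intros)
  \<comment> \<open>The factor f is controlled only at permitted points. The explicit product agrees
    with it there and is known to be rational, so the product is what enters the generic
    identity.\<close>
  then have "generically (\<lambda>a b c x. Rcoef k l m a b c x =
      ((\<Prod>(\<alpha>, n)\<leftarrow>ps. poch (eval_aff \<alpha> a b c) n) * (-1) powi n1 * x powi n2 * (1 - x) powi n3)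
      * Rmap (inv \<sigma> (base k l m)) a b c x)"
    by (rule generically_Rcoef_eq[OF adm]) (simp only: f(2) ps not_False_eq_True)
  then show "\<exists>(ps :: (aff \<times> int) list) n1 n2 n3.
        generically (\<lambda>a b c x. Rcoef k l m a b c x =
          (\<Prod>(\<alpha>, n)\<leftarrow>ps. poch (eval_aff \<alpha> a b c) n) * (-1) powi n1 * x powi n2 * (1 - x) powi n3
          * act \<sigma> Rmap (base k l m) a b c x)"
    unfolding act_def by blast
next
  fix k l m
  have act: "act g Rmap (base k l m) = Rmap (g (base k l m))" if "g \<in> gens" for g
    using gens_inv[OF that] by (simp add: act_def)
  note rational = rational_divide rational_mult rational_power_int rational_poch rational_polyfun4 polyfun4_intros
  have "generically (\<lambda>a b c x. Rcoef k l m a b c x = sig0_factor k l m a b c x * Rmap (sig0 (base k l m)) a b c x)"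
  proof (rule generically_Rcoef_eq)
    show "rational (sig0_factor k l m)"
      unfolding sig0_factor_def[abs_def] by (intro rational)
    show "Rcan k l m a b c x = sig0_factor k l m a b c x * Rcan_map (sig0 (base k l m)) a b c x"
      if "standing a b c" "x \<noteq> 0" "x \<noteq> 1" for a b c x
      using Rcan_sig0[OF that, of k l m] by (simp add: base_def add.commute)
  qed (intro admissible_sig0 admissible_base)
  then show "generically (\<lambda>a b c x. Rcoef k l m a b c x =
        poch (c + 1) (m - 1) * poch c (m - 1) * (-1) powi (m - k - l) * x powi (1 - m)
          * (1 - x) powi (m + 1 - k - l)
        / (poch (a + 1) (k - 1) * poch (b + 1) (l - 1) * poch (c - a) (m - k) * poch (c - b) (m - l))
        * act sig0 Rmap (base k l m) a b c x)"
    by (simp add: act gens_def sig0_factor_def)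
  have "generically (\<lambda>a b c x. Rcoef k l m a b c x = (1 - x) powi (- l) * Rmap (sig1 (base k l m)) a b c x)"
  proof (rule generically_Rcoef_eq)
    show "rational (\<lambda>a b c x. (1 - x) powi (- l))"
      by (intro rational)
    show "Rcan k l m a b c x = (1 - x) powi (- l) * Rcan_map (sig1 (base k l m)) a b c x"
      if "standing a b c" "x \<noteq> 0" "x \<noteq> 1" for a b c x
      using Rcan_sig1[OF that, of k l m] by (simp add: base_def algebra_simps)
  qed (intro admissible_sig1 admissible_base)
  then show "generically (\<lambda>a b c x. Rcoef k l m a b c x = (1 - x) powi (- l) * act sig1 Rmap (base k l m) a b c x)"
    by (simp add: act gens_def)
  have "generically (\<lambda>a b c x. Rcoef k l m a b c x = sig2_factor k l m a b c * Rmap (sig2 (base k l m)) a b c x)"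
  proof (rule generically_Rcoef_eq)
    show "rational (\<lambda>a b c x. sig2_factor k l m a b c)"
      unfolding sig2_factor_def by (intro rational)
    show "Rcan k l m a b c x = sig2_factor k l m a b c * Rcan_map (sig2 (base k l m)) a b c x"
      if "standing a b c" "x \<noteq> 0" "x \<noteq> 1" for a b c x
      using Rcan_sig2[OF that, of k l m] by (simp add: base_def algebra_simps)
  qed (intro admissible_sig2 admissible_base)
  then show "generically (\<lambda>a b c x. Rcoef k l m a b c x =
        poch c m * poch (c - a - b) (m - k - l) / (poch (c - a) (m - k) * poch (c - b) (m - l))
        * act sig2 Rmap (base k l m) a b c x)"
    by (simp add: act gens_def sig2_factor_def)
  have "generically (\<lambda>a b c x. Rcoef k l m a b c x = 1 * Rmap (sig3 (base k l m)) a b c x)"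
  proof (rule generically_Rcoef_eq)
    show "rational (\<lambda>a b c x. 1)"
      by (intro rational)
    show "Rcan k l m a b c x = 1 * Rcan_map (sig3 (base k l m)) a b c x"
      if "standing a b c" "x \<noteq> 0" "x \<noteq> 1" for a b c x
      using Rcan_sig3[OF that, of k l m] by (simp add: base_def)
  qed (intro admissible_sig3 admissible_base)
  then show "generically (\<lambda>a b c x. Rcoef k l m a b c x = act sig3 Rmap (base k l m) a b c x)"
    by (simp add: act gens_def)
qed

end
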